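(* The functors $F \colon \mathbf{pCBool} \to \mathbf{pAWstar}$ and $\mathrm{Proj} \colon \mathbf{pAWstar} \to \mathbf{pCBool}$ form an equivalence between the category $\mathbf{pAWstar}$ of piecewise AW*-algebras and the category $\mathbf{pCBool}$ of piecewise complete Boolean algebras.
   Context: **AW*-algebras.** An AW*-algebra is a unital C*-algebra in which the right annihilator of every subset is generated as a right ideal by a projection. Its projections, ordered by $p \le q \iff p = pq$, form a complete lattice; $\mathrm{RP}(a)$ denotes the least projection $p$ with $ap=a$. **Piecewise AW*-algebras.** A piecewise C*-algebra is a set $A$ with a reflexive symmetric (commeasurability) relation $\odot \subseteq A \times A$, elements $0,1$, total functions ${}^* \colon A \to A$, $\cdot \colon \mathbb{C} \times A \to A$, $\|-\| \colon A \to \mathbb{R}$, and partial operations $+,\cdot \colon \odot \to A$, such that every set of pairwise commeasurable elements is contained in a set of pairwise commeasurable elements that forms a commutative C*-algebra under these operations. $\mathrm{Proj}(A)$ is its set of self-adjoint idempotents. A piecewise AW*-algebra is a piecewise C*-algebra with a function $\mathrm{RP} \colon A \to \mathrm{Proj}(A)$ and an operation $\bigvee \colon \{X \subseteq \mathrm{Proj}(A) \mid X \times X \subseteq \odot\} \to \mathrm{Proj}(A)$ such that every set of pairwise commeasurable elements is contained in a set of pairwise commeasurable elements that forms a commutative AW*-algebra under all these operations (including $\mathrm{RP}$ and $\bigvee$). A morphism is a function preserving $\odot$, sums and products of commeasurable elements, scalar multiples, the involution, $1$, and $\bigvee$ of pairwise commeasurable sets of projections. These form $\mathbf{pAWstar}$.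 **Piecewise complete Boolean algebras.** A piecewise complete Boolean algebra is a set $B$ with a reflexive symmetric relation $\odot \subseteq B \times B$, a function $\neg \colon B \to B$, and an operation $\bigvee \colon \{X \subseteq B \mid X \times X \subseteq \odot\} \to B$, such that every set of pairwise commeasurable elements is contained in a pairwise commeasurable set that forms a complete Boolean algebra under these operations. Morphisms preserve $\odot$, $\neg$ and $\bigvee$ (whenever defined). These form $\mathbf{pCBool}$. $\mathcal{C}(B)$ denotes the set of pairwise commeasurable subsets of $B$ that are closed under $\neg$ and $\bigvee$ (complete Boolean subalgebras). **The functors.** $\mathrm{Proj}$ sends $A$ to $\mathrm{Proj}(A)$ with the inherited $\odot$ and $\bigvee$ and $\neg p = 1-p$, and sends a morphism to its restriction. For a complete Boolean algebra $C$, let $\mathrm{Func}(C) = C(\mathrm{Stone}(C),\mathbb{C})$, where $\mathrm{Stone}(C)$ is the Stone space of Boolean homomorphisms $C \to \{0,1\}$; $\mathrm{Func}$ is functorial by precomposition. For $B \in \mathbf{pCBool}$, $F(B) = \big(\coprod_{C \in \mathcal{C}(B)} \mathrm{Func}(C)\big)/\!\sim$, with $\sim$ the smallest equivalence relation such that $f \sim \mathrm{Func}(C \hookrightarrow D)(f)$ for $C \subseteq D$ and $f \in \mathrm{Func}(C)$. Two classes are commeasurable when they have representatives in a common $\mathrm{Func}(C)$, and then sum and product are computed there; scalar multiples, involution, $0$, $1$ and norm are computed on representatives, as are $\mathrm{RP}$ and $\bigvee$ within the commutative AW*-algebras $\mathrm{Func}(C)$. For $g \colon B_1 \to B_2$ in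 $\mathbf{pCBool}$, $F(g)([f]) = [\mathrm{Func}(g|_C \colon C \to D)(f)]$ for $f \in \mathrm{Func}(C)$ and any $D \in \mathcal{C}(B_2)$ containing $g(C)$.
   Formalization: Piecewise AW*-algebras are additionally required to have unique limits: a Cauchy sequence in a commutative C*-subalgebra has exactly one limit in all of A, lying in that subalgebra; without this, two copies of l^∞ glued along finitely-valued sequences are a counterexample. *)

theory Defs
  imports
    "HOL-Analysis.Analysis"
    "HOL-Algebra.Complete_Lattice"
    "HOL-Algebra.Module"
begin

section \<open>Categories and functors\<close>

record ('o, 'm) cat =
  Obj :: "'o set"
  Hom :: "'o \<Rightarrow> 'o \<Rightarrow> 'm set"
  Ident :: "'o \<Rightarrow> 'm"
  Comp :: "'o \<Rightarrow> 'o \<Rightarrow> 'o \<Rightarrow> 'm \<Rightarrow> 'm \<Rightarrow> 'm"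
    \<comment> \<open>\<open>Comp C X Y Z g f\<close> is the composite of \<open>f : X \<rightarrow> Y\<close> and \<open>g : Y \<rightarrow> Z\<close>\<close>

definition is_category :: "('o, 'm) cat \<Rightarrow> bool" where
  "is_category C \<longleftrightarrow>
     (\<forall>X\<in>Obj C. Ident C X \<in> Hom C X X) \<and>
     (\<forall>X\<in>Obj C. \<forall>Y\<in>Obj C. \<forall>Z\<in>Obj C. \<forall>f\<in>Hom C X Y. \<forall>g\<in>Hom C Y Z.
        Comp C X Y Z g f \<in> Hom C X Z) \<and>
     (\<forall>X\<in>Obj C. \<forall>Y\<in>Obj C. \<forall>f\<in>Hom C X Y.
        Comp C X X Y f (Ident C X) = f \<and> Comp C X Y Y (Ident C Y) f = f) \<and>
     (\<forall>W\<in>Obj C. \<forall>X\<in>Obj C. \<forall>Y\<in>Obj C. \<forall>Z\<in>Obj C.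
        \<forall>f\<in>Hom C W X. \<forall>g\<in>Hom C X Y. \<forall>h\<in>Hom C Y Z.
        Comp C W Y Z h (Comp C W X Y g f) = Comp C W X Z (Comp C X Y Z h g) f)"

definition is_functor ::
  "('o, 'm) cat \<Rightarrow> ('p, 'n) cat \<Rightarrow> ('o \<Rightarrow> 'p) \<Rightarrow> ('o \<Rightarrow> 'o \<Rightarrow> 'm \<Rightarrow> 'n) \<Rightarrow> bool" where
  "is_functor C D Fo Fm \<longleftrightarrow>
     (\<forall>X\<in>Obj C. Fo X \<in> Obj D) \<and>
     (\<forall>X\<in>Obj C. \<forall>Y\<in>Obj C. \<forall>f\<in>Hom C X Y. Fm X Y f \<in> Hom D (Fo X) (Fo Y)) \<and>
     (\<forall>X\<in>Obj C. Fm X X (Ident C X) = Ident D (Fo X)) \<and>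
     (\<forall>X\<in>Obj C. \<forall>Y\<in>Obj C. \<forall>Z\<in>Obj C. \<forall>f\<in>Hom C X Y. \<forall>g\<in>Hom C Y Z.
        Fm X Z (Comp C X Y Z g f) = Comp D (Fo X) (Fo Y) (Fo Z) (Fm Y Z g) (Fm X Y f))"


section \<open>Piecewise AW*-algebras\<close>

text \<open>
  The partial operations are total HOL functions; their values are only ever used on
  commeasurable arguments (for \<open>pjoin\<close>: on pairwise commeasurable sets of projections).
\<close>

definition complex_ring :: "complex ring" where
  "complex_ring = \<lparr>carrier = UNIV, monoid.mult = (*), one = 1, zero = 0, add = (+)\<rparr>"

record 'a pCstar = "(complex, 'a) module" +
  comm :: "('a \<times> 'a) set"
  invol :: "'a \<Rightarrow> 'a"
  cnorm :: "'a \<Rightarrow> real"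

record 'a pAWstar = "'a pCstar" +
  rproj :: "'a \<Rightarrow> 'a"
  pjoin :: "'a set \<Rightarrow> 'a"

definition projections :: "('a, 'r) pCstar_scheme \<Rightarrow> 'a set" where
  "projections A = {p \<in> carrier A. invol A p = p \<and> p \<otimes>\<^bsub>A\<^esub> p = p}"

definition proj_order :: "('a, 'r) pCstar_scheme \<Rightarrow> 'a gorder" where
  "proj_order A = \<lparr>carrier = projections A, eq = (=), le = (\<lambda>p q. p = p \<otimes>\<^bsub>A\<^esub> q)\<rparr>"

definition is_RP :: "('a, 'r) pCstar_scheme \<Rightarrow> 'a \<Rightarrow> 'a \<Rightarrow> bool" where
  "is_RP A a p \<longleftrightarrow> least (proj_order A) p {q \<in> projections A. a \<otimes>\<^bsub>A\<^esub> q = a}"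

text \<open>Not \<open>\<ominus>\<close>: additive inverses need not be unique in the carrier of a partial algebra.\<close>

definition pminus :: "('a, 'r) pCstar_scheme \<Rightarrow> 'a \<Rightarrow> 'a \<Rightarrow> 'a" where
  "pminus A a b = a \<oplus>\<^bsub>A\<^esub> ((- 1) \<odot>\<^bsub>A\<^esub> b)"

definition norm_limit :: "('a, 'r) pCstar_scheme \<Rightarrow> (nat \<Rightarrow> 'a) \<Rightarrow> 'a \<Rightarrow> bool" where
  "norm_limit A s x \<longleftrightarrow>
     x \<in> carrier A \<and> (\<forall>n. (s n, x) \<in> comm A) \<and> (\<lambda>n. cnorm A (pminus A (s n) x)) \<longlonglongrightarrow> 0"

text \<open>
  Completeness of a subset \<open>T\<close> of \<open>A\<close> is read with limits taken in \<open>A\<close>: a Cauchy sequence in \<open>T\<close>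
  has exactly one limit in \<open>A\<close>, and that limit lies in \<open>T\<close>.  If limits were only considered
  inside \<open>T\<close>, then the result of glueing two copies of \<open>l\<^sup>\<infinity>\<close> along the simple
  sequences (those with finitely many values), with \<open>x\<close> and \<open>y\<close> commeasurable iff they lie in
  one of the two copies, would be a piecewise AW*-algebra; but swapping the copies is then a
  non-identity automorphism that fixes all projections, so \<open>Proj\<close> would not be faithful.
\<close>

definition comm_Cstar_on :: "('a, 'r) pCstar_scheme \<Rightarrow> 'a set \<Rightarrow> bool" where
  "comm_Cstar_on A T \<longleftrightarrow>
     algebra complex_ring (A\<lparr>carrier := T\<rparr>) \<and>
     (\<forall>a\<in>T. invol A a \<in> T \<and> invol A (invol A a) = a) \<and>
     (\<forall>a\<in>T. \<forall>b\<in>T. invol A (a \<oplus>\<^bsub>A\<^esub> b) = invol A a \<oplus>\<^bsub>A\<^esub> invol A b) \<and>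
     (\<forall>a\<in>T. \<forall>b\<in>T. invol A (a \<otimes>\<^bsub>A\<^esub> b) = invol A b \<otimes>\<^bsub>A\<^esub> invol A a) \<and>
     (\<forall>c. \<forall>a\<in>T. invol A (c \<odot>\<^bsub>A\<^esub> a) = cnj c \<odot>\<^bsub>A\<^esub> invol A a) \<and>
     (\<forall>a\<in>T. cnorm A a \<ge> 0 \<and> (cnorm A a = 0 \<longleftrightarrow> a = \<zero>\<^bsub>A\<^esub>)) \<and>
     (\<forall>a\<in>T. \<forall>b\<in>T. cnorm A (a \<oplus>\<^bsub>A\<^esub> b) \<le> cnorm A a + cnorm A b) \<and>
     (\<forall>c. \<forall>a\<in>T. cnorm A (c \<odot>\<^bsub>A\<^esub> a) = cmod c * cnorm A a) \<and>
     (\<forall>a\<in>T. \<forall>b\<in>T. cnorm A (a \<otimes>\<^bsub>A\<^esub> b) \<le> cnorm A a * cnorm A b) \<and>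
     (\<forall>a\<in>T. cnorm A (invol A a \<otimes>\<^bsub>A\<^esub> a) = (cnorm A a)\<^sup>2) \<and>
     (\<forall>s. range s \<subseteq> T \<and>
          (\<forall>e>0. \<exists>N. \<forall>m\<ge>N. \<forall>n\<ge>N. cnorm A (pminus A (s m) (s n)) < e) \<longrightarrow>
          (\<exists>x\<in>T. norm_limit A s x \<and> (\<forall>y. norm_limit A s y \<longrightarrow> y = x)))"

definition comm_AWstar_on :: "('a, 'r) pAWstar_scheme \<Rightarrow> 'a set \<Rightarrow> bool" where
  "comm_AWstar_on A T \<longleftrightarrow>
     comm_Cstar_on A T \<and>
     (\<forall>X\<subseteq>T. \<exists>p\<in>projections A \<inter> T.
        {b\<in>T. \<forall>x\<in>X. x \<otimes>\<^bsub>A\<^esub> b = \<zero>\<^bsub>A\<^esub>} = {p \<otimes>\<^bsub>A\<^esub> c | c. c \<in> T}) \<and>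
     (\<forall>a\<in>T. is_RP (A\<lparr>carrier := T\<rparr>) a (rproj A a)) \<and>
     (\<forall>X\<subseteq>projections A \<inter> T. is_lub (proj_order (A\<lparr>carrier := T\<rparr>)) (pjoin A X) X)"

definition is_pCstar :: "('a, 'r) pCstar_scheme \<Rightarrow> bool" where
  "is_pCstar A \<longleftrightarrow>
     comm A \<subseteq> carrier A \<times> carrier A \<and> (\<forall>a\<in>carrier A. (a, a) \<in> comm A) \<and> sym (comm A) \<and>
     \<zero>\<^bsub>A\<^esub> \<in> carrier A \<and> \<one>\<^bsub>A\<^esub> \<in> carrier A \<and>
     (\<forall>a\<in>carrier A. invol A a \<in> carrier A) \<and>
     (\<forall>c. \<forall>a\<in>carrier A. c \<odot>\<^bsub>A\<^esub> a \<in> carrier A) \<and>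
     (\<forall>(a, b)\<in>comm A. a \<oplus>\<^bsub>A\<^esub> b \<in> carrier A \<and> a \<otimes>\<^bsub>A\<^esub> b \<in> carrier A) \<and>
     (\<forall>X\<subseteq>carrier A. X \<times> X \<subseteq> comm A \<longrightarrow>
        (\<exists>T\<subseteq>carrier A. X \<subseteq> T \<and> T \<times> T \<subseteq> comm A \<and> comm_Cstar_on A T))"

definition is_pAWstar :: "'a pAWstar \<Rightarrow> bool" where
  "is_pAWstar A \<longleftrightarrow>
     is_pCstar A \<and>
     (\<forall>a\<in>carrier A. rproj A a \<in> projections A) \<and>
     (\<forall>X\<subseteq>projections A. X \<times> X \<subseteq> comm A \<longrightarrow> pjoin A X \<in> projections A) \<and>
     (\<forall>X\<subseteq>carrier A. X \<times> X \<subseteq> comm A \<longrightarrow>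
        (\<exists>T\<subseteq>carrier A. X \<subseteq> T \<and> T \<times> T \<subseteq> comm A \<and> comm_AWstar_on A T))"

text \<open>
  Morphisms are extensional functions, so that equal morphisms are equal HOL functions.
  Morphisms and isomorphisms may go between different carrier types, since \<open>F\<close> and \<open>F \<circ> Proj\<close> change
  the carrier type; \<open>pAWstar_cat\<close> and \<open>pCBool_cat\<close> consist of the objects over one arbitrary type.
\<close>

definition pAWstar_hom :: "'a pAWstar \<Rightarrow> 'c pAWstar \<Rightarrow> ('a \<Rightarrow> 'c) set" where
  "pAWstar_hom A A' = {g \<in> carrier A \<rightarrow>\<^sub>E carrier A'.
     (\<forall>(a, b)\<in>comm A. (g a, g b) \<in> comm A' \<and>
        g (a \<oplus>\<^bsub>A\<^esub> b) = g a \<oplus>\<^bsub>A'\<^esub> g b \<and> g (a \<otimes>\<^bsub>A\<^esub> b) = g a \<otimes>\<^bsub>A'\<^esub> g b) \<and>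
     (\<forall>c. \<forall>a\<in>carrier A. g (c \<odot>\<^bsub>A\<^esub> a) = c \<odot>\<^bsub>A'\<^esub> g a) \<and>
     (\<forall>a\<in>carrier A. g (invol A a) = invol A' (g a)) \<and>
     g \<one>\<^bsub>A\<^esub> = \<one>\<^bsub>A'\<^esub> \<and>
     (\<forall>X\<subseteq>projections A. X \<times> X \<subseteq> comm A \<longrightarrow> g (pjoin A X) = pjoin A' (g ` X))}"

definition pAWstar_cat :: "('a pAWstar, 'a \<Rightarrow> 'a) cat" where
  "pAWstar_cat = \<lparr>Obj = {A. is_pAWstar A}, Hom = pAWstar_hom,
     Ident = (\<lambda>A. \<lambda>a\<in>carrier A. a), Comp = (\<lambda>A A' A'' g f. compose (carrier A) g f)\<rparr>"

definition pAWstar_iso :: "'a pAWstar \<Rightarrow> 'c pAWstar \<Rightarrow> ('a \<Rightarrow> 'c) \<Rightarrow> bool" where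
  "pAWstar_iso A A' g \<longleftrightarrow> g \<in> pAWstar_hom A A' \<and>
     (\<exists>h\<in>pAWstar_hom A' A. compose (carrier A) h g = (\<lambda>a\<in>carrier A. a) \<and>
                           compose (carrier A') g h = (\<lambda>a\<in>carrier A'. a))"


section \<open>Piecewise complete Boolean algebras\<close>

record 'b pCBool = "'b partial_object" +
  bcomm :: "('b \<times> 'b) set"
  bneg :: "'b \<Rightarrow> 'b"
  bjoin :: "'b set \<Rightarrow> 'b"

text \<open>The order of a complete Boolean algebra is recovered from its joins.\<close>

definition bool_order :: "'b pCBool \<Rightarrow> 'b set \<Rightarrow> 'b gorder" where
  "bool_order B T = \<lparr>carrier = T, eq = (=), le = (\<lambda>x y. bjoin B {x, y} = y)\<rparr>"

definition complete_Boolean_on :: "'b pCBool \<Rightarrow> 'b set \<Rightarrow> bool" where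
  "complete_Boolean_on B T \<longleftrightarrow> (let L = bool_order B T in
     complete_lattice L \<and>
     (\<forall>X\<subseteq>T. is_lub L (bjoin B X) X) \<and>
     (\<forall>x\<in>T. \<forall>y\<in>T. \<forall>z\<in>T. x \<sqinter>\<^bsub>L\<^esub> (y \<squnion>\<^bsub>L\<^esub> z) = (x \<sqinter>\<^bsub>L\<^esub> y) \<squnion>\<^bsub>L\<^esub> (x \<sqinter>\<^bsub>L\<^esub> z)) \<and>
     (\<forall>x\<in>T. bneg B x \<in> T \<and> x \<squnion>\<^bsub>L\<^esub> bneg B x = \<top>\<^bsub>L\<^esub> \<and> x \<sqinter>\<^bsub>L\<^esub> bneg B x = \<bottom>\<^bsub>L\<^esub>))"

definition is_pCBool :: "'b pCBool \<Rightarrow> bool" where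
  "is_pCBool B \<longleftrightarrow>
     bcomm B \<subseteq> carrier B \<times> carrier B \<and> (\<forall>x\<in>carrier B. (x, x) \<in> bcomm B) \<and> sym (bcomm B) \<and>
     (\<forall>x\<in>carrier B. bneg B x \<in> carrier B) \<and>
     (\<forall>X\<subseteq>carrier B. X \<times> X \<subseteq> bcomm B \<longrightarrow> bjoin B X \<in> carrier B) \<and>
     (\<forall>X\<subseteq>carrier B. X \<times> X \<subseteq> bcomm B \<longrightarrow>
        (\<exists>T\<subseteq>carrier B. X \<subseteq> T \<and> T \<times> T \<subseteq> bcomm B \<and> complete_Boolean_on B T))"

definition pCBool_hom :: "'b pCBool \<Rightarrow> 'c pCBool \<Rightarrow> ('b \<Rightarrow> 'c) set" where
  "pCBool_hom B B' = {g \<in> carrier B \<rightarrow>\<^sub>E carrier B'.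
     (\<forall>(x, y)\<in>bcomm B. (g x, g y) \<in> bcomm B') \<and>
     (\<forall>x\<in>carrier B. g (bneg B x) = bneg B' (g x)) \<and>
     (\<forall>X\<subseteq>carrier B. X \<times> X \<subseteq> bcomm B \<longrightarrow> g (bjoin B X) = bjoin B' (g ` X))}"

definition pCBool_cat :: "('b pCBool, 'b \<Rightarrow> 'b) cat" where
  "pCBool_cat = \<lparr>Obj = {B. is_pCBool B}, Hom = pCBool_hom,
     Ident = (\<lambda>B. \<lambda>x\<in>carrier B. x), Comp = (\<lambda>B B' B'' g f. compose (carrier B) g f)\<rparr>"

definition pCBool_iso :: "'b pCBool \<Rightarrow> 'c pCBool \<Rightarrow> ('b \<Rightarrow> 'c) \<Rightarrow> bool" where
  "pCBool_iso B B' g \<longleftrightarrow> g \<in> pCBool_hom B B' \<and>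
     (\<exists>h\<in>pCBool_hom B' B. compose (carrier B) h g = (\<lambda>x\<in>carrier B. x) \<and>
                          compose (carrier B') g h = (\<lambda>x\<in>carrier B'. x))"

definition comm_subalgs :: "'b pCBool \<Rightarrow> 'b set set" where
  "comm_subalgs B = {C. C \<subseteq> carrier B \<and> C \<times> C \<subseteq> bcomm B \<and>
     (\<forall>x\<in>C. bneg B x \<in> C) \<and> (\<forall>X\<subseteq>C. bjoin B X \<in> C)}"


section \<open>The functor \<open>Proj\<close>\<close>

definition Proj :: "'a pAWstar \<Rightarrow> 'a pCBool" where
  "Proj A = \<lparr>carrier = projections A,
     bcomm = comm A \<inter> (projections A \<times> projections A),
     bneg = (\<lambda>p. pminus A \<one>\<^bsub>A\<^esub> p),
     bjoin = pjoin A\<rparr>"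

definition Proj_map :: "'a pAWstar \<Rightarrow> 'c pAWstar \<Rightarrow> ('a \<Rightarrow> 'c) \<Rightarrow> 'a \<Rightarrow> 'c" where
  "Proj_map A A' g = restrict g (projections A)"


section \<open>The functor \<open>F\<close>\<close>

text \<open>Preservation of meets and of the top element follows by De Morgan's laws.\<close>

definition Stone :: "'b pCBool \<Rightarrow> 'b set \<Rightarrow> ('b \<Rightarrow> bool) topology" where
  "Stone B C = subtopology (product_topology (\<lambda>_. discrete_topology UNIV) C)
     {h \<in> C \<rightarrow>\<^sub>E UNIV.
        \<not> h (bjoin B {}) \<and>
        (\<forall>x\<in>C. h (bneg B x) \<longleftrightarrow> \<not> h x) \<and>
        (\<forall>x\<in>C. \<forall>y\<in>C. h (bjoin B {x, y}) \<longleftrightarrow> h x \<or> h y)}"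

type_synonym 'b cfun = "('b \<Rightarrow> bool) \<Rightarrow> complex"

text \<open>The \<open>insert 0\<close> only matters when the Stone space is empty.\<close>

definition Func :: "'b pCBool \<Rightarrow> 'b set \<Rightarrow> 'b cfun pCstar" where
  "Func B C = (let S = topspace (Stone B C);
                   K = {f \<in> extensional S. continuous_map (Stone B C) euclidean f} in
     \<lparr>carrier = K,
      monoid.mult = (\<lambda>f g. \<lambda>h\<in>S. f h * g h), one = (\<lambda>h\<in>S. 1),
      zero = (\<lambda>h\<in>S. 0), add = (\<lambda>f g. \<lambda>h\<in>S. f h + g h),
      smult = (\<lambda>c f. \<lambda>h\<in>S. c * f h),
      comm = K \<times> K,
      invol = (\<lambda>f. \<lambda>h\<in>S. cnj (f h)),
      cnorm = (\<lambda>f. Sup (insert 0 ((\<lambda>h. cmod (f h)) ` S)))\<rparr>)"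

text \<open>\<open>Func_map B' C D g\<close> is \<open>Func (g|\<^sub>C : C \<rightarrow> D)\<close>, where \<open>D\<close> is a subalgebra of \<open>B'\<close>.\<close>

definition Func_map :: "'c pCBool \<Rightarrow> 'b set \<Rightarrow> 'c set \<Rightarrow> ('b \<Rightarrow> 'c) \<Rightarrow> 'b cfun \<Rightarrow> 'c cfun" where
  "Func_map B' C D g f = (\<lambda>h\<in>topspace (Stone B' D). f (\<lambda>x\<in>C. h (g x)))"

definition F_link :: "'b pCBool \<Rightarrow> 'b set \<times> 'b cfun \<Rightarrow> 'b set \<times> 'b cfun \<Rightarrow> bool" where
  "F_link B u v \<longleftrightarrow> (\<exists>C\<in>comm_subalgs B. \<exists>D\<in>comm_subalgs B. \<exists>f\<in>carrier (Func B C).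
     C \<subseteq> D \<and> u = (C, f) \<and> v = (D, Func_map B C D (\<lambda>x. x) f))"

type_synonym 'b F_elem = "('b set \<times> 'b cfun) set"

definition F_class :: "'b pCBool \<Rightarrow> 'b set \<Rightarrow> 'b cfun \<Rightarrow> 'b F_elem" where
  "F_class B C f = {v. equivclp (F_link B) (C, f) v}"

definition F_carrier :: "'b pCBool \<Rightarrow> 'b F_elem set" where
  "F_carrier B =
     (SIGMA C:comm_subalgs B. carrier (Func B C)) // {(u, v). equivclp (F_link B) u v}"

text \<open>
  Each definite description picks the value computed on representatives; that this value does
  not depend on the representatives is part of \<open>F B\<close> being a piecewise AW*-algebra.
\<close>

definition F :: "'b pCBool \<Rightarrow> 'b F_elem pAWstar" where
  "F B =
    \<lparr>carrier = F_carrier B,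
     monoid.mult = (\<lambda>u v. THE w. \<exists>C\<in>comm_subalgs B. \<exists>f\<in>carrier (Func B C). \<exists>g\<in>carrier (Func B C).
        u = F_class B C f \<and> v = F_class B C g \<and> w = F_class B C (f \<otimes>\<^bsub>Func B C\<^esub> g)),
     one = (THE w. \<exists>C\<in>comm_subalgs B. w = F_class B C \<one>\<^bsub>Func B C\<^esub>),
     zero = (THE w. \<exists>C\<in>comm_subalgs B. w = F_class B C \<zero>\<^bsub>Func B C\<^esub>),
     add = (\<lambda>u v. THE w. \<exists>C\<in>comm_subalgs B. \<exists>f\<in>carrier (Func B C). \<exists>g\<in>carrier (Func B C).
        u = F_class B C f \<and> v = F_class B C g \<and> w = F_class B C (f \<oplus>\<^bsub>Func B C\<^esub> g)),
     smult = (\<lambda>c u. THE w. \<exists>C\<in>comm_subalgs B. \<exists>f\<in>carrier (Func B C).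
        u = F_class B C f \<and> w = F_class B C (c \<odot>\<^bsub>Func B C\<^esub> f)),
     comm = {(u, v). \<exists>C\<in>comm_subalgs B. \<exists>f\<in>carrier (Func B C). \<exists>g\<in>carrier (Func B C).
        u = F_class B C f \<and> v = F_class B C g},
     invol = (\<lambda>u. THE w. \<exists>C\<in>comm_subalgs B. \<exists>f\<in>carrier (Func B C).
        u = F_class B C f \<and> w = F_class B C (invol (Func B C) f)),
     cnorm = (\<lambda>u. THE r. \<exists>C\<in>comm_subalgs B. \<exists>f\<in>carrier (Func B C).
        u = F_class B C f \<and> r = cnorm (Func B C) f),
     rproj = (\<lambda>u. THE w. \<exists>C\<in>comm_subalgs B. \<exists>f\<in>carrier (Func B C). \<exists>p.
        u = F_class B C f \<and> is_RP (Func B C) f p \<and> w = F_class B C p),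
     pjoin = (\<lambda>X. THE w. \<exists>C\<in>comm_subalgs B. \<exists>Y\<subseteq>projections (Func B C). \<exists>p.
        X = F_class B C ` Y \<and> is_lub (proj_order (Func B C)) p Y \<and> w = F_class B C p)\<rparr>"

definition F_map :: "'b pCBool \<Rightarrow> 'c pCBool \<Rightarrow> ('b \<Rightarrow> 'c) \<Rightarrow> 'b F_elem \<Rightarrow> 'c F_elem" where
  "F_map B B' g = (\<lambda>u\<in>F_carrier B. THE w.
     \<exists>C\<in>comm_subalgs B. \<exists>f\<in>carrier (Func B C). \<exists>D\<in>comm_subalgs B'.
       u = F_class B C f \<and> g ` C \<subseteq> D \<and> w = F_class B' D (Func_map B' C D g f))"

end

theory Submission
  imports Defs
begin

text \<open>
  A piecewise complete Boolean algebra \<open>B\<close> is covered by complete Boolean algebras \<open>C\<close>, and \<open>F B\<close> is glued from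
  the algebras of continuous functions on their Stone spaces.  The classical duality between complete Boolean
  algebras and commutative AW*-algebras holds on each piece; the point is that it is compatible with glueing.

  On the side of \<open>F\<close>, the colimit is not directed, and what controls it are the spectral projections \<open>spec\<close>
  of a function \<open>f\<close>: for an open set \<open>U\<close> of complex numbers, the element of \<open>C\<close> whose clopen set is the closure
  of the preimage of \<open>U\<close>.  They do not change when \<open>f\<close> is restricted to a larger subalgebra (\<open>spec_Func_map\<close>),
  they determine \<open>f\<close> (\<open>spec_inj\<close>), and \<open>f\<close> comes from a subalgebra as soon as they lie in it (\<open>res_factor\<close>).  Hence
  a class is the same thing as its family of spectral projections: two representatives of a class come from the
  intersection of their algebras (\<open>F_common\<close>), so that all operations are well defined, and classes that are
  pairwise commeasurable have representatives in one algebra (\<open>commeasurable_in_hat\<close>).  The projections of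
  \<open>F B\<close> are the characteristic functions of the elements of \<open>B\<close>, which is the unit \<open>eta\<close>.

  On the side of \<open>Proj\<close>, each commutative AW*-algebra \<open>T\<close> in \<open>A\<close> has to be identified with the functions on the
  Stone space of its projections.  The value of \<open>a\<close> at a Boolean homomorphism \<open>h\<close> is the number \<open>z\<close> that \<open>a\<close>
  approaches when it is cut down by projections on which \<open>h\<close> is true (\<open>char_at\<close>).  It exists because the
  projections span a dense subspace of \<open>T\<close> (\<open>projections_dense\<close>): a self-adjoint contraction differs by at most
  \<open>1/2\<close> in norm from \<open>p - 1/2\<close> for a suitable projection \<open>p\<close> (\<open>halving\<close>), and iterating this gives a binary
  expansion.  The norm estimates behind it come from square roots, obtained by an iteration (\<open>sqrt_exists\<close>),
  and from the observation that \<open>x\<^sup>2 + y\<^sup>2 = 1\<close> makes \<open>x + i y\<close> unitary, so that \<open>x\<close> is a contraction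
  (\<open>nrm_le_one_of_sum_squares\<close>); the same observation shows that morphisms are contractive.  The transform is
  isometric by the prime ideal theorem (\<open>gelf_norm\<close>) and onto by density (\<open>delta_surj\<close>).  Commutative AW*-algebras
  in \<open>A\<close> are closed under intersection (\<open>awblock_Int\<close>), which makes the transform independent of \<open>T\<close>; the
  resulting bijection from \<open>A\<close> to \<open>F (Proj A)\<close> is the inverse of the counit.  It is natural because morphisms
  preserve the approximations that define the values.
\<close>


section \<open>Order and complements in a piecewise complete Boolean algebra\<close>

definition ble :: "'b pCBool \<Rightarrow> 'b \<Rightarrow> 'b \<Rightarrow> bool" where
  "ble B x y \<longleftrightarrow> bjoin B {x, y} = y"

abbreviation bzero :: "'b pCBool \<Rightarrow> 'b" where
  "bzero B \<equiv> bjoin B {}"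

abbreviation btop :: "'b pCBool \<Rightarrow> 'b" where
  "btop B \<equiv> bneg B (bjoin B {})"

text \<open>
  The meet is passed as a function \<open>m\<close>, since it is not an operation of the structure; the infimum of an
  arbitrary set is the join of its lower bounds.
\<close>

lemma complete_Boolean_onI:
  assumes refl: "\<And>x. x \<in> T \<Longrightarrow> ble B x x"
    and antisym: "\<And>x y. x \<in> T \<Longrightarrow> y \<in> T \<Longrightarrow> ble B x y \<Longrightarrow> ble B y x \<Longrightarrow> x = y"
    and trans: "\<And>x y z. x \<in> T \<Longrightarrow> y \<in> T \<Longrightarrow> z \<in> T \<Longrightarrow> ble B x y \<Longrightarrow> ble B y z \<Longrightarrow> ble B x z"
    and join_in: "\<And>X. X \<subseteq> T \<Longrightarrow> bjoin B X \<in> T"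
    and join_upper: "\<And>X x. X \<subseteq> T \<Longrightarrow> x \<in> X \<Longrightarrow> ble B x (bjoin B X)"
    and join_least: "\<And>X z. X \<subseteq> T \<Longrightarrow> z \<in> T \<Longrightarrow> (\<And>x. x \<in> X \<Longrightarrow> ble B x z) \<Longrightarrow> ble B (bjoin B X) z"
    and meet_in: "\<And>x y. x \<in> T \<Longrightarrow> y \<in> T \<Longrightarrow> m x y \<in> T"
    and meet_lower: "\<And>x y. x \<in> T \<Longrightarrow> y \<in> T \<Longrightarrow> ble B (m x y) x \<and> ble B (m x y) y"
    and meet_greatest: "\<And>x y z. x \<in> T \<Longrightarrow> y \<in> T \<Longrightarrow> z \<in> T \<Longrightarrow> ble B z x \<Longrightarrow> ble B z y \<Longrightarrow> ble B z (m x y)"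
    and distrib: "\<And>x y z. x \<in> T \<Longrightarrow> y \<in> T \<Longrightarrow> z \<in> T \<Longrightarrow>
       m x (bjoin B {y, z}) = bjoin B {m x y, m x z}"
    and neg_in: "\<And>x. x \<in> T \<Longrightarrow> bneg B x \<in> T"
    and compl: "\<And>x. x \<in> T \<Longrightarrow> bjoin B {x, bneg B x} = btop B"
      "\<And>x. x \<in> T \<Longrightarrow> m x (bneg B x) = bzero B"
  shows "complete_Boolean_on B T"
proof -
  define L where "L = bool_order B T"
  have L: "carrier L = T" "\<And>x y. x \<sqsubseteq>\<^bsub>L\<^esub> y \<longleftrightarrow> ble B x y" "(.=\<^bsub>L\<^esub>) = (=)"
    by (simp_all add: L_def bool_order_def ble_def)
  interpret L: partial_order L
    by standard (auto simp: L intro: refl antisym trans)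
  have lub: "is_lub L (bjoin B X) X" if "X \<subseteq> T" for X
    unfolding least_def Upper_def
    using that join_in[of X] join_upper[of X] join_least[of X] by (simp add: L subset_iff)
  have lub_unique: "s = bjoin B X" if "is_lub L s X" "X \<subseteq> T" for s X
    using L.least_unique[OF that(1) lub[OF that(2)]] .
  have upper: "Upper L X \<subseteq> T" "Lower L X \<subseteq> T" for X
    by (auto simp: Upper_def Lower_def L)
  have glb: "is_glb L (bjoin B (Lower L X)) X" if X: "X \<subseteq> T" for X
  proof -
    have "ble B (bjoin B (Lower L X)) x" if "x \<in> X" for x
      by (rule join_least[OF upper(2)]) (use X that in \<open>auto simp: Lower_def L\<close>)
    moreover have "ble B y (bjoin B (Lower L X))" if "y \<in> Lower L X" for y
      by (rule join_upper[OF upper(2) that])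
    ultimately show ?thesis
      using join_in[OF upper(2), of X] X unfolding greatest_def Lower_def L by (auto simp: L)
  qed
  have cl: "complete_lattice L"
    by standard (use lub glb in \<open>auto simp: L\<close>)
  have join: "x \<squnion>\<^bsub>L\<^esub> y = bjoin B {x, y}" if "x \<in> T" "y \<in> T" for x y
    unfolding join_def sup_def
  proof (rule some_equality)
    show "is_lub L (bjoin B {x, y}) {x, y}" using lub that by simp
    show "\<And>s. is_lub L s {x, y} \<Longrightarrow> s = bjoin B {x, y}" using lub_unique that by simp
  qed
  have meet: "x \<sqinter>\<^bsub>L\<^esub> y = m x y" if "x \<in> T" "y \<in> T" for x y
  proof -
    have g: "is_glb L (m x y) {x, y}"
      using that meet_in meet_lower meet_greatest
      unfolding greatest_def Lower_def by (auto simp: L)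
    show ?thesis unfolding meet_def inf_def
      by (rule some_equality) (use L.greatest_unique g in auto)
  qed
  have bot: "\<bottom>\<^bsub>L\<^esub> = bzero B"
    unfolding bottom_def
  proof (rule some_equality)
    show z: "least L (bzero B) (carrier L)"
      using lub[of "{}"] by (simp add: L)
    show "\<And>x. least L x (carrier L) \<Longrightarrow> x = bzero B"
      using L.least_unique[OF _ z] by blast
  qed
  have top: "\<top>\<^bsub>L\<^esub> = btop B"
    unfolding top_def
  proof (rule some_equality)
    have "ble B x (btop B)" if "x \<in> T" for x
      using compl(1)[OF that] join_upper[of "{x, bneg B x}" x] that neg_in[OF that] by auto
    then show z: "greatest L (btop B) (carrier L)"
      using neg_in join_in[of "{}"] by (auto simp: greatest_def L)
    show "\<And>x. greatest L x (carrier L) \<Longrightarrow> x = btop B"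
      using L.greatest_unique[OF _ z] by blast
  qed
  show ?thesis
    unfolding complete_Boolean_on_def Let_def L_def[symmetric]
    using cl lub distrib compl neg_in join_in meet_in
    by (auto simp: join meet bot top)
qed

text \<open>
  The last two facts are the only use that is made of distributivity: both say that \<open>x\<close> lies below \<open>z\<close>
  once some \<open>y\<close> is disjoint from \<open>x\<close> and covers the top together with \<open>z\<close>.  They are what the
  prime ideal theorem needs.
\<close>

lemma complete_Boolean_onD:
  assumes "complete_Boolean_on B T"
  shows ble_refl: "x \<in> T \<Longrightarrow> ble B x x"
    and ble_antisym: "x \<in> T \<Longrightarrow> y \<in> T \<Longrightarrow> ble B x y \<Longrightarrow> ble B y x \<Longrightarrow> x = y"
    and ble_trans: "x \<in> T \<Longrightarrow> y \<in> T \<Longrightarrow> z \<in> T \<Longrightarrow> ble B x y \<Longrightarrow> ble B y z \<Longrightarrow> ble B x z"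
    and bjoin_in: "X \<subseteq> T \<Longrightarrow> bjoin B X \<in> T"
    and bjoin_upper: "X \<subseteq> T \<Longrightarrow> x \<in> X \<Longrightarrow> ble B x (bjoin B X)"
    and bjoin_least: "X \<subseteq> T \<Longrightarrow> z \<in> T \<Longrightarrow> (\<And>x. x \<in> X \<Longrightarrow> ble B x z) \<Longrightarrow> ble B (bjoin B X) z"
    and bneg_in: "x \<in> T \<Longrightarrow> bneg B x \<in> T"
    and bjoin_neg: "x \<in> T \<Longrightarrow> bjoin B {x, bneg B x} = btop B"
    and bneg_le: "x \<in> T \<Longrightarrow> z \<in> T \<Longrightarrow> bjoin B {x, z} = btop B \<Longrightarrow> ble B (bneg B x) z"
    and le_of_bneg: "x \<in> T \<Longrightarrow> z \<in> T \<Longrightarrow> bjoin B {bneg B x, z} = btop B \<Longrightarrow> ble B x z"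
proof -
  define L where "L = bool_order B T"
  have L: "carrier L = T" "\<And>x y. x \<sqsubseteq>\<^bsub>L\<^esub> y \<longleftrightarrow> ble B x y" "(.=\<^bsub>L\<^esub>) = (=)"
    by (simp_all add: L_def bool_order_def ble_def)
  from assms have cl: "complete_lattice L"
    and lub: "\<And>X. X \<subseteq> T \<Longrightarrow> is_lub L (bjoin B X) X"
    and dist: "\<And>x y z. x \<in> T \<Longrightarrow> y \<in> T \<Longrightarrow> z \<in> T \<Longrightarrow>
       x \<sqinter>\<^bsub>L\<^esub> (y \<squnion>\<^bsub>L\<^esub> z) = (x \<sqinter>\<^bsub>L\<^esub> y) \<squnion>\<^bsub>L\<^esub> (x \<sqinter>\<^bsub>L\<^esub> z)"
    and neg: "\<And>x. x \<in> T \<Longrightarrow> bneg B x \<in> T"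
    and cj: "\<And>x. x \<in> T \<Longrightarrow> x \<squnion>\<^bsub>L\<^esub> bneg B x = \<top>\<^bsub>L\<^esub>"
    and cm: "\<And>x. x \<in> T \<Longrightarrow> x \<sqinter>\<^bsub>L\<^esub> bneg B x = \<bottom>\<^bsub>L\<^esub>"
    by (auto simp: complete_Boolean_on_def Let_def L_def[symmetric])
  interpret L: complete_lattice L by (rule cl)
  have join: "x \<squnion>\<^bsub>L\<^esub> y = bjoin B {x, y}" if "x \<in> T" "y \<in> T" for x y
    unfolding join_def sup_def
  proof (rule some_equality)
    show l: "is_lub L (bjoin B {x, y}) {x, y}" using lub that by simp
    show "\<And>s. is_lub L s {x, y} \<Longrightarrow> s = bjoin B {x, y}" using L.least_unique[OF _ l] .
  qed
  have in': "X \<subseteq> T \<Longrightarrow> bjoin B X \<in> T" for X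
    using lub[of X] by (auto simp: least_def Upper_def L)
  have bot: "\<bottom>\<^bsub>L\<^esub> = bzero B"
    unfolding bottom_def
  proof (rule some_equality)
    show z: "least L (bzero B) (carrier L)"
      using lub[of "{}"] by (simp add: L)
    show "\<And>x. least L x (carrier L) \<Longrightarrow> x = bzero B"
      using L.least_unique[OF _ z] by blast
  qed
  have top: "\<top>\<^bsub>L\<^esub> = btop B"
  proof -
    have "\<bottom>\<^bsub>L\<^esub> \<squnion>\<^bsub>L\<^esub> bneg B \<bottom>\<^bsub>L\<^esub> = \<top>\<^bsub>L\<^esub>"
      using cj L.bottom_closed by (simp add: L)
    moreover have "\<bottom>\<^bsub>L\<^esub> \<squnion>\<^bsub>L\<^esub> bneg B \<bottom>\<^bsub>L\<^esub> = bneg B \<bottom>\<^bsub>L\<^esub>"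
    proof -
      have n: "bneg B \<bottom>\<^bsub>L\<^esub> \<in> T" using L.bottom_closed neg by (simp add: L)
      then have "\<bottom>\<^bsub>L\<^esub> \<sqsubseteq>\<^bsub>L\<^esub> bneg B \<bottom>\<^bsub>L\<^esub>" by (intro L.bottom_lower) (simp add: L)
      then show ?thesis using join[of "\<bottom>\<^bsub>L\<^esub>"] n L.bottom_closed by (simp add: L ble_def)
    qed
    ultimately show ?thesis using bot by simp
  qed
  show "x \<in> T \<Longrightarrow> ble B x x" using L.le_refl L by auto
  show "x \<in> T \<Longrightarrow> y \<in> T \<Longrightarrow> ble B x y \<Longrightarrow> ble B y x \<Longrightarrow> x = y"
    using L.le_antisym L by auto
  show "x \<in> T \<Longrightarrow> y \<in> T \<Longrightarrow> z \<in> T \<Longrightarrow> ble B x y \<Longrightarrow> ble B y z \<Longrightarrow> ble B x z"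
    using L.le_trans[of x y z] L by auto
  show "X \<subseteq> T \<Longrightarrow> bjoin B X \<in> T" by (rule in')
  show "X \<subseteq> T \<Longrightarrow> x \<in> X \<Longrightarrow> ble B x (bjoin B X)"
    using lub[of X] by (auto simp: least_def Upper_def L)
  show "X \<subseteq> T \<Longrightarrow> z \<in> T \<Longrightarrow> (\<And>x. x \<in> X \<Longrightarrow> ble B x z) \<Longrightarrow> ble B (bjoin B X) z"
    using lub[of X] by (auto simp: least_def Upper_def L)
  show "x \<in> T \<Longrightarrow> bneg B x \<in> T" by (rule neg)
  show "x \<in> T \<Longrightarrow> bjoin B {x, bneg B x} = btop B"
    using cj[of x] join[of x "bneg B x"] neg top by simp
  have key: "ble B x z" if x: "x \<in> T" and y: "y \<in> T" and z: "z \<in> T"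
    and j: "bjoin B {y, z} = btop B" and m: "x \<sqinter>\<^bsub>L\<^esub> y = \<bottom>\<^bsub>L\<^esub>" for x y z
  proof -
    have xc: "x \<in> carrier L" and zc: "z \<in> carrier L" using x z L by auto
    have "x = x \<sqinter>\<^bsub>L\<^esub> \<top>\<^bsub>L\<^esub>" using L.top_meet[OF xc] by (simp add: L meet_comm)
    also have "\<dots> = x \<sqinter>\<^bsub>L\<^esub> (y \<squnion>\<^bsub>L\<^esub> z)" using j join y z top by simp
    also have "\<dots> = \<bottom>\<^bsub>L\<^esub> \<squnion>\<^bsub>L\<^esub> (x \<sqinter>\<^bsub>L\<^esub> z)" using dist x y z m by simp
    also have "\<dots> = x \<sqinter>\<^bsub>L\<^esub> z"
      using join[of "\<bottom>\<^bsub>L\<^esub>" "x \<sqinter>\<^bsub>L\<^esub> z"] L.bottom_lower[of "x \<sqinter>\<^bsub>L\<^esub> z"] L.bottom_closed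
        L.meet_closed[OF xc zc] by (simp add: L ble_def)
    finally show ?thesis using L.meet_right[OF xc zc] L by auto
  qed
  show "x \<in> T \<Longrightarrow> z \<in> T \<Longrightarrow> bjoin B {x, z} = btop B \<Longrightarrow> ble B (bneg B x) z"
    using key[of "bneg B x" x z] cm[of x] neg[of x] by (simp add: meet_comm)
  show "x \<in> T \<Longrightarrow> z \<in> T \<Longrightarrow> bjoin B {bneg B x, z} = btop B \<Longrightarrow> ble B x z"
    using key[of x "bneg B x" z] cm[of x] neg[of x] by simp
qed


lemma complete_Boolean_subalg:
  assumes "complete_Boolean_on B T" "T \<subseteq> carrier B" "T \<times> T \<subseteq> bcomm B"
  shows "T \<in> comm_subalgs B"
  using assms bneg_in[OF assms(1)] bjoin_in[OF assms(1)] by (auto simp: comm_subalgs_def)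

locale pcbool =
  fixes B :: "'b pCBool"
  assumes pcb: "is_pCBool B"
begin

lemma commeasurable_in_subalg:
  assumes "X \<subseteq> carrier B" "X \<times> X \<subseteq> bcomm B"
  obtains T where "T \<in> comm_subalgs B" "X \<subseteq> T" "complete_Boolean_on B T"
proof -
  have "\<exists>T\<subseteq>carrier B. X \<subseteq> T \<and> T \<times> T \<subseteq> bcomm B \<and> complete_Boolean_on B T"
    using pcb assms unfolding is_pCBool_def by blast
  then show ?thesis using that complete_Boolean_subalg by blast
qed

lemma subalg_in_Boolean:
  assumes "C \<in> comm_subalgs B"
  obtains T where "C \<subseteq> T" "complete_Boolean_on B T"
proof -
  have "C \<subseteq> carrier B" "C \<times> C \<subseteq> bcomm B" using assms by (auto simp: comm_subalgs_def)
  then show ?thesis using commeasurable_in_subalg that by blast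
qed

context
  fixes C assumes C: "C \<in> comm_subalgs B"
begin

lemma bneg_mem: "x \<in> C \<Longrightarrow> bneg B x \<in> C"
  and bjoin_mem: "X \<subseteq> C \<Longrightarrow> bjoin B X \<in> C"
  using C by (auto simp: comm_subalgs_def)

lemma bjoin2_mem: "x \<in> C \<Longrightarrow> y \<in> C \<Longrightarrow> bjoin B {x, y} \<in> C"
  and bzero_mem: "bzero B \<in> C"
  and btop_mem: "btop B \<in> C"
  by (auto intro!: bjoin_mem bneg_mem)

text \<open>
  A set closed under the operations lies in a complete Boolean algebra, and it inherits the order
  because the order is expressed by binary joins.
\<close>

lemma subalg_order:
  shows le_refl: "x \<in> C \<Longrightarrow> ble B x x"
    and le_antisym: "x \<in> C \<Longrightarrow> y \<in> C \<Longrightarrow> ble B x y \<Longrightarrow> ble B y x \<Longrightarrow> x = y"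
    and le_trans: "x \<in> C \<Longrightarrow> y \<in> C \<Longrightarrow> z \<in> C \<Longrightarrow> ble B x y \<Longrightarrow> ble B y z \<Longrightarrow> ble B x z"
    and join_upper: "X \<subseteq> C \<Longrightarrow> x \<in> X \<Longrightarrow> ble B x (bjoin B X)"
    and join_least: "X \<subseteq> C \<Longrightarrow> z \<in> C \<Longrightarrow> (\<And>x. x \<in> X \<Longrightarrow> ble B x z) \<Longrightarrow> ble B (bjoin B X) z"
    and join_neg: "x \<in> C \<Longrightarrow> bjoin B {x, bneg B x} = btop B"
    and neg_le: "x \<in> C \<Longrightarrow> z \<in> C \<Longrightarrow> bjoin B {x, z} = btop B \<Longrightarrow> ble B (bneg B x) z"
    and le_of_neg: "x \<in> C \<Longrightarrow> z \<in> C \<Longrightarrow> bjoin B {bneg B x, z} = btop B \<Longrightarrow> ble B x z"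
proof -
  obtain T where T: "C \<subseteq> T" and cb: "complete_Boolean_on B T"
    using subalg_in_Boolean[OF C] .
  note D = complete_Boolean_onD[OF cb]
  show "x \<in> C \<Longrightarrow> ble B x x" using D(1) T by blast
  show "x \<in> C \<Longrightarrow> y \<in> C \<Longrightarrow> ble B x y \<Longrightarrow> ble B y x \<Longrightarrow> x = y" using D(2) T by blast
  show "x \<in> C \<Longrightarrow> y \<in> C \<Longrightarrow> z \<in> C \<Longrightarrow> ble B x y \<Longrightarrow> ble B y z \<Longrightarrow> ble B x z"
    using D(3) T by blast
  show "X \<subseteq> C \<Longrightarrow> x \<in> X \<Longrightarrow> ble B x (bjoin B X)" using D(5) T by blast
  show "X \<subseteq> C \<Longrightarrow> z \<in> C \<Longrightarrow> (\<And>x. x \<in> X \<Longrightarrow> ble B x z) \<Longrightarrow> ble B (bjoin B X) z"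
    using D(6)[of X z] T by blast
  show "x \<in> C \<Longrightarrow> bjoin B {x, bneg B x} = btop B" using D(8) T by blast
  show "x \<in> C \<Longrightarrow> z \<in> C \<Longrightarrow> bjoin B {x, z} = btop B \<Longrightarrow> ble B (bneg B x) z" using D(9) T by blast
  show "x \<in> C \<Longrightarrow> z \<in> C \<Longrightarrow> bjoin B {bneg B x, z} = btop B \<Longrightarrow> ble B x z" using D(10) T by blast
qed

lemma zero_le: "x \<in> C \<Longrightarrow> ble B (bzero B) x"
  by (rule join_least) auto

lemma join_left: "x \<in> C \<Longrightarrow> y \<in> C \<Longrightarrow> ble B x (bjoin B {x, y})"
  and join_right: "x \<in> C \<Longrightarrow> y \<in> C \<Longrightarrow> ble B y (bjoin B {x, y})"
  by (rule join_upper; simp)+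

lemma join2_least: "x \<in> C \<Longrightarrow> y \<in> C \<Longrightarrow> z \<in> C \<Longrightarrow> ble B x z \<Longrightarrow> ble B y z \<Longrightarrow> ble B (bjoin B {x, y}) z"
  by (rule join_least) auto

lemma le_top: "x \<in> C \<Longrightarrow> ble B x (btop B)"
  using join_left[of x "bneg B x"] join_neg[of x] bneg_mem by auto

lemma top_leD: "x \<in> C \<Longrightarrow> ble B (btop B) x \<Longrightarrow> x = btop B"
  using le_antisym le_top btop_mem by blast

lemma join_insert:
  assumes "x \<in> C" "X \<subseteq> C"
  shows "bjoin B (insert x X) = bjoin B {x, bjoin B X}"
proof (rule le_antisym)
  have m: "bjoin B X \<in> C" "bjoin B (insert x X) \<in> C" "bjoin B {x, bjoin B X} \<in> C"
    using assms by (auto intro!: bjoin_mem)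
  then show "bjoin B (insert x X) \<in> C" "bjoin B {x, bjoin B X} \<in> C" by auto
  show "ble B (bjoin B (insert x X)) (bjoin B {x, bjoin B X})"
  proof (rule join_least)
    fix y assume y: "y \<in> insert x X"
    show "ble B y (bjoin B {x, bjoin B X})"
    proof (cases "y = x")
      case True then show ?thesis using join_left m assms by auto
    next
      case False
      then have "ble B y (bjoin B X)" using y assms join_upper by auto
      then show ?thesis using join_right[of x "bjoin B X"] le_trans m assms y False by blast
    qed
  qed (use assms m in auto)
  show "ble B (bjoin B {x, bjoin B X}) (bjoin B (insert x X))"
    using assms m by (intro join2_least join_least join_upper) auto
qed

end

end

section \<open>Stone spaces\<close>

abbreviation St :: "'b pCBool \<Rightarrow> 'b set \<Rightarrow> ('b \<Rightarrow> bool) set" where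
  "St B C \<equiv> topspace (Stone B C)"

lemma St_iff:
  "h \<in> St B C \<longleftrightarrow> h \<in> C \<rightarrow>\<^sub>E UNIV \<and> \<not> h (bzero B) \<and> (\<forall>x\<in>C. h (bneg B x) \<longleftrightarrow> \<not> h x) \<and>
     (\<forall>x\<in>C. \<forall>y\<in>C. h (bjoin B {x, y}) \<longleftrightarrow> h x \<or> h y)"
  by (auto simp: Stone_def topspace_subtopology)

lemma St_zero: "h \<in> St B C \<Longrightarrow> \<not> h (bzero B)"
  and St_neg: "h \<in> St B C \<Longrightarrow> x \<in> C \<Longrightarrow> h (bneg B x) \<longleftrightarrow> \<not> h x"
  and St_join: "h \<in> St B C \<Longrightarrow> x \<in> C \<Longrightarrow> y \<in> C \<Longrightarrow> h (bjoin B {x, y}) \<longleftrightarrow> h x \<or> h y"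
  and St_ext: "h \<in> St B C \<Longrightarrow> h \<in> C \<rightarrow>\<^sub>E UNIV"
  by (auto simp: St_iff)

lemma St_le: "h \<in> St B C \<Longrightarrow> x \<in> C \<Longrightarrow> y \<in> C \<Longrightarrow> ble B x y \<Longrightarrow> h x \<Longrightarrow> h y"
  using St_join[of h B C x y] by (simp add: ble_def)

text \<open>
  Both the inclusion of a subalgebra and the restriction of a morphism to a subalgebra are of this form,
  and pulling back along such a map sends the Stone space of \<open>D\<close> to that of \<open>C\<close>.
\<close>

definition subalg_hom :: "'b pCBool \<Rightarrow> 'c pCBool \<Rightarrow> 'b set \<Rightarrow> 'c set \<Rightarrow> ('b \<Rightarrow> 'c) \<Rightarrow> bool" where
  "subalg_hom B B' C D g \<longleftrightarrow> g ` C \<subseteq> D \<and> (\<forall>x\<in>C. g (bneg B x) = bneg B' (g x)) \<and>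
     (\<forall>X\<subseteq>C. g (bjoin B X) = bjoin B' (g ` X))"

lemma subalg_hom_incl: "C \<subseteq> D \<Longrightarrow> subalg_hom B B C D (\<lambda>x. x)"
  by (auto simp: subalg_hom_def)

context pcbool
begin

lemma St_pullback:
  assumes C: "C \<in> comm_subalgs B" and g: "subalg_hom B B' C D g" and h: "h \<in> St B' D"
  shows "(\<lambda>x\<in>C. h (g x)) \<in> St B C"
proof -
  have [simp]: "bneg B x \<in> C" if "x \<in> C" for x using bneg_mem[OF C that] .
  have [simp]: "bjoin B X \<in> C" if "X \<subseteq> C" for X using bjoin_mem[OF C that] .
  have gz: "g (bzero B) = bzero B'" using g unfolding subalg_hom_def by auto
  have gj: "g (bjoin B {x, y}) = bjoin B' {g x, g y}" if "x \<in> C" "y \<in> C" for x y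
    using g that unfolding subalg_hom_def by (metis (no_types) empty_subsetI image_empty image_insert insert_subset)
  have gn: "g (bneg B x) = bneg B' (g x)" "g x \<in> D" if "x \<in> C" for x
    using g that unfolding subalg_hom_def by auto
  show ?thesis using h gz gj gn
    by (auto simp: St_iff)
qed

definition is_ideal :: "'b set \<Rightarrow> 'b set \<Rightarrow> bool" where
  "is_ideal C I \<longleftrightarrow> I \<subseteq> C \<and> bzero B \<in> I \<and> (\<forall>x\<in>I. \<forall>y\<in>C. ble B y x \<longrightarrow> y \<in> I) \<and>
     (\<forall>x\<in>I. \<forall>y\<in>I. bjoin B {x, y} \<in> I)"

text \<open>
  The Boolean prime ideal theorem: by Zorn's lemma the ideal extends to a maximal proper one, which contains
  \<open>x\<close> or \<open>bneg B x\<close> for every \<open>x\<close>, and its complement is a homomorphism to two elements.  Below it takes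
  the place of compactness: a property that holds near every point holds on an ideal, hence everywhere.
\<close>

lemma ideal_avoided:
  assumes C: "C \<in> comm_subalgs B" and I: "is_ideal C I" "btop B \<notin> I"
  obtains h where "h \<in> St B C" "\<And>x. x \<in> I \<Longrightarrow> \<not> h x"
proof -
  define \<A> where "\<A> = {J. is_ideal C J \<and> btop B \<notin> J \<and> I \<subseteq> J}"
  have "\<exists>M\<in>\<A>. \<forall>X\<in>\<A>. M \<subseteq> X \<longrightarrow> X = M"
  proof (rule subset_Zorn)
    fix \<C> assume ch: "subset.chain \<A> \<C>"
    show "\<exists>U\<in>\<A>. \<forall>X\<in>\<C>. X \<subseteq> U"
    proof (cases "\<C> = {}")
      case True then show ?thesis using I by (auto simp: \<A>_def)
    next
      case False
      have sub: "\<C> \<subseteq> \<A>" and lin: "\<And>X Y. X \<in> \<C> \<Longrightarrow> Y \<in> \<C> \<Longrightarrow> X \<subseteq> Y \<or> Y \<subseteq> X"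
        using ch by (auto simp: subset_chain_def)
      have "is_ideal C (\<Union>\<C>)"
        unfolding is_ideal_def
      proof (intro conjI ballI impI)
        show "\<Union>\<C> \<subseteq> C" "bzero B \<in> \<Union>\<C>"
          using sub False by (auto simp: \<A>_def is_ideal_def)
        show "y \<in> \<Union>\<C>" if "x \<in> \<Union>\<C>" "y \<in> C" "ble B y x" for x y
          using sub that unfolding \<A>_def is_ideal_def by blast
        show "bjoin B {x, y} \<in> \<Union>\<C>" if xy: "x \<in> \<Union>\<C>" "y \<in> \<Union>\<C>" for x y
        proof -
          obtain X Y where "X \<in> \<C>" "Y \<in> \<C>" "x \<in> X" "y \<in> Y" using xy by auto
          then obtain Z where "Z \<in> \<C>" "x \<in> Z" "y \<in> Z" using lin by blast
          then show ?thesis using sub unfolding \<A>_def is_ideal_def by blast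
        qed
      qed
      moreover have "btop B \<notin> \<Union>\<C>" "I \<subseteq> \<Union>\<C>" using sub False by (auto simp: \<A>_def)
      ultimately show ?thesis by (auto simp: \<A>_def)
    qed
  qed
  then obtain M where MA: "M \<in> \<A>" and mx: "\<And>X. X \<in> \<A> \<Longrightarrow> M \<subseteq> X \<Longrightarrow> X = M"
    by blast
  have M: "is_ideal C M" "btop B \<notin> M" "I \<subseteq> M" using MA by (auto simp: \<A>_def)
  have max: "J = M" if "is_ideal C J" "btop B \<notin> J" "M \<subseteq> J" for J
    using that M(3) by (intro mx) (auto simp: \<A>_def)
  note MC = M(1)[unfolded is_ideal_def]
  note mem = bneg_mem[OF C] bjoin2_mem[OF C] bzero_mem[OF C] btop_mem[OF C]
  have prime: "bneg B x \<in> M" if x: "x \<in> C" "x \<notin> M" for x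
  proof -
    \<comment> \<open>the ideal generated by \<open>M\<close> and \<open>x\<close>, improper by maximality\<close>
    define J where "J = {z\<in>C. \<exists>m\<in>M. ble B z (bjoin B {m, x})}"
    have MJ: "M \<subseteq> J" using MC x join_left[OF C] by (auto simp: J_def)
    have "is_ideal C J"
      unfolding is_ideal_def
    proof (intro conjI ballI impI)
      show "J \<subseteq> C" "bzero B \<in> J" using MJ MC by (auto simp: J_def)
      show "z \<in> J" if zy: "y \<in> J" "z \<in> C" "ble B z y" for y z
      proof -
        obtain m where m: "m \<in> M" "ble B y (bjoin B {m, x})" using zy(1) unfolding J_def by blast
        then have "bjoin B {m, x} \<in> C" "y \<in> C" using zy MC x mem by (auto simp: J_def)
        then show ?thesis using m zy le_trans[OF C, of z y] by (auto simp: J_def)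
      qed
      show "bjoin B {y, z} \<in> J" if yz: "y \<in> J" "z \<in> J" for y z
      proof -
        obtain m n where mn: "m \<in> M" "n \<in> M" "ble B y (bjoin B {m, x})" "ble B z (bjoin B {n, x})"
          using yz by (auto simp: J_def)
        let ?k = "bjoin B {m, n}"
        have k: "?k \<in> M" using mn MC by blast
        have MsubC: "M \<subseteq> C" using MC by (rule conjunct1)
        have c: "m \<in> C" "n \<in> C" "?k \<in> C" using mn(1,2) k MsubC by (auto simp del: insert_subset)
        have yzC: "y \<in> C" "z \<in> C" using yz unfolding J_def by simp_all
        note kx = join_left[OF C c(3) x(1)] join_right[OF C c(3) x(1)] bjoin2_mem[OF C c(3) x(1)]
        have "ble B (bjoin B {m, x}) (bjoin B {?k, x})" "ble B (bjoin B {n, x}) (bjoin B {?k, x})"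
          using le_trans[OF C c(1,3) kx(3) join_left[OF C c(1,2)] kx(1)]
            le_trans[OF C c(2,3) kx(3) join_right[OF C c(1,2)] kx(1)] c x(1) kx
          by (blast intro: join2_least[OF C])+
        then have "ble B (bjoin B {y, z}) (bjoin B {?k, x})"
          using le_trans[OF C yzC(1) bjoin2_mem[OF C c(1) x(1)] kx(3) mn(3)]
            le_trans[OF C yzC(2) bjoin2_mem[OF C c(2) x(1)] kx(3) mn(4)] yzC kx(3)
          by (blast intro: join2_least[OF C])
        then show ?thesis using k bjoin2_mem[OF C yzC] unfolding J_def by blast
      qed
    qed
    moreover have "x \<in> J" using x MC join_right[OF C, of "bzero B" x] mem by (auto simp: J_def)
    ultimately have "btop B \<in> J" using max[OF _ _ MJ] x by auto
    then obtain m where m: "m \<in> M" "ble B (btop B) (bjoin B {m, x})" by (auto simp: J_def)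
    then have "bjoin B {x, m} = btop B"
      using top_leD[OF C, of "bjoin B {m, x}"] x MC mem by (auto simp: insert_commute)
    then have "ble B (bneg B x) m" using neg_le[OF C] x m MC by blast
    then show ?thesis using m MC mem x by blast
  qed
  have proper: "bneg B x \<notin> M" if "x \<in> M" for x
  proof
    assume "bneg B x \<in> M"
    then have "bjoin B {x, bneg B x} \<in> M" "x \<in> C" using that MC by blast+
    then show False using M(2) join_neg[OF C] by simp
  qed
  define h where "h = (\<lambda>x\<in>C. x \<notin> M)"
  have "h \<in> St B C"
    unfolding St_iff
  proof (intro conjI ballI)
    show "h \<in> C \<rightarrow>\<^sub>E UNIV" by (auto simp: h_def)
    show "\<not> h (bzero B)" using MC mem by (auto simp: h_def)
    show "h (bneg B x) \<longleftrightarrow> \<not> h x" if "x \<in> C" for x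
      using that prime proper mem by (auto simp: h_def)
    show "h (bjoin B {x, y}) \<longleftrightarrow> h x \<or> h y" if "x \<in> C" "y \<in> C" for x y
      using that MC mem join_left[OF C, of x y] join_right[OF C, of x y] by (auto simp: h_def)
  qed
  moreover have "\<not> h x" if "x \<in> I" for x
    using that M(3) MC by (auto simp: h_def)
  ultimately show ?thesis using that by blast
qed

lemma le_iff_St:
  assumes C: "C \<in> comm_subalgs B" and x: "x \<in> C" and y: "y \<in> C"
  shows "ble B x y \<longleftrightarrow> (\<forall>h\<in>St B C. h x \<longrightarrow> h y)"
proof
  show "\<forall>h\<in>St B C. h x \<longrightarrow> h y" if "ble B x y" using St_le[OF _ x y that] by blast
  assume *: "\<forall>h\<in>St B C. h x \<longrightarrow> h y"
  note mem = bneg_mem[OF C] bjoin2_mem[OF C] bzero_mem[OF C] btop_mem[OF C]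
  let ?n = "bjoin B {bneg B x, y}"
  have n: "?n \<in> C" using x y mem by auto
  have I: "is_ideal C {z\<in>C. ble B z ?n}"
    unfolding is_ideal_def
  proof (intro conjI ballI impI)
    show "{z\<in>C. ble B z ?n} \<subseteq> C" "bzero B \<in> {z\<in>C. ble B z ?n}"
      using zero_le[OF C n] mem(3) by auto
    show "z \<in> {z\<in>C. ble B z ?n}" if "w \<in> {z\<in>C. ble B z ?n}" "z \<in> C" "ble B z w" for w z
      using that le_trans[OF C _ _ n, of z w] by simp
    show "bjoin B {w, z} \<in> {z\<in>C. ble B z ?n}"
      if "w \<in> {z\<in>C. ble B z ?n}" "z \<in> {z\<in>C. ble B z ?n}" for w z
      using that join2_least[OF C _ _ n, of w z] mem(2)[of w z] by simp
  qed
  show "ble B x y"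
  proof (rule ccontr)
    assume "\<not> ble B x y"
    then have "?n \<noteq> btop B" using le_of_neg[OF C x y] by blast
    then have "btop B \<notin> {z\<in>C. ble B z ?n}" using top_leD[OF C n] by blast
    then obtain h where h: "h \<in> St B C" and hI: "\<And>z. z \<in> {z\<in>C. ble B z ?n} \<Longrightarrow> \<not> h z"
      using ideal_avoided[OF C I] by metis
    from hI[of ?n] have "\<not> h ?n" using n le_refl[OF C n] by blast
    then have "h x" "\<not> h y" using h x y mem by (auto simp: St_join St_neg)
    then show False using * h by blast
  qed
qed

text \<open>
  The ideal of \<open>D\<close> generated by the elements of \<open>C\<close> where \<open>h\<close> is false is proper, and a point of the
  Stone space of \<open>D\<close> that avoids it restricts to \<open>h\<close>.
\<close>

lemma St_extend:
  assumes C: "C \<in> comm_subalgs B" and D: "D \<in> comm_subalgs B" and CD: "C \<subseteq> D"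
    and h: "h \<in> St B C"
  obtains k where "k \<in> St B D" "h = (\<lambda>x\<in>C. k x)"
proof -
  note mem = bneg_mem[OF C] bjoin2_mem[OF C] bzero_mem[OF C] btop_mem[OF C]
  note memD = bneg_mem[OF D] bjoin2_mem[OF D] bzero_mem[OF D] btop_mem[OF D]
  define I where "I = {d\<in>D. \<exists>c\<in>C. \<not> h c \<and> ble B d c}"
  have "is_ideal D I"
    unfolding is_ideal_def
  proof (intro conjI ballI impI)
    show "I \<subseteq> D" by (auto simp: I_def)
    show "bzero B \<in> I"
      using memD mem St_zero[OF h] le_refl[OF C, of "bzero B"] by (auto simp: I_def)
    show "z \<in> I" if "y \<in> I" "z \<in> D" "ble B z y" for y z
      using that CD le_trans[OF D, of z y] unfolding I_def by blast
    show "bjoin B {y, z} \<in> I" if yz: "y \<in> I" "z \<in> I" for y z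
    proof -
      obtain c c' where c: "c \<in> C" "c' \<in> C" "\<not> h c" "\<not> h c'" "ble B y c" "ble B z c'"
        and d: "y \<in> D" "z \<in> D" using yz by (auto simp: I_def)
      have m: "bjoin B {c, c'} \<in> C" "\<not> h (bjoin B {c, c'})" using c mem St_join[OF h] by auto
      have "ble B y (bjoin B {c, c'})" "ble B z (bjoin B {c, c'})"
        using c d m CD le_trans[OF D, of y c "bjoin B {c, c'}"] le_trans[OF D, of z c' "bjoin B {c, c'}"]
          join_left[OF C, of c c'] join_right[OF C, of c c'] by auto
      then have "ble B (bjoin B {y, z}) (bjoin B {c, c'})"
        using d m CD by (intro join2_least[OF D]) auto
      then show ?thesis using m d memD by (auto simp: I_def)
    qed
  qed
  moreover have "btop B \<notin> I"
  proof
    assume "btop B \<in> I"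
    then obtain c where "c \<in> C" "\<not> h c" "ble B (btop B) c" by (auto simp: I_def)
    then have "\<not> h (btop B)" using top_leD[OF C] by blast
    then show False using St_neg[OF h] St_zero[OF h] mem by auto
  qed
  ultimately obtain k where k: "k \<in> St B D" "\<And>x. x \<in> I \<Longrightarrow> \<not> k x"
    using ideal_avoided[OF D] by blast
  have no: "\<not> k c" if "c \<in> C" "\<not> h c" for c
    using that CD le_refl[OF C] by (intro k(2)) (auto simp: I_def)
  have "h c \<longleftrightarrow> k c" if "c \<in> C" for c
    using no[of c] no[of "bneg B c"] that mem St_neg[OF h] St_neg[OF k(1)] CD by blast
  then have "h = (\<lambda>x\<in>C. k x)"
    using St_ext[OF h] by (auto intro!: extensionalityI[of h C] simp: PiE_def)
  then show ?thesis using that k by blast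
qed

lemma St_restrict:
  assumes "C \<in> comm_subalgs B" "C \<subseteq> D" "k \<in> St B D"
  shows "(\<lambda>x\<in>C. k x) \<in> St B C"
  using St_pullback[OF assms(1) subalg_hom_incl[OF assms(2)] assms(3)] .

lemma St_finite_join:
  assumes C: "C \<in> comm_subalgs B" and h: "h \<in> St B C" and "finite Y" "Y \<subseteq> C"
  shows "h (bjoin B Y) \<longleftrightarrow> (\<exists>y\<in>Y. h y)"
  using assms(3,4)
proof (induction Y)
  case empty
  then show ?case using St_zero[OF h] by simp
next
  case (insert x F)
  then show ?case
    using join_insert[OF C, of x F] St_join[OF h, of x "bjoin B F"] bjoin_mem[OF C, of F] by auto
qed

text \<open>The clopen sets given by elements of the algebra form a basis.\<close>

lemma Stone_basis:
  assumes C: "C \<in> comm_subalgs B" and W: "openin (Stone B C) W" and h: "h \<in> W"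
  shows "\<exists>c\<in>C. h c \<and> (\<forall>k\<in>St B C. k c \<longrightarrow> k \<in> W)"
proof -
  let ?P = "product_topology (\<lambda>_. discrete_topology (UNIV :: bool set)) C"
  obtain V where V: "openin ?P V" "W = V \<inter> St B C"
  proof -
    obtain V K where "openin ?P V" "W = V \<inter> K" "St B C = topspace ?P \<inter> K"
      using W unfolding Stone_def openin_subtopology topspace_subtopology by blast
    then show ?thesis using that[of V] openin_subset[of ?P V] by blast
  qed
  have hS: "h \<in> St B C" using V h by blast
  obtain U where U: "finite {i\<in>C. U i \<noteq> UNIV}" "h \<in> Pi\<^sub>E C U" "Pi\<^sub>E C U \<subseteq> V"
    using V h unfolding openin_product_topology_alt by fastforce
  define J where "J = {i\<in>C. U i \<noteq> UNIV}"
  define Y where "Y = (\<lambda>x. if h x then bneg B x else x) ` J"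
  have Y: "finite Y" "Y \<subseteq> C" using U(1) bneg_mem[OF C] by (auto simp: Y_def J_def)
  have mem: "bjoin B Y \<in> C" using bjoin_mem[OF C Y(2)] .
  have *: "k (bneg B (bjoin B Y)) \<longleftrightarrow> (\<forall>x\<in>J. k x = h x)" if k: "k \<in> St B C" for k
  proof -
    have "k (if h x then bneg B x else x) \<longleftrightarrow> k x \<noteq> h x" if "x \<in> J" for x
      using St_neg[OF k, of x] that by (simp add: J_def)
    then have "(\<exists>y\<in>Y. k y) \<longleftrightarrow> (\<exists>x\<in>J. k x \<noteq> h x)" unfolding Y_def by (simp only: bex_simps cong: bex_cong)
    then show ?thesis using St_neg[OF k mem] St_finite_join[OF C k Y] by simp
  qed
  have "k \<in> W" if k: "k \<in> St B C" "k (bneg B (bjoin B Y))" for k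
  proof -
    have "k x \<in> U x" if "x \<in> C" for x
    proof (cases "x \<in> J")
      case True
      then have "k x = h x" using * k by blast
      then show ?thesis using U(2) that by (simp add: PiE_iff)
    next
      case False
      then have "U x = UNIV" using that by (simp add: J_def)
      then show ?thesis by simp
    qed
    then have "k \<in> Pi\<^sub>E C U" using St_ext[OF k(1)] by (auto simp: PiE_iff)
    then show ?thesis using U(3) V k by blast
  qed
  then show ?thesis using * hS bneg_mem[OF C mem] by (intro bexI[of _ "bneg B (bjoin B Y)"]) auto
qed

lemma Stone_clopen:
  assumes "c \<in> C"
  shows "openin (Stone B C) {h \<in> St B C. h c}"
proof -
  have "continuous_map (Stone B C) (discrete_topology UNIV) (\<lambda>h. h c)"
    unfolding Stone_def
    by (rule continuous_map_from_subtopology) (rule continuous_map_product_projection[OF assms])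
  from openin_continuous_map_preimage[OF this, of "{True}"] show ?thesis by simp
qed

text \<open>
  Continuity is only ever used and verified in this form, with neighbourhoods given by elements of the algebra.
\<close>

lemma continuous_Stone_iff:
  fixes f :: "('b \<Rightarrow> bool) \<Rightarrow> 'm::metric_space"
  assumes C: "C \<in> comm_subalgs B"
  shows "continuous_map (Stone B C) euclidean f \<longleftrightarrow>
    (\<forall>h\<in>St B C. \<forall>e>0. \<exists>c\<in>C. h c \<and> (\<forall>k\<in>St B C. k c \<longrightarrow> dist (f k) (f h) < e))"
    (is "?L \<longleftrightarrow> ?R")
proof
  assume L: ?L
  show ?R
  proof (intro ballI allI impI)
    fix h and e :: real assume h: "h \<in> St B C" "e > 0"
    have "openin (Stone B C) {k \<in> St B C. f k \<in> ball (f h) e}"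
      using openin_continuous_map_preimage[OF L, of "ball (f h) e"] by simp
    moreover have "h \<in> {k \<in> St B C. f k \<in> ball (f h) e}" using h by simp
    ultimately have "\<exists>c\<in>C. h c \<and> (\<forall>k\<in>St B C. k c \<longrightarrow> k \<in> {k \<in> St B C. f k \<in> ball (f h) e})"
      by (rule Stone_basis[OF C])
    then show "\<exists>c\<in>C. h c \<and> (\<forall>k\<in>St B C. k c \<longrightarrow> dist (f k) (f h) < e)"
      by (simp add: dist_commute cong: conj_cong)
  qed
next
  assume R: ?R
  show ?L
    unfolding continuous_map_def
  proof (intro conjI allI impI)
    fix U :: "'m set" assume U: "openin euclidean U"
    show "openin (Stone B C) {x \<in> St B C. f x \<in> U}"
    proof (subst openin_subopen, intro ballI)
      fix h assume h: "h \<in> {x \<in> St B C. f x \<in> U}"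
      then obtain e where e: "e > 0" "\<And>y. dist y (f h) < e \<Longrightarrow> y \<in> U"
        using U by (auto simp: open_dist)
      have "h \<in> St B C" using h by simp
      with R e(1) have "\<exists>c\<in>C. h c \<and> (\<forall>k\<in>St B C. k c \<longrightarrow> dist (f k) (f h) < e)" by simp
      then obtain c where c: "c \<in> C" "h c \<and> (\<forall>k\<in>St B C. k c \<longrightarrow> dist (f k) (f h) < e)"
        by (rule bexE)
      show "\<exists>T. openin (Stone B C) T \<and> h \<in> T \<and> T \<subseteq> {x \<in> St B C. f x \<in> U}"
        by (rule exI[of _ "{k \<in> St B C. k c}"]) (use Stone_clopen[OF c(1)] h c e in auto)
    qed
  qed auto
qed

end


section \<open>Continuous functions on Stone spaces\<close>

lemma Func_carrier:
  "f \<in> carrier (Func B C) \<longleftrightarrow> f \<in> extensional (St B C) \<and> continuous_map (Stone B C) euclidean f"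
  by (simp add: Func_def Let_def)

lemma Func_simps:
  "f \<otimes>\<^bsub>Func B C\<^esub> g = (\<lambda>h\<in>St B C. f h * g h)"
  "f \<oplus>\<^bsub>Func B C\<^esub> g = (\<lambda>h\<in>St B C. f h + g h)"
  "\<one>\<^bsub>Func B C\<^esub> = (\<lambda>h\<in>St B C. 1)"
  "\<zero>\<^bsub>Func B C\<^esub> = (\<lambda>h\<in>St B C. 0)"
  "c \<odot>\<^bsub>Func B C\<^esub> f = (\<lambda>h\<in>St B C. c * f h)"
  "invol (Func B C) f = (\<lambda>h\<in>St B C. cnj (f h))"
  "cnorm (Func B C) f = Sup (insert 0 ((\<lambda>h. cmod (f h)) ` St B C))"
  by (simp_all add: Func_def Let_def)

lemma Func_eqI:
  "f \<in> carrier (Func B C) \<Longrightarrow> g \<in> carrier (Func B C) \<Longrightarrow> (\<And>h. h \<in> St B C \<Longrightarrow> f h = g h) \<Longrightarrow> f = g"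
  by (rule extensionalityI[of _ "St B C"]) (auto simp: Func_carrier)

lemma Func_combine:
  assumes "f \<in> carrier (Func B C)" "g \<in> carrier (Func B C)" "continuous_on UNIV \<phi>"
  shows "(\<lambda>h\<in>St B C. \<phi> (f h, g h)) \<in> carrier (Func B C)"
proof -
  have "continuous_map (Stone B C) (prod_topology euclidean euclidean) (\<lambda>h. (f h, g h))"
    using assms unfolding continuous_map_pairwise by (simp add: Func_carrier o_def)
  then have "continuous_map (Stone B C) euclidean (\<phi> \<circ> (\<lambda>h. (f h, g h)))"
    using assms(3) by (intro continuous_map_compose) (auto simp: euclidean_product_topology)
  then have "continuous_map (Stone B C) euclidean (\<lambda>h\<in>St B C. \<phi> (f h, g h))"
    by (rule continuous_map_eq) auto
  then show ?thesis by (simp add: Func_carrier)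
qed

lemma Func_closed:
  shows "f \<in> carrier (Func B C) \<Longrightarrow> g \<in> carrier (Func B C) \<Longrightarrow> (\<lambda>h\<in>St B C. f h * g h) \<in> carrier (Func B C)"
    and "f \<in> carrier (Func B C) \<Longrightarrow> g \<in> carrier (Func B C) \<Longrightarrow> (\<lambda>h\<in>St B C. f h + g h) \<in> carrier (Func B C)"
    and "f \<in> carrier (Func B C) \<Longrightarrow> (\<lambda>h\<in>St B C. c * f h) \<in> carrier (Func B C)"
    and "f \<in> carrier (Func B C) \<Longrightarrow> (\<lambda>h\<in>St B C. cnj (f h)) \<in> carrier (Func B C)"
proof -
  have c: "continuous_on UNIV (\<lambda>z :: complex \<times> complex. fst z * snd z)"
    "continuous_on UNIV (\<lambda>z :: complex \<times> complex. fst z + snd z)"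
    "continuous_on UNIV (\<lambda>z :: complex \<times> complex. c * fst z)"
    "continuous_on UNIV (\<lambda>z :: complex \<times> complex. cnj (fst z))"
    by (intro continuous_intros)+
  assume f: "f \<in> carrier (Func B C)"
  show "(\<lambda>h\<in>St B C. c * f h) \<in> carrier (Func B C)" "(\<lambda>h\<in>St B C. cnj (f h)) \<in> carrier (Func B C)"
    using Func_combine[OF f f c(3)] Func_combine[OF f f c(4)] by simp_all
  assume g: "g \<in> carrier (Func B C)"
  show "(\<lambda>h\<in>St B C. f h * g h) \<in> carrier (Func B C)" "(\<lambda>h\<in>St B C. f h + g h) \<in> carrier (Func B C)"
    using Func_combine[OF f g c(1)] Func_combine[OF f g c(2)] by simp_all
qed

lemma Func_const: "(\<lambda>h\<in>St B C. c) \<in> carrier (Func B C)"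
proof -
  have "continuous_map (Stone B C) euclidean (\<lambda>h\<in>St B C. c)"
    by (rule continuous_map_eq[of _ _ "\<lambda>_. c"]) auto
  then show ?thesis by (simp add: Func_carrier)
qed

text \<open>
  For open \<open>U\<close> this is the spectral projection of \<open>f\<close>: its clopen set is the closure of the preimage of
  \<open>U\<close>, which is open because \<open>C\<close> is complete.
\<close>

definition spec :: "'b pCBool \<Rightarrow> 'b set \<Rightarrow> 'b cfun \<Rightarrow> complex set \<Rightarrow> 'b" where
  "spec B C f U = bjoin B {c\<in>C. \<forall>h\<in>St B C. h c \<longrightarrow> f h \<in> U}"

definition chi :: "'b pCBool \<Rightarrow> 'b set \<Rightarrow> 'b \<Rightarrow> 'b cfun" where
  "chi B C c = (\<lambda>h\<in>St B C. if h c then 1 else 0)"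

context pcbool
begin

context
  fixes C assumes C: "C \<in> comm_subalgs B"
begin

lemma Func_I:
  assumes "f \<in> extensional (St B C)"
    "\<And>h e. h \<in> St B C \<Longrightarrow> e > 0 \<Longrightarrow> \<exists>c\<in>C. h c \<and> (\<forall>k\<in>St B C. k c \<longrightarrow> dist (f k) (f h) < e)"
  shows "f \<in> carrier (Func B C)"
  using assms continuous_Stone_iff[OF C, of f] by (simp add: Func_carrier)

lemma Func_D:
  assumes "f \<in> carrier (Func B C)" "h \<in> St B C" "e > 0"
  shows "\<exists>c\<in>C. h c \<and> (\<forall>k\<in>St B C. k c \<longrightarrow> dist (f k) (f h) < e)"
  using assms continuous_Stone_iff[OF C, of f] by (simp add: Func_carrier)

lemma chi_in: "c \<in> C \<Longrightarrow> chi B C c \<in> carrier (Func B C)"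
proof (rule Func_I)
  show "chi B C c \<in> extensional (St B C)" by (simp add: chi_def)
  fix h and e :: real assume c: "c \<in> C" and h: "h \<in> St B C" and e: "e > 0"
  show "\<exists>d\<in>C. h d \<and> (\<forall>k\<in>St B C. k d \<longrightarrow> dist (chi B C c k) (chi B C c h) < e)"
    by (rule bexI[of _ "if h c then c else bneg B c"])
      (use c h e bneg_mem[OF C c] St_neg[of _ B C c] in \<open>auto simp: chi_def\<close>)
qed

text \<open>
  The elements of \<open>C\<close> on which \<open>f\<close> is bounded form an ideal that no point avoids.
\<close>

lemma Func_bounded:
  assumes f: "f \<in> carrier (Func B C)"
  obtains M where "M \<ge> 0" "\<And>h. h \<in> St B C \<Longrightarrow> cmod (f h) \<le> M"
proof -
  define I where "I = {c\<in>C. \<exists>M. \<forall>h\<in>St B C. h c \<longrightarrow> cmod (f h) \<le> M}"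
  have I: "is_ideal C I"
    unfolding is_ideal_def
  proof (intro conjI ballI impI)
    show "I \<subseteq> C" "bzero B \<in> I" using bzero_mem[OF C] by (auto simp: I_def St_zero)
    show "y \<in> I" if "x \<in> I" "y \<in> C" "ble B y x" for x y
      using that St_le[of _ B C y x] by (auto simp: I_def)
    show "bjoin B {x, y} \<in> I" if xy: "x \<in> I" "y \<in> I" for x y
    proof -
      obtain M N where "\<forall>h\<in>St B C. h x \<longrightarrow> cmod (f h) \<le> M" "\<forall>h\<in>St B C. h y \<longrightarrow> cmod (f h) \<le> N"
        and m: "x \<in> C" "y \<in> C" using xy by (auto simp: I_def)
      then have "\<forall>h\<in>St B C. h (bjoin B {x, y}) \<longrightarrow> cmod (f h) \<le> max M N"
        using St_join[of _ B C x y] by (auto simp: le_max_iff_disj)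
      then show ?thesis using m bjoin2_mem[OF C] by (auto simp: I_def)
    qed
  qed
  have "btop B \<in> I"
  proof (rule ccontr)
    assume "btop B \<notin> I"
    then obtain h where h: "h \<in> St B C" "\<And>x. x \<in> I \<Longrightarrow> \<not> h x" using ideal_avoided[OF C I] by blast
    obtain c where c: "c \<in> C" "h c" "\<forall>k\<in>St B C. k c \<longrightarrow> dist (f k) (f h) < 1"
      using Func_D[OF f h(1), of 1] by auto
    have "cmod (f k) \<le> cmod (f h) + 1" if "k \<in> St B C" "k c" for k
      using c(3)[rule_format, OF that] norm_triangle_sub[of "f k" "f h"] by (simp add: dist_norm)
    then have "c \<in> I" using c by (auto simp: I_def)
    then show False using h c by blast
  qed
  then obtain M where M: "\<And>h. h \<in> St B C \<Longrightarrow> h (btop B) \<Longrightarrow> cmod (f h) \<le> M" by (auto simp: I_def)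
  have "cmod (f h) \<le> max 0 M" if "h \<in> St B C" for h
    using M[OF that] that St_neg[of h B C "bzero B"] St_zero[of h B C] bzero_mem[OF C] by auto
  then show ?thesis using that[of "max 0 M"] by auto
qed

lemma cnorm_le_iff:
  assumes "f \<in> carrier (Func B C)"
  shows "cnorm (Func B C) f \<le> M \<longleftrightarrow> M \<ge> 0 \<and> (\<forall>h\<in>St B C. cmod (f h) \<le> M)"
proof -
  obtain N where N: "N \<ge> 0" "\<And>h. h \<in> St B C \<Longrightarrow> cmod (f h) \<le> N" using Func_bounded[OF assms] by metis
  then have "bdd_above (insert 0 ((\<lambda>h. cmod (f h)) ` St B C))" by (auto intro!: bdd_aboveI[of _ N])
  then show ?thesis by (subst Func_simps, subst cSup_le_iff) auto
qed

lemma cnorm_nonneg: "f \<in> carrier (Func B C) \<Longrightarrow> cnorm (Func B C) f \<ge> 0"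
  and cnorm_upper: "f \<in> carrier (Func B C) \<Longrightarrow> h \<in> St B C \<Longrightarrow> cmod (f h) \<le> cnorm (Func B C) f"
  using cnorm_le_iff[of f "cnorm (Func B C) f"] by auto

context
  fixes f assumes f: "f \<in> carrier (Func B C)"
begin

lemma spec_mem: "spec B C f U \<in> C"
  unfolding spec_def by (rule bjoin_mem[OF C]) auto

lemma spec_covers:
  assumes U: "open U" and h: "h \<in> St B C" "f h \<in> U"
  shows "h (spec B C f U)"
proof -
  obtain e where e: "e > 0" "\<And>y. dist y (f h) < e \<Longrightarrow> y \<in> U"
    using U h by (auto simp: open_dist)
  obtain c where c: "c \<in> C" "h c" "\<forall>k\<in>St B C. k c \<longrightarrow> dist (f k) (f h) < e"
    using Func_D[OF f h(1) e(1)] by auto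
  then have "ble B c (spec B C f U)"
    unfolding spec_def by (intro join_upper[OF C]) (auto intro: e)
  then show ?thesis using St_le[OF h(1) c(1) spec_mem] c(2) by blast
qed

lemma spec_least:
  assumes "c \<in> C" "\<And>h. h \<in> St B C \<Longrightarrow> f h \<in> U \<Longrightarrow> h c"
  shows "ble B (spec B C f U) c"
  unfolding spec_def
proof (rule join_least[OF C])
  fix d assume "d \<in> {d\<in>C. \<forall>h\<in>St B C. h d \<longrightarrow> f h \<in> U}"
  then show "ble B d c" using assms by (subst le_iff_St[OF C _ assms(1)]) auto
qed (use assms in auto)

text \<open>
  A point where \<open>f\<close> is outside the closure has a neighbourhood \<open>c\<close> on which \<open>f\<close> stays outside; the
  complement of \<open>c\<close> covers the preimage of \<open>U\<close>, hence contains the spectral projection.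
\<close>

lemma spec_closure:
  assumes U: "open U" and h: "h \<in> St B C" "h (spec B C f U)"
  shows "f h \<in> closure U"
proof (rule ccontr)
  assume "f h \<notin> closure U"
  then have "f h \<in> - closure U" "open (- closure U)" by auto
  then obtain e where e: "e > 0" "\<And>y. dist y (f h) < e \<Longrightarrow> y \<in> - closure U"
    unfolding open_dist by blast
  obtain c where c: "c \<in> C" "h c" "\<forall>k\<in>St B C. k c \<longrightarrow> dist (f k) (f h) < e"
    using Func_D[OF f h(1) e(1)] by auto
  have "k (bneg B c)" if "k \<in> St B C" "f k \<in> U" for k
    using that c(3)[rule_format, OF that(1)] e(2)[of "f k"] closure_subset[of U] St_neg[OF that(1) c(1)] by auto
  then have "ble B (spec B C f U) (bneg B c)"
    using bneg_mem[OF C c(1)] by (intro spec_least) auto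
  then have "h (bneg B c)" using St_le[OF h(1) spec_mem bneg_mem[OF C c(1)]] h(2) by blast
  then show False using St_neg[OF h(1) c(1)] c(2) by blast
qed

end

lemma ball_separates:
  fixes z w :: complex assumes "z \<noteq> w"
  shows "z \<in> ball z (dist z w / 2)" "w \<notin> closure (ball z (dist z w / 2))"
  using assms by (auto simp: closure_ball)

text \<open>
  Taking for \<open>U\<close> a small ball around one of the values, spectral projections tell apart points with different values.
\<close>

lemma spec_separates:
  assumes f: "f \<in> carrier (Func B C)" and p: "p \<in> St B C" and q: "q \<in> St B C" and "f p \<noteq> f q"
  obtains U where "open U" "p (spec B C f U)" "\<not> q (spec B C f U)"
  using that[OF open_ball] spec_covers[OF f open_ball p] spec_closure[OF f open_ball q]
    ball_separates[OF assms(4)] by blast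

lemma spec_inj:
  assumes f: "f \<in> carrier (Func B C)" and g: "g \<in> carrier (Func B C)"
    and eq: "\<And>U. open U \<Longrightarrow> spec B C f U = spec B C g U"
  shows "f = g"
proof (rule Func_eqI[OF f g], rule ccontr)
  fix h assume h: "h \<in> St B C" "f h \<noteq> g h"
  show False
    using spec_covers[OF f open_ball h(1)] spec_closure[OF g open_ball h(1)] eq[OF open_ball]
      ball_separates[OF h(2)] by metis
qed

lemma spec_chi:
  assumes c: "c \<in> C"
  shows "spec B C (chi B C c) (ball 1 (1/2)) = c"
proof (rule le_antisym[OF C])
  note f = chi_in[OF c]
  show "spec B C (chi B C c) (ball 1 (1/2)) \<in> C" using spec_mem[OF f] .
  show "ble B (spec B C (chi B C c) (ball 1 (1/2))) c"
    by (rule spec_least[OF f c]) (auto simp: chi_def split: if_splits)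
  show "ble B c (spec B C (chi B C c) (ball 1 (1/2)))"
    unfolding spec_def by (rule join_upper[OF C]) (use c in \<open>auto simp: chi_def\<close>)
qed (rule c)

text \<open>
  A projection has values 0 and 1, so it is determined by its spectral projection for a ball around 1.
\<close>

lemma projections_Func: "projections (Func B C) = chi B C ` C"
proof (intro equalityI subsetI)
  fix p assume "p \<in> projections (Func B C)"
  then have p: "p \<in> carrier (Func B C)" "(\<lambda>h\<in>St B C. p h * p h) = p"
    by (auto simp: projections_def Func_simps)
  have 01: "p h = 0 \<or> p h = 1" if "h \<in> St B C" for h
  proof -
    have "p h * p h = p h" using fun_cong[OF p(2), of h] that by simp
    then show ?thesis by simp
  qed
  define c where "c = spec B C p (ball 1 (1/2))"
  have c: "c \<in> C" using spec_mem[OF p(1)] by (simp add: c_def)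
  have "p h = 1 \<longleftrightarrow> h c" if h: "h \<in> St B C" for h
    using 01[OF h] spec_covers[OF p(1) open_ball h, of 1 "1/2"]
      spec_closure[OF p(1) open_ball h, of 1 "1/2"] by (auto simp: c_def closure_ball)
  then have "p = chi B C c"
    by (intro Func_eqI[OF p(1) chi_in[OF c]]) (use 01 in \<open>auto simp: chi_def\<close>)
  then show "p \<in> chi B C ` C" using c by blast
next
  fix p assume "p \<in> chi B C ` C"
  then show "p \<in> projections (Func B C)"
    using chi_in by (auto simp: projections_def Func_simps chi_def)
qed

lemma chi_le_iff:
  assumes "c \<in> C" "d \<in> C"
  shows "chi B C c = chi B C c \<otimes>\<^bsub>Func B C\<^esub> chi B C d \<longleftrightarrow> ble B c d"
  unfolding le_iff_St[OF C assms] Func_simps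
proof
  assume "chi B C c = (\<lambda>h\<in>St B C. chi B C c h * chi B C d h)"
  then show "\<forall>h\<in>St B C. h c \<longrightarrow> h d"
    by (auto simp: chi_def fun_eq_iff split: if_splits)
next
  assume "\<forall>h\<in>St B C. h c \<longrightarrow> h d"
  then show "chi B C c = (\<lambda>h\<in>St B C. chi B C c h * chi B C d h)"
    by (auto simp: chi_def fun_eq_iff)
qed

lemma is_lub_chi:
  assumes X: "X \<subseteq> C"
  shows "is_lub (proj_order (Func B C)) p (chi B C ` X) \<longleftrightarrow> p = chi B C (bjoin B X)"
proof -
  let ?L = "proj_order (Func B C)"
  have L: "carrier ?L = chi B C ` C" "le ?L p q \<longleftrightarrow> p = p \<otimes>\<^bsub>Func B C\<^esub> q" for p q
    by (simp_all add: proj_order_def projections_Func)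
  have up: "Upper ?L (chi B C ` X) = chi B C ` {d\<in>C. \<forall>c\<in>X. ble B c d}"
  proof -
    have X': "x \<in> chi B C ` C" if "x \<in> chi B C ` X" for x using that X by blast
    have iff: "(\<forall>x. x \<in> chi B C ` X \<and> x \<in> chi B C ` C \<longrightarrow> le ?L x (chi B C d)) \<longleftrightarrow> (\<forall>c\<in>X. ble B c d)"
      if "d \<in> C" for d
      using chi_le_iff[OF _ that] X' X by (auto simp: L subset_iff)
    show ?thesis unfolding Upper_def L(1)
    proof (intro equalityI subsetI)
      fix q assume q: "q \<in> {l. \<forall>x. x \<in> chi B C ` X \<inter> chi B C ` C \<longrightarrow> le ?L x l} \<inter> chi B C ` C"
      then obtain d where "d \<in> C" "q = chi B C d" by blast
      then show "q \<in> chi B C ` {d\<in>C. \<forall>c\<in>X. ble B c d}" using q iff[of d] by blast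
    next
      fix q assume "q \<in> chi B C ` {d\<in>C. \<forall>c\<in>X. ble B c d}"
      then obtain d where "d \<in> C" "q = chi B C d" "\<forall>c\<in>X. ble B c d" by blast
      then show "q \<in> {l. \<forall>x. x \<in> chi B C ` X \<inter> chi B C ` C \<longrightarrow> le ?L x l} \<inter> chi B C ` C"
        using iff[of d] by blast
    qed
  qed
  have bj: "bjoin B X \<in> C" using bjoin_mem[OF C X] .
  have l: "is_lub ?L (chi B C (bjoin B X)) (chi B C ` X)"
    unfolding least_def up
    using bj join_upper[OF C X] join_least[OF C X] chi_le_iff[OF bj] by (auto simp: L projections_Func)
  moreover have "p = chi B C (bjoin B X)" if p: "is_lub ?L p (chi B C ` X)"
  proof -
    obtain c where c: "p = chi B C c" "c \<in> C" "\<forall>x\<in>X. ble B x c"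
      using p unfolding least_def up by auto
    have "ble B c (bjoin B X)"
      using p l chi_le_iff[OF c(2) bj] unfolding least_def by (auto simp: L c(1))
    moreover have "ble B (bjoin B X) c" using join_least[OF C X c(2)] c(3) by blast
    ultimately show ?thesis using le_antisym[OF C c(2) bj] c(1) by blast
  qed
  ultimately show ?thesis by blast
qed

text \<open>The support of \<open>f\<close> is its spectral projection for the complement of the origin.\<close>

lemma is_RP_Func:
  assumes f: "f \<in> carrier (Func B C)"
  shows "is_RP (Func B C) f p \<longleftrightarrow> p = chi B C (spec B C f (- {0}))"
proof -
  let ?L = "proj_order (Func B C)"
  have L: "carrier ?L = chi B C ` C" "le ?L p q \<longleftrightarrow> p = p \<otimes>\<^bsub>Func B C\<^esub> q" for p q
    by (simp_all add: proj_order_def projections_Func)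
  define e where "e = spec B C f (- {0})"
  have e: "e \<in> C" using spec_mem[OF f] by (simp add: e_def)
  have *: "f \<otimes>\<^bsub>Func B C\<^esub> chi B C c = f \<longleftrightarrow> ble B e c" if c: "c \<in> C" for c
  proof
    assume eq: "f \<otimes>\<^bsub>Func B C\<^esub> chi B C c = f"
    show "ble B e c" unfolding e_def
    proof (rule spec_least[OF f c])
      fix h assume "h \<in> St B C" "f h \<in> - {0}"
      then show "h c" using fun_cong[OF eq, of h] by (auto simp: Func_simps chi_def split: if_splits)
    qed
  next
    assume le: "ble B e c"
    have "h c" if "h \<in> St B C" "f h \<noteq> 0" for h
      using St_le[OF that(1) e c le] spec_covers[OF f _ that(1), of "- {0}"] that(2)
      by (auto simp: e_def open_Compl)
    then show "f \<otimes>\<^bsub>Func B C\<^esub> chi B C c = f"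
      unfolding Func_simps by (intro Func_eqI[OF Func_closed(1)[OF f chi_in[OF c]] f]) (auto simp: chi_def)
  qed
  have set: "{q \<in> projections (Func B C). f \<otimes>\<^bsub>Func B C\<^esub> q = f} = chi B C ` {c\<in>C. ble B e c}"
    using * by (auto simp: projections_Func)
  have l: "is_RP (Func B C) f (chi B C e)"
    unfolding is_RP_def set least_def using e le_refl[OF C] chi_le_iff[OF e]
    by (auto simp: L)
  moreover have "p = chi B C e" if p: "is_RP (Func B C) f p"
  proof -
    obtain c where c: "p = chi B C c" "c \<in> C" "ble B e c"
      using p unfolding is_RP_def least_def set by auto
    have "ble B c e"
      using p e le_refl[OF C e] chi_le_iff[OF c(2) e] unfolding is_RP_def least_def set
      by (auto simp: L c(1))
    then show ?thesis using le_antisym[OF C c(2) e] c by blast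
  qed
  ultimately show ?thesis unfolding e_def by blast
qed

end

section \<open>Change of subalgebra\<close>

context
  fixes B' :: "'c pCBool" and C D g
  assumes B': "pcbool B'" and C: "C \<in> comm_subalgs B" and D: "D \<in> comm_subalgs B'"
    and g: "subalg_hom B B' C D g"
begin

interpretation B': pcbool B' by (rule B')

lemma Func_map_apply:
  "h \<in> St B' D \<Longrightarrow> Func_map B' C D g f h = f (\<lambda>x\<in>C. h (g x))"
  by (simp add: Func_map_def)

lemma Func_map_in:
  assumes f: "f \<in> carrier (Func B C)"
  shows "Func_map B' C D g f \<in> carrier (Func B' D)"
proof (rule B'.Func_I[OF D])
  show "Func_map B' C D g f \<in> extensional (St B' D)" by (simp add: Func_map_def)
  fix h and e :: real assume h: "h \<in> St B' D" and e: "e > 0"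
  obtain c where c: "c \<in> C" "(\<lambda>x\<in>C. h (g x)) c"
    "\<forall>k\<in>St B C. k c \<longrightarrow> dist (f k) (f (\<lambda>x\<in>C. h (g x))) < e"
    using Func_D[OF C f St_pullback[OF C g h] e] by (rule bexE) simp
  show "\<exists>c\<in>D. h c \<and> (\<forall>k\<in>St B' D. k c \<longrightarrow> dist (Func_map B' C D g f k) (Func_map B' C D g f h) < e)"
    by (rule bexI[of _ "g c"])
      (use c h St_pullback[OF C g] g in \<open>auto simp: Func_map_def subalg_hom_def\<close>)
qed

text \<open>
  The spectral projection is the join of the elements \<open>c\<close> whose clopen set lies in the preimage of \<open>U\<close>.
  As \<open>g\<close> preserves joins and the clopen sets of the \<open>g c\<close> lie in the new preimage and cover it, this
  join is sent to the new spectral projection.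
\<close>

lemma spec_Func_map:
  assumes f: "f \<in> carrier (Func B C)" and U: "open U"
  shows "spec B' D (Func_map B' C D g f) U = g (spec B C f U)"
proof (rule B'.le_antisym[OF D])
  let ?f = "Func_map B' C D g f"
  note f' = Func_map_in[OF f]
  show m: "spec B' D ?f U \<in> D" using B'.spec_mem[OF D f'] .
  show gm: "g (spec B C f U) \<in> D" using g spec_mem[OF C f] by (auto simp: subalg_hom_def)
  show "ble B' (spec B' D ?f U) (g (spec B C f U))"
  proof (rule B'.spec_least[OF D f' gm])
    fix h assume h: "h \<in> St B' D" "?f h \<in> U"
    then show "h (g (spec B C f U))"
      using spec_covers[OF C f U St_pullback[OF C g h(1)]] spec_mem[OF C f]
      by (simp add: Func_map_apply)
  qed
  let ?S = "{c\<in>C. \<forall>h\<in>St B C. h c \<longrightarrow> f h \<in> U}"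
  have "g (spec B C f U) = bjoin B' (g ` ?S)"
    unfolding spec_def using g by (auto simp: subalg_hom_def)
  moreover have "ble B' (bjoin B' (g ` ?S)) (spec B' D ?f U)"
  proof (rule B'.join_least[OF D _ m])
    show "g ` ?S \<subseteq> D" using g by (auto simp: subalg_hom_def)
    fix d assume "d \<in> g ` ?S"
    then obtain c where c: "d = g c" "c \<in> C" "\<And>h. h \<in> St B C \<Longrightarrow> h c \<Longrightarrow> f h \<in> U" by auto
    have "d \<in> D" using c g by (auto simp: subalg_hom_def)
    moreover have "?f h \<in> U" if "h \<in> St B' D" "h d" for h
      using c(3)[OF St_pullback[OF C g that(1)]] that c by (simp add: Func_map_apply)
    ultimately show "ble B' d (spec B' D ?f U)"
      unfolding spec_def by (intro B'.join_upper[OF D]) auto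
  qed
  ultimately show "ble B' (g (spec B C f U)) (spec B' D ?f U)" by simp
qed

lemma Func_map_chi: "c \<in> C \<Longrightarrow> Func_map B' C D g (chi B C c) = chi B' D (g c)"
  using St_pullback[OF C g] by (auto simp: Func_map_def chi_def fun_eq_iff)

end

abbreviation res :: "'b set \<Rightarrow> 'b set \<Rightarrow> 'b cfun \<Rightarrow> 'b cfun" where
  "res C D \<equiv> Func_map B C D (\<lambda>x. x)"

lemma res_facts:
  assumes "C \<in> comm_subalgs B" "D \<in> comm_subalgs B" "C \<subseteq> D"
  shows res_in: "f \<in> carrier (Func B C) \<Longrightarrow> res C D f \<in> carrier (Func B D)"
    and spec_res: "f \<in> carrier (Func B C) \<Longrightarrow> open U \<Longrightarrow> spec B D (res C D f) U = spec B C f U"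
    and res_chi: "c \<in> C \<Longrightarrow> res C D (chi B C c) = chi B D c"
  using Func_map_in[OF pcbool_axioms assms(1,2) subalg_hom_incl[OF assms(3)]]
    spec_Func_map[OF pcbool_axioms assms(1,2) subalg_hom_incl[OF assms(3)]]
    Func_map_chi[OF pcbool_axioms assms(1,2) subalg_hom_incl[OF assms(3)]] by blast+

lemma res_apply: "h \<in> St B D \<Longrightarrow> res C D f h = f (\<lambda>x\<in>C. h x)"
  by (simp add: Func_map_def)

text \<open>
  A function descends to a subalgebra as soon as its spectral projections lie there: since they separate its
  values, it is constant on the fibres of the restriction map, and the function induced on the smaller Stone
  space is continuous because spectral projections for small balls are neighbourhoods of the required kind.
\<close>

lemma res_factor:
  assumes C: "C \<in> comm_subalgs B" and D: "D \<in> comm_subalgs B" and CD: "C \<subseteq> D"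
    and f: "f \<in> carrier (Func B D)" and sp: "\<And>U. open U \<Longrightarrow> spec B D f U \<in> C"
  obtains f0 where "f0 \<in> carrier (Func B C)" "f = res C D f0"
proof -
  have same: "f p = f q" if pq: "p \<in> St B D" "q \<in> St B D" "(\<lambda>x\<in>C. p x) = (\<lambda>x\<in>C. q x)" for p q
  proof (rule ccontr)
    assume "f p \<noteq> f q"
    then obtain U where U: "open U" "p (spec B D f U)" "\<not> q (spec B D f U)"
      using spec_separates[OF D f pq(1,2)] by blast
    then show False using fun_cong[OF pq(3), of "spec B D f U"] sp[OF U(1)] by simp
  qed
  define f0 where "f0 = (\<lambda>k\<in>St B C. f (SOME p. p \<in> St B D \<and> k = (\<lambda>x\<in>C. p x)))"
  have f0: "f0 (\<lambda>x\<in>C. p x) = f p" if p: "p \<in> St B D" for p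
  proof -
    let ?k = "\<lambda>x\<in>C. p x"
    let ?q = "SOME q. q \<in> St B D \<and> ?k = (\<lambda>x\<in>C. q x)"
    have "?q \<in> St B D \<and> ?k = (\<lambda>x\<in>C. ?q x)" by (rule someI[of _ p]) (use p in auto)
    then have "f ?q = f p" using same[of ?q p] p by auto
    then show ?thesis using St_restrict[OF C CD p] by (simp add: f0_def)
  qed
  have "f0 \<in> carrier (Func B C)"
  proof (rule Func_I[OF C])
    show "f0 \<in> extensional (St B C)" by (simp add: f0_def)
    fix h and e :: real assume h: "h \<in> St B C" and e: "e > 0"
    obtain p where p: "p \<in> St B D" "h = (\<lambda>x\<in>C. p x)" using St_extend[OF C D CD h] .
    let ?U = "ball (f p) (e / 2)"
    let ?c = "spec B D f ?U"
    have c: "?c \<in> C" using sp by simp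
    have "h ?c" using spec_covers[OF D f open_ball p(1), of "f p" "e/2"] e p c by simp
    moreover have "dist (f0 k) (f0 h) < e" if k: "k \<in> St B C" "k ?c" for k
    proof -
      obtain q where q: "q \<in> St B D" "k = (\<lambda>x\<in>C. q x)" using St_extend[OF C D CD k(1)] .
      have "f q \<in> closure ?U" using spec_closure[OF D f open_ball q(1)] k q c by simp
      then have "dist (f q) (f p) < e" using e by (simp add: closure_ball dist_commute)
      then show ?thesis using f0 p q by simp
    qed
    ultimately show "\<exists>c\<in>C. h c \<and> (\<forall>k\<in>St B C. k c \<longrightarrow> dist (f0 k) (f0 h) < e)" using c by blast
  qed
  moreover have "f = res C D f0"
    by (rule Func_eqI[OF f res_in[OF C D CD calculation]]) (simp add: res_apply f0)
  ultimately show ?thesis using that by blast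
qed

end


section \<open>Commutative C*-algebras inside a piecewise algebra\<close>

lemma cring_complex_ring: "cring complex_ring"
proof (rule cringI)
  show "abelian_group complex_ring"
    by (rule abelian_groupI) (auto simp: complex_ring_def algebra_simps intro: exI[of _ "- _"] add.left_inverse)
  show "comm_monoid complex_ring"
    by (rule comm_monoidI) (auto simp: complex_ring_def)
qed (auto simp: complex_ring_def algebra_simps)

lemma algebra_complexI:
  fixes A (structure)
  assumes cl: "\<And>a b. a \<in> T \<Longrightarrow> b \<in> T \<Longrightarrow> a \<oplus> b \<in> T" "\<And>a b. a \<in> T \<Longrightarrow> b \<in> T \<Longrightarrow> a \<otimes> b \<in> T"
    "\<zero> \<in> T" "\<one> \<in> T" "\<And>c a. a \<in> T \<Longrightarrow> c \<odot> a \<in> T"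
    and add: "\<And>a b c. a \<in> T \<Longrightarrow> b \<in> T \<Longrightarrow> c \<in> T \<Longrightarrow> (a \<oplus> b) \<oplus> c = a \<oplus> (b \<oplus> c)"
      "\<And>a b. a \<in> T \<Longrightarrow> b \<in> T \<Longrightarrow> a \<oplus> b = b \<oplus> a"
      "\<And>a. a \<in> T \<Longrightarrow> \<zero> \<oplus> a = a" "\<And>a. a \<in> T \<Longrightarrow> (- 1) \<odot> a \<oplus> a = \<zero>"
    and mult: "\<And>a b c. a \<in> T \<Longrightarrow> b \<in> T \<Longrightarrow> c \<in> T \<Longrightarrow> (a \<otimes> b) \<otimes> c = a \<otimes> (b \<otimes> c)"
      "\<And>a b. a \<in> T \<Longrightarrow> b \<in> T \<Longrightarrow> a \<otimes> b = b \<otimes> a" "\<And>a. a \<in> T \<Longrightarrow> \<one> \<otimes> a = a"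
      "\<And>a b c. a \<in> T \<Longrightarrow> b \<in> T \<Longrightarrow> c \<in> T \<Longrightarrow> (a \<oplus> b) \<otimes> c = a \<otimes> c \<oplus> b \<otimes> c"
    and scal: "\<And>c d a. a \<in> T \<Longrightarrow> (c + d) \<odot> a = c \<odot> a \<oplus> d \<odot> a"
      "\<And>c a b. a \<in> T \<Longrightarrow> b \<in> T \<Longrightarrow> c \<odot> (a \<oplus> b) = c \<odot> a \<oplus> c \<odot> b"
      "\<And>c d a. a \<in> T \<Longrightarrow> (c * d) \<odot> a = c \<odot> (d \<odot> a)" "\<And>a. a \<in> T \<Longrightarrow> 1 \<odot> a = a"
      "\<And>c a b. a \<in> T \<Longrightarrow> b \<in> T \<Longrightarrow> (c \<odot> a) \<otimes> b = c \<odot> (a \<otimes> b)"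
  shows "algebra complex_ring (A\<lparr>carrier := T\<rparr>)"
proof (rule algebraI[OF cring_complex_ring])
  have inv: "\<exists>y\<in>T. y \<oplus> x = \<zero>" if "x \<in> T" for x
    using cl(5)[OF that] add(4)[OF that] by blast
  show "cring (A\<lparr>carrier := T\<rparr>)"
  proof (rule cringI)
    show "abelian_group (A\<lparr>carrier := T\<rparr>)"
      by (rule abelian_groupI) (use cl add inv in \<open>simp_all\<close>)
    show "comm_monoid (A\<lparr>carrier := T\<rparr>)"
      by (rule comm_monoidI) (use cl mult in \<open>simp_all\<close>)
  qed (use mult in simp)
qed (use cl scal in \<open>simp_all add: complex_ring_def\<close>)

locale cstar =
  fixes A :: "('a, 'r) pCstar_scheme" (structure) and T :: "'a set"
  assumes cstar_on: "comm_Cstar_on A T"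
begin

abbreviation nrm :: "'a \<Rightarrow> real" where "nrm \<equiv> cnorm A"
abbreviation star :: "'a \<Rightarrow> 'a" where "star \<equiv> invol A"
abbreviation sub :: "'a \<Rightarrow> 'a \<Rightarrow> 'a" where "sub \<equiv> pminus A"

lemma alg: "algebra complex_ring (A\<lparr>carrier := T\<rparr>)"
  using cstar_on by (simp add: comm_Cstar_on_def)

lemma
  shows add_in [simp]: "a \<in> T \<Longrightarrow> b \<in> T \<Longrightarrow> a \<oplus> b \<in> T"
    and mult_in [simp]: "a \<in> T \<Longrightarrow> b \<in> T \<Longrightarrow> a \<otimes> b \<in> T"
    and zero_in [simp]: "\<zero> \<in> T"
    and one_in [simp]: "\<one> \<in> T"
    and scal_in [simp]: "a \<in> T \<Longrightarrow> c \<odot> a \<in> T"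
    and add_assoc: "a \<in> T \<Longrightarrow> b \<in> T \<Longrightarrow> c' \<in> T \<Longrightarrow> (a \<oplus> b) \<oplus> c' = a \<oplus> (b \<oplus> c')"
    and add_comm: "a \<in> T \<Longrightarrow> b \<in> T \<Longrightarrow> a \<oplus> b = b \<oplus> a"
    and add_zero [simp]: "a \<in> T \<Longrightarrow> \<zero> \<oplus> a = a" "a \<in> T \<Longrightarrow> a \<oplus> \<zero> = a"
    and mult_assoc: "a \<in> T \<Longrightarrow> b \<in> T \<Longrightarrow> c' \<in> T \<Longrightarrow> (a \<otimes> b) \<otimes> c' = a \<otimes> (b \<otimes> c')"
    and mult_comm: "a \<in> T \<Longrightarrow> b \<in> T \<Longrightarrow> a \<otimes> b = b \<otimes> a"
    and mult_one [simp]: "a \<in> T \<Longrightarrow> \<one> \<otimes> a = a" "a \<in> T \<Longrightarrow> a \<otimes> \<one> = a"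
    and mult_zero [simp]: "a \<in> T \<Longrightarrow> \<zero> \<otimes> a = \<zero>" "a \<in> T \<Longrightarrow> a \<otimes> \<zero> = \<zero>"
    and distr_l: "a \<in> T \<Longrightarrow> b \<in> T \<Longrightarrow> c' \<in> T \<Longrightarrow> (a \<oplus> b) \<otimes> c' = a \<otimes> c' \<oplus> b \<otimes> c'"
    and distr_r: "a \<in> T \<Longrightarrow> b \<in> T \<Longrightarrow> c' \<in> T \<Longrightarrow> c' \<otimes> (a \<oplus> b) = c' \<otimes> a \<oplus> c' \<otimes> b"
    and scal_distr: "a \<in> T \<Longrightarrow> (c + d) \<odot> a = c \<odot> a \<oplus> d \<odot> a"
    and scal_add: "a \<in> T \<Longrightarrow> b \<in> T \<Longrightarrow> c \<odot> (a \<oplus> b) = c \<odot> a \<oplus> c \<odot> b"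
    and scal_scal: "a \<in> T \<Longrightarrow> c \<odot> (d \<odot> a) = (c * d) \<odot> a"
    and scal_one [simp]: "a \<in> T \<Longrightarrow> 1 \<odot> a = a"
    and scal_zero [simp]: "a \<in> T \<Longrightarrow> 0 \<odot> a = \<zero>" "c \<odot> \<zero> = \<zero>"
    and scal_mult_l: "a \<in> T \<Longrightarrow> b \<in> T \<Longrightarrow> (c \<odot> a) \<otimes> b = c \<odot> (a \<otimes> b)"
proof -
  interpret C: cring "A\<lparr>carrier := T\<rparr>" by (rule algebra.M_cring[OF alg])
  interpret M: algebra complex_ring "A\<lparr>carrier := T\<rparr>" by (rule alg)
  have cr: "carrier complex_ring = UNIV" "zero complex_ring = 0" "one complex_ring = 1"
    "x \<oplus>\<^bsub>complex_ring\<^esub> y = x + y" "x \<otimes>\<^bsub>complex_ring\<^esub> y = x * y" for x y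
    by (simp_all add: complex_ring_def)
  show "a \<in> T \<Longrightarrow> b \<in> T \<Longrightarrow> a \<oplus> b \<in> T" using C.a_closed by simp
  show "a \<in> T \<Longrightarrow> b \<in> T \<Longrightarrow> a \<otimes> b \<in> T" using C.m_closed by simp
  show "\<zero> \<in> T" using C.zero_closed by simp
  show "\<one> \<in> T" using C.one_closed by simp
  show "a \<in> T \<Longrightarrow> c \<odot> a \<in> T" using M.smult_closed[of c a] by (simp add: cr)
  show "a \<in> T \<Longrightarrow> b \<in> T \<Longrightarrow> c' \<in> T \<Longrightarrow> (a \<oplus> b) \<oplus> c' = a \<oplus> (b \<oplus> c')" using C.a_assoc by simp
  show "a \<in> T \<Longrightarrow> b \<in> T \<Longrightarrow> a \<oplus> b = b \<oplus> a" using C.a_comm by simp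
  show "a \<in> T \<Longrightarrow> \<zero> \<oplus> a = a" "a \<in> T \<Longrightarrow> a \<oplus> \<zero> = a" using C.l_zero C.r_zero by simp_all
  show "a \<in> T \<Longrightarrow> b \<in> T \<Longrightarrow> c' \<in> T \<Longrightarrow> (a \<otimes> b) \<otimes> c' = a \<otimes> (b \<otimes> c')" using C.m_assoc by simp
  show "a \<in> T \<Longrightarrow> b \<in> T \<Longrightarrow> a \<otimes> b = b \<otimes> a" using C.m_comm by simp
  show "a \<in> T \<Longrightarrow> \<one> \<otimes> a = a" "a \<in> T \<Longrightarrow> a \<otimes> \<one> = a" using C.l_one C.r_one by simp_all
  show "a \<in> T \<Longrightarrow> \<zero> \<otimes> a = \<zero>" "a \<in> T \<Longrightarrow> a \<otimes> \<zero> = \<zero>" using C.l_null C.r_null by simp_all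
  show "a \<in> T \<Longrightarrow> b \<in> T \<Longrightarrow> c' \<in> T \<Longrightarrow> (a \<oplus> b) \<otimes> c' = a \<otimes> c' \<oplus> b \<otimes> c'" using C.l_distr by simp
  show "a \<in> T \<Longrightarrow> b \<in> T \<Longrightarrow> c' \<in> T \<Longrightarrow> c' \<otimes> (a \<oplus> b) = c' \<otimes> a \<oplus> c' \<otimes> b" using C.r_distr by simp
  show "a \<in> T \<Longrightarrow> (c + d) \<odot> a = c \<odot> a \<oplus> d \<odot> a" using M.smult_l_distr[of c d a] by (simp add: cr)
  show "a \<in> T \<Longrightarrow> b \<in> T \<Longrightarrow> c \<odot> (a \<oplus> b) = c \<odot> a \<oplus> c \<odot> b" using M.smult_r_distr[of c a b] by (simp add: cr)
  show "a \<in> T \<Longrightarrow> c \<odot> (d \<odot> a) = (c * d) \<odot> a" using M.smult_assoc1[of c d a] by (simp add: cr)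
  show "a \<in> T \<Longrightarrow> 1 \<odot> a = a" using M.smult_one[of a] by (simp add: cr)
  show "a \<in> T \<Longrightarrow> 0 \<odot> a = \<zero>" using M.smult_l_null[of a] by (simp add: cr)
  show "c \<odot> \<zero> = \<zero>" using M.smult_r_null[of c] by (simp add: cr)
  show "a \<in> T \<Longrightarrow> b \<in> T \<Longrightarrow> (c \<odot> a) \<otimes> b = c \<odot> (a \<otimes> b)" using M.smult_assoc2[of c a b] by (simp add: cr)
qed

lemma
  shows star_in [simp]: "a \<in> T \<Longrightarrow> star a \<in> T"
    and star_star [simp]: "a \<in> T \<Longrightarrow> star (star a) = a"
    and star_add: "a \<in> T \<Longrightarrow> b \<in> T \<Longrightarrow> star (a \<oplus> b) = star a \<oplus> star b"
    and star_mult: "a \<in> T \<Longrightarrow> b \<in> T \<Longrightarrow> star (a \<otimes> b) = star b \<otimes> star a"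
    and star_scal: "a \<in> T \<Longrightarrow> star (c \<odot> a) = cnj c \<odot> star a"
    and nrm_ge: "a \<in> T \<Longrightarrow> nrm a \<ge> 0"
    and nrm_zero_iff: "a \<in> T \<Longrightarrow> nrm a = 0 \<longleftrightarrow> a = \<zero>"
    and nrm_add: "a \<in> T \<Longrightarrow> b \<in> T \<Longrightarrow> nrm (a \<oplus> b) \<le> nrm a + nrm b"
    and nrm_scal: "a \<in> T \<Longrightarrow> nrm (c \<odot> a) = cmod c * nrm a"
    and nrm_mult: "a \<in> T \<Longrightarrow> b \<in> T \<Longrightarrow> nrm (a \<otimes> b) \<le> nrm a * nrm b"
    and nrm_cstar: "a \<in> T \<Longrightarrow> nrm (star a \<otimes> a) = (nrm a)\<^sup>2"
    and complete: "range s \<subseteq> T \<Longrightarrow> \<forall>e>0. \<exists>N. \<forall>m\<ge>N. \<forall>n\<ge>N. nrm (sub (s m) (s n)) < e \<Longrightarrow>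
       \<exists>x\<in>T. norm_limit A s x \<and> (\<forall>y. norm_limit A s y \<longrightarrow> y = x)"
  using cstar_on unfolding comm_Cstar_on_def by blast+

lemma sub_in [simp]: "a \<in> T \<Longrightarrow> b \<in> T \<Longrightarrow> sub a b \<in> T"
  by (simp add: pminus_def)

lemma mult_lcomm: "a \<in> T \<Longrightarrow> b \<in> T \<Longrightarrow> c \<in> T \<Longrightarrow> a \<otimes> (b \<otimes> c) = b \<otimes> (a \<otimes> c)"
  using mult_assoc[of a b c] mult_assoc[of b a c] mult_comm[of a b] by simp

lemma scal_mult_r: "a \<in> T \<Longrightarrow> b \<in> T \<Longrightarrow> a \<otimes> (c \<odot> b) = c \<odot> (a \<otimes> b)"
  using mult_comm[of a "c \<odot> b"] scal_mult_l[of b a c] mult_comm[of a b] by simp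

text \<open>
  A normal form for polynomial identities: a linear combination of monomials is a list of terms
  \<open>lincons m c\<close>, and the order of the arguments makes ordered rewriting sort it by monomials.
\<close>

definition lincons :: "'a \<Rightarrow> complex \<Rightarrow> 'a \<Rightarrow> 'a" where
  "lincons m c r = c \<odot> m \<oplus> r"

lemma lincons_in [simp]: "m \<in> T \<Longrightarrow> r \<in> T \<Longrightarrow> lincons m c r \<in> T"
  by (simp add: lincons_def)

lemma lincons_eqI: "a \<in> T \<Longrightarrow> b \<in> T \<Longrightarrow> lincons a 1 \<zero> = lincons b 1 \<zero> \<Longrightarrow> a = b"
  by (simp add: lincons_def)

lemma lincons_simps:
  "a \<in> T \<Longrightarrow> b \<in> T \<Longrightarrow> r \<in> T \<Longrightarrow> lincons (a \<oplus> b) c r = lincons a c (lincons b c r)"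
  "a \<in> T \<Longrightarrow> r \<in> T \<Longrightarrow> lincons (d \<odot> a) c r = lincons a (c * d) r"
  "r \<in> T \<Longrightarrow> lincons \<zero> c r = r"
  "a \<in> T \<Longrightarrow> r \<in> T \<Longrightarrow> lincons a 0 r = r"
  "a \<in> T \<Longrightarrow> r \<in> T \<Longrightarrow> lincons a c (lincons a d r) = lincons a (c + d) r"
  "a \<in> T \<Longrightarrow> b \<in> T \<Longrightarrow> r \<in> T \<Longrightarrow> lincons a c (lincons b d r) = lincons b d (lincons a c r)"
proof -
  have lc: "x \<in> T \<Longrightarrow> y \<in> T \<Longrightarrow> z \<in> T \<Longrightarrow> x \<oplus> (y \<oplus> z) = y \<oplus> (x \<oplus> z)" for x y z
    using add_assoc[of x y z] add_assoc[of y x z] add_comm[of x y] by simp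
  show "a \<in> T \<Longrightarrow> b \<in> T \<Longrightarrow> r \<in> T \<Longrightarrow> lincons (a \<oplus> b) c r = lincons a c (lincons b c r)"
    "a \<in> T \<Longrightarrow> r \<in> T \<Longrightarrow> lincons (d \<odot> a) c r = lincons a (c * d) r"
    "r \<in> T \<Longrightarrow> lincons \<zero> c r = r" "a \<in> T \<Longrightarrow> r \<in> T \<Longrightarrow> lincons a 0 r = r"
    "a \<in> T \<Longrightarrow> r \<in> T \<Longrightarrow> lincons a c (lincons a d r) = lincons a (c + d) r"
    "a \<in> T \<Longrightarrow> b \<in> T \<Longrightarrow> r \<in> T \<Longrightarrow> lincons a c (lincons b d r) = lincons b d (lincons a c r)"
    by (simp_all add: lincons_def scal_add scal_scal add_assoc scal_distr lc)
qed

lemmas lin = lincons_simps distr_l distr_r scal_mult_l scal_mult_r mult_assoc mult_comm mult_lcomm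
  pminus_def scal_scal

lemma star_zero [simp]: "star \<zero> = \<zero>"
  using star_scal[of \<one> 0] by simp

lemma star_one [simp]: "star \<one> = \<one>"
  using star_mult[of "star \<one>" \<one>] by simp

lemma star_sub: "a \<in> T \<Longrightarrow> b \<in> T \<Longrightarrow> star (sub a b) = sub (star a) (star b)"
  by (simp add: pminus_def star_add star_scal)

lemma nrm_star [simp]:
  assumes a: "a \<in> T" shows "nrm (star a) = nrm a"
proof -
  have le: "nrm b \<le> nrm (star b)" if b: "b \<in> T" for b
  proof (cases "nrm b = 0")
    case True then show ?thesis using nrm_ge[of "star b"] b by simp
  next
    case False
    have "nrm b * nrm b \<le> nrm (star b) * nrm b"
      using nrm_cstar[OF b] nrm_mult[of "star b" b] b by (simp add: power2_eq_square)
    then show ?thesis using False nrm_ge[OF b] by auto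
  qed
  show ?thesis using le[OF a] le[of "star a"] a by simp
qed

lemma nrm_sa: "a \<in> T \<Longrightarrow> star a = a \<Longrightarrow> nrm (a \<otimes> a) = (nrm a)\<^sup>2"
  using nrm_cstar[of a] by simp

lemma nrm_idem_le: "p \<in> T \<Longrightarrow> star p = p \<Longrightarrow> p \<otimes> p = p \<Longrightarrow> nrm p \<le> 1"
  using nrm_sa[of p] by (auto simp: power2_eq_square)

lemma nrm_one_le: "nrm \<one> \<le> 1"
  by (rule nrm_idem_le) auto

lemma nrm_zero [simp]: "nrm \<zero> = 0"
  using nrm_zero_iff by simp

lemma sub_self [simp]: "a \<in> T \<Longrightarrow> sub a a = \<zero>"
  by - (rule lincons_eqI; simp add: lin)

lemma sub_eq_zero: "a \<in> T \<Longrightarrow> b \<in> T \<Longrightarrow> sub a b = \<zero> \<Longrightarrow> a = b"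
proof -
  assume *: "a \<in> T" "b \<in> T" "sub a b = \<zero>"
  have "a = sub a b \<oplus> b" using *(1,2) by - (rule lincons_eqI; simp add: lin)
  then show "a = b" using * by simp
qed

lemma nrm_sub_commute: "a \<in> T \<Longrightarrow> b \<in> T \<Longrightarrow> nrm (sub a b) = nrm (sub b a)"
proof -
  assume *: "a \<in> T" "b \<in> T"
  have "sub a b = (- 1) \<odot> sub b a" using * by - (rule lincons_eqI; simp add: lin)
  then show ?thesis using * by (simp add: nrm_scal)
qed

lemma nrm_sub_le: "a \<in> T \<Longrightarrow> b \<in> T \<Longrightarrow> nrm (sub a b) \<le> nrm a + nrm b"
  using nrm_add[of a "(- 1) \<odot> b"] by (simp add: pminus_def nrm_scal)

lemma nrm_triangle: "a \<in> T \<Longrightarrow> b \<in> T \<Longrightarrow> c \<in> T \<Longrightarrow> nrm (sub a c) \<le> nrm (sub a b) + nrm (sub b c)"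
proof -
  assume *: "a \<in> T" "b \<in> T" "c \<in> T"
  have "sub a c = sub a b \<oplus> sub b c" using * by - (rule lincons_eqI; simp add: lin)
  then show ?thesis using nrm_add[of "sub a b" "sub b c"] * by simp
qed

lemma nrm_le_sub: "a \<in> T \<Longrightarrow> b \<in> T \<Longrightarrow> nrm a \<le> nrm (sub a b) + nrm b"
  using nrm_triangle[of a b \<zero>] by (simp add: pminus_def)

lemma zero_by_limit:
  assumes "a \<in> T" "\<And>n::nat. nrm a \<le> f n" "f \<longlonglongrightarrow> 0"
  shows "a = \<zero>"
proof -
  have "nrm a \<le> 0" by (rule LIMSEQ_le_const[OF assms(3)]) (use assms(2) in auto)
  then show ?thesis using nrm_ge nrm_zero_iff assms(1) by force
qed

lemma complete': "range s \<subseteq> T \<Longrightarrow> \<forall>e>0. \<exists>N. \<forall>m\<ge>N. \<forall>n\<ge>N. nrm (sub (s m) (s n)) < e \<Longrightarrow>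
    \<exists>x\<in>T. (\<lambda>n. nrm (sub (s n) x)) \<longlonglongrightarrow> 0"
  using complete[of s] unfolding norm_limit_def by blast

text \<open>
  The iteration \<open>y \<mapsto> (x + y\<^sup>2) / 2\<close> converges to a fixed point, and \<open>(1 - y)\<^sup>2 = 1 - x\<close> for every fixed point
  \<open>y\<close>.  Norms and distances of its members are dominated by the same iteration for the number 1 in place of
  \<open>x\<close>, which is increasing and bounded by 1.
\<close>

lemma sqrt_exists:
  assumes x: "x \<in> T" "star x = x" "nrm x \<le> 1"
  obtains y where "y \<in> T" "star y = y" "nrm y \<le> 1" "sub \<one> y \<otimes> sub \<one> y = sub \<one> x"
proof -
  define y where "y = rec_nat \<zero> (\<lambda>_ z. (1/2) \<odot> (x \<oplus> z \<otimes> z))"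
  define t where "t = rec_nat 0 (\<lambda>_ r. (1/2) * (1 + r * r) :: real)"
  have y0: "y 0 = \<zero>" and yS: "\<And>n. y (Suc n) = (1/2) \<odot> (x \<oplus> y n \<otimes> y n)" by (simp_all add: y_def)
  have t0: "t 0 = 0" and tS: "\<And>n. t (Suc n) = (1/2) * (1 + t n * t n)" by (simp_all add: t_def)
  have yT: "y n \<in> T" for n by (induction n) (simp_all add: y0 yS x)
  have ysa: "star (y n) = y n" for n
    by (induction n) (simp_all add: y0 yS x yT star_scal star_add star_mult)
  have t01: "0 \<le> t n \<and> t n \<le> 1" for n
  proof (induction n)
    case (Suc n)
    then have "t n * t n \<le> 1" using mult_mono[of "t n" 1 "t n" 1] by simp
    then show ?case using Suc by (simp add: tS)
  qed (simp add: t0)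
  have tinc: "t n \<le> t (Suc n)" for n
    using zero_le_power2[of "1 - t n"] by (simp add: tS power2_eq_square algebra_simps)
  have yt: "nrm (y n) \<le> t n" for n
  proof (induction n)
    case (Suc n)
    have "nrm (y n \<otimes> y n) \<le> t n * t n"
      using nrm_mult[OF yT yT, of n n] mult_mono[OF Suc Suc] nrm_ge[OF yT] t01[of n] by force
    then have "nrm (x \<oplus> y n \<otimes> y n) \<le> 1 + t n * t n"
      using nrm_add[of x "y n \<otimes> y n"] x yT by force
    then show ?case by (simp add: yS tS nrm_scal x yT)
  qed (simp add: y0 t0)
  have step: "nrm (sub (y (Suc n)) (y n)) \<le> t (Suc n) - t n" for n
  proof (induction n)
    case 0
    have "sub (y (Suc 0)) (y 0) = (1/2) \<odot> x" using x by - (rule lincons_eqI; simp add: lin y0 yS)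
    then show ?case using x by (simp add: tS t0 nrm_scal)
  next
    case (Suc n)
    have "sub ((1/2) \<odot> (x \<oplus> v \<otimes> v)) ((1/2) \<odot> (x \<oplus> u \<otimes> u)) = (1/2) \<odot> (sub v u \<otimes> (v \<oplus> u))"
      if "u \<in> T" "v \<in> T" for u v
      using x(1) that by - (rule lincons_eqI; simp add: lin)
    from this[OF yT[of n] yT[of "Suc n"]]
    have "sub (y (Suc (Suc n))) (y (Suc n)) = (1/2) \<odot> (sub (y (Suc n)) (y n) \<otimes> (y (Suc n) \<oplus> y n))"
      by (simp only: yS[symmetric])
    then have "nrm (sub (y (Suc (Suc n))) (y (Suc n)))
        = 1/2 * nrm (sub (y (Suc n)) (y n) \<otimes> (y (Suc n) \<oplus> y n))"
      by (simp add: nrm_scal yT)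
    also have "\<dots> \<le> 1/2 * (nrm (sub (y (Suc n)) (y n)) * nrm (y (Suc n) \<oplus> y n))"
      using nrm_mult[of "sub (y (Suc n)) (y n)" "y (Suc n) \<oplus> y n"] yT by simp
    also have "\<dots> \<le> 1/2 * ((t (Suc n) - t n) * (t (Suc n) + t n))"
      using Suc nrm_add[OF yT yT, of "Suc n" n] yt[of n] yt[of "Suc n"] tinc[of n] nrm_ge yT
      by (intro mult_left_mono mult_mono) (auto intro: order_trans)
    also have "\<dots> = t (Suc (Suc n)) - t (Suc n)"
      unfolding tS[of "Suc n"] by (simp add: tS[of n] field_simps)
    finally show ?case .
  qed
  have dist: "nrm (sub (y (n + k)) (y n)) \<le> t (n + k) - t n" for n k
  proof (induction k)
    case (Suc k)
    then show ?case
      using nrm_triangle[of "y (n + Suc k)" "y (n + k)" "y n"] step[of "n + k"] yT by simp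
  qed (simp add: yT)
  have "Bseq t" by (rule BseqI'[of _ 1]) (use t01 in auto)
  moreover have "incseq t" using tinc by (simp add: incseq_Suc_iff)
  ultimately have "convergent t" by (intro Bseq_mono_convergent) (auto simp: incseq_def)
  then have "Cauchy t" by (rule convergent_Cauchy)
  have "\<forall>e>0. \<exists>N. \<forall>m\<ge>N. \<forall>n\<ge>N. nrm (sub (y m) (y n)) < e"
  proof (intro allI impI)
    fix e :: real assume "e > 0"
    then obtain N where N: "\<And>m n. m \<ge> N \<Longrightarrow> n \<ge> N \<Longrightarrow> \<bar>t m - t n\<bar> < e"
      using \<open>Cauchy t\<close> unfolding Cauchy_def dist_real_def by blast
    have le: "nrm (sub (y m) (y n)) < e" if "N \<le> n" "n \<le> m" for m n
      using dist[of n "m - n"] N[of m n] that by simp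
    show "\<exists>N. \<forall>m\<ge>N. \<forall>n\<ge>N. nrm (sub (y m) (y n)) < e"
    proof (intro exI allI impI)
      fix m n assume "m \<ge> N" "n \<ge> N"
      then show "nrm (sub (y m) (y n)) < e"
        using le[of n m] le[of m n] nrm_sub_commute[OF yT yT, of m n] by (cases "n \<le> m") auto
    qed
  qed
  moreover have "range y \<subseteq> T" using yT by auto
  ultimately obtain Y where Y: "Y \<in> T" and lim: "(\<lambda>n. nrm (sub (y n) Y)) \<longlonglongrightarrow> 0"
    using complete' by blast
  note lims = LIMSEQ_Suc[OF lim]
  have saY: "star Y = Y"
  proof (rule sub_eq_zero)
    show "sub (star Y) Y = \<zero>"
    proof (rule zero_by_limit)
      fix n
      have "nrm (sub (star Y) (y n)) = nrm (sub (y n) Y)"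
        using nrm_star[of "sub Y (y n)"] nrm_sub_commute[OF Y yT, of n] ysa Y yT by (simp add: star_sub)
      then show "nrm (sub (star Y) Y) \<le> nrm (sub (y n) Y) + nrm (sub (y n) Y)"
        using nrm_triangle[of "star Y" "y n" Y] Y yT by simp
    qed (use Y tendsto_add[OF lim lim] in auto)
  qed (use Y in auto)
  have nY: "nrm Y \<le> 1"
  proof (rule LIMSEQ_le_const)
    show "(\<lambda>n. nrm (sub (y n) Y) + 1) \<longlonglongrightarrow> 1" using tendsto_add[OF lim tendsto_const[of 1]] by simp
    show "\<exists>N. \<forall>n\<ge>N. nrm Y \<le> nrm (sub (y n) Y) + 1"
      using nrm_le_sub[OF Y yT] nrm_sub_commute[OF Y yT] yt t01 by (metis add_mono_thms_linordered_semiring(2) order_trans)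
  qed
  have fixp: "sub Y ((1/2) \<odot> (x \<oplus> Y \<otimes> Y)) = \<zero>"
  proof (rule zero_by_limit)
    fix n
    have "sub Y ((1/2) \<odot> (x \<oplus> Y \<otimes> Y)) = sub Y (y (Suc n)) \<oplus> (1/2) \<odot> (sub (y n) Y \<otimes> (y n \<oplus> Y))"
      unfolding yS using x Y yT by - (rule lincons_eqI; simp add: lin)
    also have "nrm \<dots> \<le> nrm (sub Y (y (Suc n))) + 1/2 * (nrm (sub (y n) Y) * nrm (y n \<oplus> Y))"
      using nrm_add[of "sub Y (y (Suc n))" "(1/2) \<odot> (sub (y n) Y \<otimes> (y n \<oplus> Y))"]
        nrm_mult[of "sub (y n) Y" "y n \<oplus> Y"] Y yT by (simp add: nrm_scal)
    also have "\<dots> \<le> nrm (sub (y (Suc n)) Y) + 1/2 * (nrm (sub (y n) Y) * 2)"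
      using nrm_add[OF yT Y, of n] nY yt[of n] t01[of n] nrm_ge[of "sub (y n) Y"] nrm_sub_commute[OF Y yT] yT Y
      by (intro add_mono mult_left_mono) auto
    finally show "nrm (sub Y ((1/2) \<odot> (x \<oplus> Y \<otimes> Y)))
        \<le> nrm (sub (y (Suc n)) Y) + nrm (sub (y n) Y)" by simp
  qed (use x Y tendsto_add[OF lims lim] in auto)
  have "sub \<one> Y \<otimes> sub \<one> Y = sub \<one> x \<oplus> (-2) \<odot> sub Y ((1/2) \<odot> (x \<oplus> Y \<otimes> Y))"
    using x Y by - (rule lincons_eqI; simp add: lin)
  then have "sub \<one> Y \<otimes> sub \<one> Y = sub \<one> x" using fixp x by simp
  then show ?thesis using that Y saY nY by blast
qed

text \<open>
  With \<open>s\<close> in place of a cosine, every self-adjoint contraction behaves like a sine.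
\<close>

lemma sqrt_one_minus_square:
  assumes x: "x \<in> T" "star x = x" "nrm x \<le> 1"
  obtains s where "s \<in> T" "star s = s" "x \<otimes> x \<oplus> s \<otimes> s = \<one>"
proof -
  have "nrm (x \<otimes> x) \<le> 1" using nrm_sa[OF x(1,2)] x(3) nrm_ge[OF x(1)] by (simp add: power_le_one)
  then obtain y where y: "y \<in> T" "star y = y" "sub \<one> y \<otimes> sub \<one> y = sub \<one> (x \<otimes> x)"
    using sqrt_exists[of "x \<otimes> x"] x by (auto simp: star_mult)
  have "x \<otimes> x \<oplus> sub \<one> y \<otimes> sub \<one> y = \<one>"
    unfolding y(3) using x by - (rule lincons_eqI; simp add: lin)
  then show ?thesis using that[of "sub \<one> y"] y by (simp add: star_sub)
qed

text \<open>
  The element \<open>x\<close> is the real part of \<open>w = x + i y\<close>, and \<open>w\<close> has norm at most 1 because it is unitary.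
  All norm bounds on self-adjoint elements are obtained by completing a square to 1 in this way.
\<close>

lemma nrm_le_one_of_sum_squares:
  assumes x: "x \<in> T" "star x = x" and y: "y \<in> T" "star y = y" and 1: "x \<otimes> x \<oplus> y \<otimes> y = \<one>"
  shows "nrm x \<le> 1"
proof -
  define w where "w = x \<oplus> \<i> \<odot> y"
  have w: "w \<in> T" "star w = x \<oplus> (- \<i>) \<odot> y"
    using x y by (simp_all add: w_def star_add star_scal)
  have "star w \<otimes> w = x \<otimes> x \<oplus> y \<otimes> y"
    unfolding w(2) unfolding w_def using x(1) y(1) by - (rule lincons_eqI; simp add: lin)
  then have "(nrm w)\<^sup>2 \<le> 1" using nrm_cstar[OF w(1)] nrm_one_le 1 by simp
  then have nw: "nrm w \<le> 1" using nrm_ge[OF w(1)] by (simp add: power2_le_imp_le[of _ 1] abs_square_le_1)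
  have "x = (1/2) \<odot> (w \<oplus> star w)"
    unfolding w(2) unfolding w_def using x(1) y(1) by - (rule lincons_eqI; simp add: lin)
  then have "nrm x = 1/2 * nrm (w \<oplus> star w)" using w(1) by (metis add_in nrm_scal norm_divide norm_numeral norm_one star_in)
  then show ?thesis using nrm_add[of w "star w"] w(1) nw by simp
qed

lemma nrm_one_minus_square:
  assumes "x \<in> T" "star x = x" "nrm x \<le> 1"
  shows "nrm (sub \<one> (x \<otimes> x)) \<le> 1"
proof -
  obtain s where s: "s \<in> T" "star s = s" "x \<otimes> x \<oplus> s \<otimes> s = \<one>"
    using sqrt_one_minus_square[OF assms] .
  have "s \<otimes> s \<oplus> x \<otimes> x = \<one>" using s assms by (simp add: add_comm)
  then have "nrm s \<le> 1" using nrm_le_one_of_sum_squares[of s x] s assms by simp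
  then have "nrm (s \<otimes> s) \<le> 1" using nrm_sa[OF s(1,2)] nrm_ge[OF s(1)] by (simp add: power_le_one)
  moreover have "sub \<one> (x \<otimes> x) = s \<otimes> s"
    unfolding s(3)[symmetric] using s(1) assms(1) by - (rule lincons_eqI; simp add: lin)
  ultimately show ?thesis by simp
qed

text \<open>
  The absolute value \<open>m\<close> of \<open>a\<close> is the square root of \<open>a\<^sup>2\<close>.  It has a square root \<open>c\<close> itself, and with
  \<open>c\<^sup>2 + s\<^sup>2 = 1\<close> the double angle formulas \<open>2 c\<^sup>2 - 1\<close> and \<open>2 c s\<close> complete each other, which bounds \<open>2 m - 1\<close>.
\<close>

lemma abs_exists:
  assumes a: "a \<in> T" "star a = a" "nrm a \<le> 1"
  obtains m where "m \<in> T" "star m = m" "m \<otimes> m = a \<otimes> a" "nrm (sub m ((1/2) \<odot> \<one>)) \<le> 1/2"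
proof -
  have "star (sub \<one> (a \<otimes> a)) = sub \<one> (a \<otimes> a)" using a by (simp add: star_sub star_mult)
  then obtain y where y: "y \<in> T" "star y = y" "nrm y \<le> 1" "sub \<one> y \<otimes> sub \<one> y = sub \<one> (sub \<one> (a \<otimes> a))"
    using sqrt_exists[of "sub \<one> (a \<otimes> a)"] nrm_one_minus_square[OF a] a by auto
  define m where "m = sub \<one> y"
  have m: "m \<in> T" "star m = m" using y by (simp_all add: m_def star_sub)
  have "sub \<one> (sub \<one> (a \<otimes> a)) = a \<otimes> a" using a by - (rule lincons_eqI; simp add: lin)
  then have mm: "m \<otimes> m = a \<otimes> a" using y by (simp add: m_def)
  then have nm: "nrm m \<le> 1"
    using nrm_sa[OF m] nrm_sa[OF a(1,2)] a nrm_ge[OF m(1)] nrm_ge[OF a(1)]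
    by (simp add: power2_eq_iff_nonneg)
  obtain z where z: "z \<in> T" "star z = z" "sub \<one> z \<otimes> sub \<one> z = sub \<one> y"
    using sqrt_exists[OF y(1-3)] by blast
  define c where "c = sub \<one> z"
  have c: "c \<in> T" "star c = c" "c \<otimes> c = m" using z by (simp_all add: c_def m_def star_sub)
  then have "(nrm c)\<^sup>2 \<le> 1" using nrm_sa[of c] nm by simp
  then have nc: "nrm c \<le> 1" using nrm_ge[OF c(1)] by (simp add: abs_square_le_1)
  obtain s where s: "s \<in> T" "star s = s" "c \<otimes> c \<oplus> s \<otimes> s = \<one>"
    using sqrt_one_minus_square[OF c(1,2) nc] .
  let ?d = "sub (2 \<odot> (c \<otimes> c)) \<one>" and ?e = "2 \<odot> (c \<otimes> s)"
  have ss: "s \<otimes> s = sub \<one> (c \<otimes> c)" unfolding s(3)[symmetric] using c(1) s(1) by - (rule lincons_eqI; simp add: lin)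
  have "?d \<otimes> ?d \<oplus> ?e \<otimes> ?e = ?d \<otimes> ?d \<oplus> 4 \<odot> ((c \<otimes> c) \<otimes> (s \<otimes> s))"
    using c(1) s(1) by - (rule lincons_eqI; simp add: lin)
  also have "\<dots> = \<one>" unfolding ss using c(1) by - (rule lincons_eqI; simp add: lin)
  finally have "nrm ?d \<le> 1"
    using c(1,2) s(1,2) by (intro nrm_le_one_of_sum_squares[of ?d ?e]) (simp_all add: star_sub star_scal star_mult mult_comm)
  moreover have "sub m ((1/2) \<odot> \<one>) = (1/2) \<odot> ?d"
    unfolding c(3)[symmetric] using c(1) by - (rule lincons_eqI; simp add: lin)
  ultimately have "nrm (sub m ((1/2) \<odot> \<one>)) \<le> 1/2" using c(1) by (simp add: nrm_scal)
  then show ?thesis using that m mm by blast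
qed

text \<open>
  Scaling reduces a bound on an arbitrary element to contractivity of a self-adjoint one, by the C*-identity.
\<close>

lemma nrm_scaled_square:
  assumes "a \<in> T" "M > 0"
  shows "nrm ((1 / complex_of_real (M\<^sup>2)) \<odot> (star a \<otimes> a)) \<le> 1 \<longleftrightarrow> nrm a \<le> M"
proof -
  have "nrm ((1 / complex_of_real (M\<^sup>2)) \<odot> (star a \<otimes> a)) = (nrm a)\<^sup>2 / M\<^sup>2"
    using assms by (simp add: nrm_scal nrm_cstar norm_divide norm_power)
  also have "\<dots> \<le> 1 \<longleftrightarrow> (nrm a)\<^sup>2 \<le> M\<^sup>2" using assms by (simp add: divide_le_eq_1)
  also have "\<dots> \<longleftrightarrow> nrm a \<le> M" using assms nrm_ge by (simp add: power2_le_iff_abs_le)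
  finally show ?thesis .
qed

lemma star_scaled_square:
  "a \<in> T \<Longrightarrow> star ((1 / complex_of_real (M\<^sup>2)) \<odot> (star a \<otimes> a)) = (1 / complex_of_real (M\<^sup>2)) \<odot> (star a \<otimes> a)"
  by (simp add: star_scal star_mult mult_comm)

text \<open>
  A bound on \<open>a p\<close> and \<open>a q\<close> persists on the join of \<open>p\<close> and \<open>q\<close>: the scaled squares \<open>b\<close> and \<open>c\<close> of \<open>a p\<close> and
  \<open>a (q - p q)\<close> are orthogonal, so \<open>(b + c)\<^sup>2 = b\<^sup>2 + c\<^sup>2\<close> is completed to 1 by \<open>(1 - b\<^sup>2) (1 - c\<^sup>2)\<close>.
\<close>

lemma nrm_mult_join_le:
  assumes a: "a \<in> T" and p: "p \<in> T" "star p = p" "p \<otimes> p = p" and q: "q \<in> T" "star q = q" "q \<otimes> q = q"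
    and M: "M > 0" "nrm (a \<otimes> p) \<le> M" "nrm (a \<otimes> q) \<le> M"
  shows "nrm (a \<otimes> sub (p \<oplus> q) (p \<otimes> q)) \<le> M"
proof -
  define k where "k = 1 / complex_of_real (M\<^sup>2)"
  let ?u = "a \<otimes> p" and ?v = "a \<otimes> sub q (p \<otimes> q)" and ?r = "a \<otimes> sub (p \<oplus> q) (p \<otimes> q)"
  have pp: "p \<otimes> (p \<otimes> x) = p \<otimes> x" and qq: "q \<otimes> (q \<otimes> x) = q \<otimes> x" if "x \<in> T" for x
    using that p q by (simp_all add: mult_assoc[symmetric])
  have v: "?v = (a \<otimes> q) \<otimes> sub \<one> p" using a p q by - (rule lincons_eqI; simp add: lin)
  have "sub \<one> p \<otimes> sub \<one> p = sub \<one> p" using p by - (rule lincons_eqI; simp add: lin)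
  then have "nrm (sub \<one> p) \<le> 1" using p by (intro nrm_idem_le) (simp_all add: star_sub)
  then have "nrm ?v \<le> M"
    unfolding v using nrm_mult[of "a \<otimes> q" "sub \<one> p"] mult_mono[OF M(3), of "nrm (sub \<one> p)" 1] M(1)
      a p(1) q(1) nrm_ge[of "sub \<one> p"] by simp
  define b c where "b = k \<odot> (star ?u \<otimes> ?u)" and "c = k \<odot> (star ?v \<otimes> ?v)"
  have bc: "b \<in> T" "c \<in> T" "star b = b" "star c = c" "nrm b \<le> 1" "nrm c \<le> 1"
    unfolding b_def c_def k_def
    using nrm_scaled_square[of ?u M] nrm_scaled_square[of ?v M] M \<open>nrm ?v \<le> M\<close> a p(1) q(1)
      star_scaled_square[of ?u M] star_scaled_square[of ?v M] by simp_all
  obtain s where s: "s \<in> T" "star s = s" "b \<otimes> b \<oplus> s \<otimes> s = \<one>"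
    using sqrt_one_minus_square[of b] bc by blast
  obtain t where t: "t \<in> T" "star t = t" "c \<otimes> c \<oplus> t \<otimes> t = \<one>"
    using sqrt_one_minus_square[of c] bc by blast
  have uv: "star ?u = star a \<otimes> p" "star ?v = star a \<otimes> sub q (p \<otimes> q)" "star ?r = star a \<otimes> sub (p \<oplus> q) (p \<otimes> q)"
    using a p q by (simp_all add: star_mult star_sub star_add mult_comm)
  have b0: "b \<otimes> c = \<zero>"
    unfolding b_def c_def uv using a p(1) q(1) by - (rule lincons_eqI; simp add: lin p(3) q(3) pp qq)
  have ss: "s \<otimes> s = sub \<one> (b \<otimes> b)" unfolding s(3)[symmetric] using bc(1) s(1) by - (rule lincons_eqI; simp add: lin)
  have tt: "t \<otimes> t = sub \<one> (c \<otimes> c)" unfolding t(3)[symmetric] using bc(2) t(1) by - (rule lincons_eqI; simp add: lin)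
  have "(b \<oplus> c) \<otimes> (b \<oplus> c) \<oplus> (s \<otimes> t) \<otimes> (s \<otimes> t)
      = (b \<oplus> c) \<otimes> (b \<oplus> c) \<oplus> (s \<otimes> s) \<otimes> (t \<otimes> t)"
    using bc s t by - (rule lincons_eqI; simp add: lin)
  also have "\<dots> = \<one> \<oplus> 2 \<odot> (b \<otimes> c) \<oplus> (b \<otimes> c) \<otimes> (b \<otimes> c)"
    unfolding ss tt using bc(1,2) by - (rule lincons_eqI; simp add: lin)
  also have "\<dots> = \<one>" unfolding b0 by simp
  finally have "nrm (b \<oplus> c) \<le> 1"
    using bc s t by (intro nrm_le_one_of_sum_squares[of "b \<oplus> c" "s \<otimes> t"]) (simp_all add: star_add star_mult mult_comm)
  moreover have "b \<oplus> c = k \<odot> (star ?r \<otimes> ?r)"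
    unfolding b_def c_def uv using a p(1) q(1) by - (rule lincons_eqI; simp add: lin p(3) q(3) pp qq)
  ultimately show ?thesis using nrm_scaled_square[of ?r M] M a p q by (simp add: k_def)
qed

end

text \<open>
  A unital *-homomorphism maps a completion of a square to 1 to another such completion, so it sends
  self-adjoint contractions to contractions.
\<close>

lemma star_hom_contractive:
  fixes A :: "('a, 'r) pCstar_scheme" and A' :: "('c, 's) pCstar_scheme"
  assumes T: "cstar A T" and T': "cstar A' T'" and gT: "\<And>a. a \<in> T \<Longrightarrow> g a \<in> T'"
    and add: "\<And>a b. a \<in> T \<Longrightarrow> b \<in> T \<Longrightarrow> g (a \<oplus>\<^bsub>A\<^esub> b) = g a \<oplus>\<^bsub>A'\<^esub> g b"
    and mult: "\<And>a b. a \<in> T \<Longrightarrow> b \<in> T \<Longrightarrow> g (a \<otimes>\<^bsub>A\<^esub> b) = g a \<otimes>\<^bsub>A'\<^esub> g b"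
    and scal: "\<And>c a. a \<in> T \<Longrightarrow> g (c \<odot>\<^bsub>A\<^esub> a) = c \<odot>\<^bsub>A'\<^esub> g a"
    and star: "\<And>a. a \<in> T \<Longrightarrow> g (invol A a) = invol A' (g a)"
    and one: "g \<one>\<^bsub>A\<^esub> = \<one>\<^bsub>A'\<^esub>" and a: "a \<in> T"
  shows "cnorm A' (g a) \<le> cnorm A a"
proof (rule field_le_epsilon)
  interpret T: cstar A T by (rule T)
  interpret T': cstar A' T' by (rule T')
  fix e :: real assume e: "e > 0"
  define M where "M = cnorm A a + e"
  have M: "M > 0" "cnorm A a \<le> M" using e T.nrm_ge[OF a] by (auto simp: M_def)
  define z where "z = (1 / complex_of_real (M\<^sup>2)) \<odot>\<^bsub>A\<^esub> (invol A a \<otimes>\<^bsub>A\<^esub> a)"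
  have z: "z \<in> T" "invol A z = z" "cnorm A z \<le> 1"
    using a T.star_scaled_square[OF a] T.nrm_scaled_square[OF a M(1)] M(2) by (auto simp: z_def)
  obtain s where s: "s \<in> T" "invol A s = s" "z \<otimes>\<^bsub>A\<^esub> z \<oplus>\<^bsub>A\<^esub> s \<otimes>\<^bsub>A\<^esub> s = \<one>\<^bsub>A\<^esub>"
    using T.sqrt_one_minus_square[OF z] .
  have "g z \<otimes>\<^bsub>A'\<^esub> g z \<oplus>\<^bsub>A'\<^esub> g s \<otimes>\<^bsub>A'\<^esub> g s = \<one>\<^bsub>A'\<^esub>"
    using arg_cong[OF s(3), of g] z(1) s(1) by (simp add: add mult one)
  then have "cnorm A' (g z) \<le> 1"
    using T'.nrm_le_one_of_sum_squares[of "g z" "g s"] gT star[of z] star[of s] z s by simp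
  moreover have "g z = (1 / complex_of_real (M\<^sup>2)) \<odot>\<^bsub>A'\<^esub> (invol A' (g a) \<otimes>\<^bsub>A'\<^esub> g a)"
    using a by (simp add: z_def scal mult star)
  ultimately show "cnorm A' (g a) \<le> cnorm A a + e"
    using T'.nrm_scaled_square[of "g a" M] gT[OF a] M by (simp add: M_def)
qed

locale awstar = cstar A T for A :: "'a pAWstar" (structure) and T +
  assumes aw: "comm_AWstar_on A T"
begin

lemma annihilator:
  assumes "X \<subseteq> T"
  obtains p where "p \<in> projections A" "p \<in> T" "{b\<in>T. \<forall>x\<in>X. x \<otimes> b = \<zero>} = {p \<otimes> c | c. c \<in> T}"
  using aw assms unfolding comm_AWstar_on_def by blast

text \<open>
  If \<open>a = m (2 p - 1)\<close> is a polar decomposition with \<open>0 \<le> m \<le> 1\<close>, then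
  \<open>a - (p - 1/2) = (m - 1/2) (2 p - 1)\<close>; for \<open>p\<close> one takes the annihilator of the negative part of \<open>a\<close>.
\<close>

lemma halving:
  assumes a: "a \<in> T" "star a = a" "nrm a \<le> 1"
  obtains p where "p \<in> projections A" "p \<in> T" "nrm (sub a (sub p ((1/2) \<odot> \<one>))) \<le> 1/2"
proof -
  obtain m where m: "m \<in> T" "star m = m" "m \<otimes> m = a \<otimes> a" "nrm (sub m ((1/2) \<odot> \<one>)) \<le> 1/2"
    using abs_exists[OF a] .
  let ?P = "(1/2) \<odot> (m \<oplus> a)" and ?N = "(1/2) \<odot> sub m a"
  obtain p where p: "p \<in> projections A" "p \<in> T" "{b\<in>T. \<forall>x\<in>{?N}. x \<otimes> b = \<zero>} = {p \<otimes> c | c. c \<in> T}"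
    using annihilator[of "{?N}"] m a by auto
  have pp: "p \<otimes> p = p" "star p = p" using p(1) by (auto simp: projections_def)
  have "?N \<otimes> ?P = (1/4) \<odot> sub (m \<otimes> m) (a \<otimes> a)" using m(1) a(1) by - (rule lincons_eqI; simp add: lin)
  also have "\<dots> = \<zero>" unfolding m(3) using a(1) by simp
  finally have "?P \<in> {p \<otimes> c | c. c \<in> T}" using m(1) a(1) unfolding p(3)[symmetric] by simp
  then obtain c where c: "c \<in> T" "?P = p \<otimes> c" by blast
  have pP: "p \<otimes> ?P = ?P" unfolding c(2) using pp p c by (simp add: mult_assoc[symmetric])
  have "p \<in> {p \<otimes> c | c. c \<in> T}" using p(2) pp(1) by (intro CollectI exI[of _ p]) simp
  then have pN: "?N \<otimes> p = \<zero>" unfolding p(3)[symmetric] by simp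
  let ?r = "sub (2 \<odot> p) \<one>"
  have am: "a = ?r \<otimes> m"
  proof -
    have "?r \<otimes> m = 2 \<odot> (p \<otimes> ?P) \<oplus> 2 \<odot> (?N \<otimes> p) \<oplus> (-1) \<odot> m"
      using m(1) a(1) p(2) by - (rule lincons_eqI; simp add: lin)
    also have "\<dots> = a" unfolding pP pN using m(1) a(1) by - (rule lincons_eqI; simp add: lin)
    finally show ?thesis by simp
  qed
  have "?r \<otimes> ?r = \<one>" using p(2) pp(1) by - (rule lincons_eqI; simp add: lin)
  then have "(nrm ?r)\<^sup>2 \<le> 1" using nrm_sa[of ?r] p(2) pp nrm_one_le by (simp add: star_sub star_scal)
  then have nr: "nrm ?r \<le> 1" using nrm_ge[of ?r] p(2) by (simp add: abs_square_le_1)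
  have "sub a (sub p ((1/2) \<odot> \<one>)) = ?r \<otimes> sub m ((1/2) \<odot> \<one>)"
    unfolding am using p(2) m(1) by - (rule lincons_eqI; simp add: lin)
  then have "nrm (sub a (sub p ((1/2) \<odot> \<one>))) \<le> nrm ?r * nrm (sub m ((1/2) \<odot> \<one>))"
    using nrm_mult[of ?r "sub m ((1/2) \<odot> \<one>)"] p(2) m(1) by simp
  also have "\<dots> \<le> 1 * (1/2)" using nr m p(2) nrm_ge by (intro mult_mono) auto
  finally show ?thesis using that[OF p(1,2)] by simp
qed

text \<open>
  Iterating the halving step gives a binary expansion of every self-adjoint contraction whose digits are
  projections; so the projections span a dense subspace.
\<close>

lemma projections_dense:
  assumes R: "R \<subseteq> T" "projections A \<inter> T \<subseteq> R"
    and add: "\<And>a b. a \<in> R \<Longrightarrow> b \<in> R \<Longrightarrow> a \<oplus> b \<in> R" and scal: "\<And>c a. a \<in> R \<Longrightarrow> c \<odot> a \<in> R"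
    and closed: "\<And>a. a \<in> T \<Longrightarrow> (\<And>e. e > 0 \<Longrightarrow> \<exists>b\<in>R. nrm (sub a b) < e) \<Longrightarrow> a \<in> R"
    and one: "\<one> \<in> R"
  shows "R = T"
proof -
  have contr: "a \<in> R" if a: "a \<in> T" "star a = a" "nrm a \<le> 1" for a
  proof (rule closed[OF a(1)])
    fix e :: real assume e: "e > 0"
    have "\<exists>b\<in>R. star b = b \<and> nrm (sub a b) \<le> (1/2)^n" for n
    proof (induction n)
      case 0
      have "(0::complex) \<odot> \<one> \<in> R" using scal one by blast
      then have "\<zero> \<in> R" by simp
      moreover have "sub a \<zero> = a" using a by (simp add: pminus_def)
      ultimately show ?case using a by (intro bexI[of _ \<zero>]) auto
    next
      case (Suc n)
      then obtain b where b: "b \<in> R" "star b = b" "nrm (sub a b) \<le> (1/2)^n" by blast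
      have bT: "b \<in> T" using b R by blast
      define k :: complex where "k = 2^n"
      have k: "k \<noteq> 0" "cmod k = 2^n" "cnj k = k" by (simp_all add: k_def norm_power)
      have "nrm (k \<odot> sub a b) \<le> 1"
        using b(3) a bT k by (simp add: nrm_scal power_divide field_simps)
      then obtain p where p: "p \<in> projections A" "p \<in> T" "nrm (sub (k \<odot> sub a b) (sub p ((1/2) \<odot> \<one>))) \<le> 1/2"
        using halving[of "k \<odot> sub a b"] a bT b k by (auto simp: star_scal star_sub)
      let ?b = "b \<oplus> (1/k) \<odot> sub p ((1/2) \<odot> \<one>)"
      have "?b \<in> R" unfolding pminus_def using p R b one by (intro add scal) auto
      moreover have "star ?b = ?b"
        using p bT b k by (simp add: star_add star_scal star_sub projections_def)
      moreover have "sub a ?b = (1/k) \<odot> sub (k \<odot> sub a b) (sub p ((1/2) \<odot> \<one>))"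
        using a(1) bT p(2) k(1) by - (rule lincons_eqI; simp add: lin)
      then have "nrm (sub a ?b) \<le> (1/2)^Suc n"
        using p a bT k by (simp add: nrm_scal norm_divide power_divide field_simps)
      ultimately show ?case by blast
    qed
    moreover obtain n where "(1/2::real)^n < e" using real_arch_pow_inv[OF e, of "1/2"] by auto
    ultimately show "\<exists>b\<in>R. nrm (sub a b) < e" by (meson order.strict_trans1)
  qed
  have sa: "a \<in> R" if a: "a \<in> T" "star a = a" for a
  proof -
    define k where "k = complex_of_real (nrm a + 1)"
    have k: "cmod k = nrm a + 1" "k \<noteq> 0" "cnj k = k"
      using nrm_ge[OF a(1)] unfolding k_def by (auto simp del: of_real_add)
    have "(1/k) \<odot> a \<in> R"
      by (rule contr) (use a k nrm_ge[OF a(1)] in \<open>auto simp: star_scal nrm_scal norm_divide\<close>)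
    then have "k \<odot> ((1/k) \<odot> a) \<in> R" by (rule scal)
    then show ?thesis using a k by (simp add: scal_scal)
  qed
  have "a \<in> R" if a: "a \<in> T" for a
  proof -
    have re: "(1/2) \<odot> (a \<oplus> star a) \<in> R"
      using a by (intro sa) (simp_all add: star_scal star_add add_comm)
    have "(1 / (2 * \<i>)) \<odot> sub a (star a) \<in> R"
    proof (rule sa)
      have "(- (1 / (2 * \<i>))) \<odot> sub (star a) a = (1 / (2 * \<i>)) \<odot> sub a (star a)"
        using a by - (rule lincons_eqI; simp add: lin)
      then show "star ((1 / (2 * \<i>)) \<odot> sub a (star a)) = (1 / (2 * \<i>)) \<odot> sub a (star a)"
        using a by (simp add: star_scal star_sub)
    qed (use a in simp)
    from add[OF re scal[OF this]]
    have "(1/2) \<odot> (a \<oplus> star a) \<oplus> \<i> \<odot> ((1 / (2 * \<i>)) \<odot> sub a (star a)) \<in> R" .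
    moreover have "a = (1/2) \<odot> (a \<oplus> star a) \<oplus> \<i> \<odot> ((1 / (2 * \<i>)) \<odot> sub a (star a))"
      using a by - (rule lincons_eqI; simp add: lin)
    ultimately show ?thesis by metis
  qed
  then show ?thesis using R by blast
qed

end


section \<open>The piecewise AW*-algebra of a piecewise complete Boolean algebra\<close>

lemma F_class_eq_iff: "F_class B C f = F_class B D g \<longleftrightarrow> equivclp (F_link B) (C, f) (D, g)"
proof
  assume "F_class B C f = F_class B D g"
  then have "(D, g) \<in> F_class B C f" by (simp add: F_class_def)
  then show "equivclp (F_link B) (C, f) (D, g)" by (simp add: F_class_def)
next
  assume "equivclp (F_link B) (C, f) (D, g)"
  then show "F_class B C f = F_class B D g"
    unfolding F_class_def by (auto intro: equivclp_trans equivclp_sym)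
qed

lemma F_carrier_iff:
  "u \<in> F_carrier B \<longleftrightarrow> (\<exists>C\<in>comm_subalgs B. \<exists>f\<in>carrier (Func B C). u = F_class B C f)"
  by (auto simp: F_carrier_def quotient_def F_class_def)

text \<open>
  The copy of \<open>Func B C\<close> inside \<open>F B\<close>.
\<close>

definition hat :: "'b pCBool \<Rightarrow> 'b set \<Rightarrow> 'b F_elem set" where
  "hat B C = F_class B C ` carrier (Func B C)"

text \<open>The unit of the equivalence: an element is sent to its characteristic function.\<close>

definition eta :: "'b pCBool \<Rightarrow> 'b \<Rightarrow> 'b F_elem" where
  "eta B b = (SOME w. \<exists>C\<in>comm_subalgs B. b \<in> C \<and> w = F_class B C (chi B C b))"

lemma least_image:
  assumes L': "carrier L' = \<phi> ` carrier L"
    and le: "\<And>x y. x \<in> carrier L \<Longrightarrow> y \<in> carrier L \<Longrightarrow> le L' (\<phi> x) (\<phi> y) \<longleftrightarrow> le L x y"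
    and S: "S \<subseteq> carrier L" and x: "least L x S"
  shows "least L' (\<phi> x) (\<phi> ` S)"
  using x S unfolding least_def L' by (auto simp: le subset_iff)

lemma Upper_image:
  assumes L': "carrier L' = \<phi> ` carrier L"
    and le: "\<And>x y. x \<in> carrier L \<Longrightarrow> y \<in> carrier L \<Longrightarrow> le L' (\<phi> x) (\<phi> y) \<longleftrightarrow> le L x y"
    and S: "S \<subseteq> carrier L"
  shows "Upper L' (\<phi> ` S) = \<phi> ` Upper L S"
proof -
  have "(\<forall>x. x \<in> \<phi> ` S \<inter> \<phi> ` carrier L \<longrightarrow> le L' x (\<phi> u)) \<longleftrightarrow> (\<forall>x. x \<in> S \<inter> carrier L \<longrightarrow> le L x u)"
    if u: "u \<in> carrier L" for u
    using S le[OF _ u] by blast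
  then show ?thesis unfolding Upper_def L' by blast
qed

context pcbool
begin

lemma subalg_Int: "C \<in> comm_subalgs B \<Longrightarrow> D \<in> comm_subalgs B \<Longrightarrow> C \<inter> D \<in> comm_subalgs B"
  unfolding comm_subalgs_def by auto

lemma subalg_exists: "\<exists>C. C \<in> comm_subalgs B"
  using commeasurable_in_subalg[of "{}"] by auto

lemma spec_equivclp:
  assumes "equivclp (F_link B) u v" "open U"
  shows "spec B (fst u) (snd u) U = spec B (fst v) (snd v) U"
  using assms(1)
proof (induction rule: equivclp_induct)
  case (step y z)
  have L: "spec B (fst x) (snd x) U = spec B (fst x') (snd x') U" if "F_link B x x'" for x x'
    using that spec_res assms(2) by (auto simp: F_link_def)
  show ?case using step(2,3) L[of y z] L[of z y] by auto
qed simp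

lemma F_class_res:
  assumes "C \<in> comm_subalgs B" "D \<in> comm_subalgs B" "C \<subseteq> D" "f \<in> carrier (Func B C)"
  shows "F_class B D (res C D f) = F_class B C f"
proof -
  have "F_link B (C, f) (D, res C D f)" using assms by (auto simp: F_link_def)
  then show ?thesis unfolding F_class_eq_iff by (simp add: r_into_equivclp equivclp_sym)
qed

text \<open>
  Functions with the same spectral projections descend to the intersection of their algebras, where they
  agree, as a function is determined by its spectral projections.
\<close>

lemma spec_common:
  assumes C: "C \<in> comm_subalgs B" and D: "D \<in> comm_subalgs B"
    and f: "f \<in> carrier (Func B C)" and g: "g \<in> carrier (Func B D)"
    and sp: "\<And>U. open U \<Longrightarrow> spec B C f U = spec B D g U"
  obtains h where "h \<in> carrier (Func B (C \<inter> D))" "f = res (C \<inter> D) C h" "g = res (C \<inter> D) D h"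
proof -
  note E = subalg_Int[OF C D]
  have inE: "spec B C f U \<in> C \<inter> D" "spec B D g U \<in> C \<inter> D" if "open U" for U
    using sp[OF that] spec_mem[OF C f, of U] spec_mem[OF D g, of U] by auto
  obtain h where h: "h \<in> carrier (Func B (C \<inter> D))" "f = res (C \<inter> D) C h"
    using res_factor[OF E C _ f inE(1)] by blast
  obtain k where k: "k \<in> carrier (Func B (C \<inter> D))" "g = res (C \<inter> D) D k"
    using res_factor[OF E D _ g inE(2)] by blast
  have "h = k"
  proof (rule spec_inj[OF E h(1) k(1)])
    fix U :: "complex set" assume U: "open U"
    show "spec B (C \<inter> D) h U = spec B (C \<inter> D) k U"
      using sp[OF U] spec_res[OF E C _ h(1) U] spec_res[OF E D _ k(1) U] h(2) k(2) by simp
  qed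
  then show ?thesis using that h k by blast
qed

text \<open>
  This makes the colimit \<open>F B\<close> computable although it is not directed: spectral projections are invariant
  under restriction, so two representatives of a class come from one function on the intersection.
\<close>

lemma F_common:
  assumes C: "C \<in> comm_subalgs B" and D: "D \<in> comm_subalgs B"
    and f: "f \<in> carrier (Func B C)" and g: "g \<in> carrier (Func B D)"
    and eq: "F_class B C f = F_class B D g"
  obtains h where "h \<in> carrier (Func B (C \<inter> D))" "f = res (C \<inter> D) C h" "g = res (C \<inter> D) D h"
proof -
  have "spec B C f U = spec B D g U" if "open U" for U
    using eq spec_equivclp[OF _ that, of "(C, f)" "(D, g)"] by (simp add: F_class_eq_iff)
  then show ?thesis using spec_common[OF C D f g] that by blast
qed

lemma F_class_eqI:
  assumes C: "C \<in> comm_subalgs B" and D: "D \<in> comm_subalgs B"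
    and f: "f \<in> carrier (Func B C)" and g: "g \<in> carrier (Func B D)"
    and sp: "\<And>U. open U \<Longrightarrow> spec B C f U = spec B D g U"
  shows "F_class B C f = F_class B D g"
proof -
  obtain h where h: "h \<in> carrier (Func B (C \<inter> D))" "f = res (C \<inter> D) C h" "g = res (C \<inter> D) D h"
    using spec_common[OF C D f g sp] by blast
  show ?thesis
    using F_class_res[OF subalg_Int[OF C D] C _ h(1)] F_class_res[OF subalg_Int[OF C D] D _ h(1)] h(2,3) by simp
qed

lemma F_class_inj:
  assumes C: "C \<in> comm_subalgs B" and f: "f \<in> carrier (Func B C)" and g: "g \<in> carrier (Func B C)"
  shows "F_class B C f = F_class B C g \<longleftrightarrow> f = g"
  using F_common[OF C C f g] by metis

text \<open>
  The definite descriptions in the definition of \<open>F\<close> pick the value computed on any representative, provided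
  that this value does not change when passing to a larger subalgebra.
\<close>

lemma the_unary:
  assumes nat: "\<And>C D f. C \<in> comm_subalgs B \<Longrightarrow> D \<in> comm_subalgs B \<Longrightarrow> C \<subseteq> D \<Longrightarrow> f \<in> carrier (Func B C) \<Longrightarrow>
      val D (res C D f) = val C f"
    and C: "C \<in> comm_subalgs B" and f: "f \<in> carrier (Func B C)"
  shows "(THE w. \<exists>C'\<in>comm_subalgs B. \<exists>f'\<in>carrier (Func B C'). F_class B C f = F_class B C' f' \<and> w = val C' f')
    = val C f"
proof (rule the_equality)
  show "\<exists>C'\<in>comm_subalgs B. \<exists>f'\<in>carrier (Func B C'). F_class B C f = F_class B C' f' \<and> val C f = val C' f'"
    using C f by blast
  fix w assume "\<exists>C'\<in>comm_subalgs B. \<exists>f'\<in>carrier (Func B C'). F_class B C f = F_class B C' f' \<and> w = val C' f'"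
  then obtain D g where D: "D \<in> comm_subalgs B" and g: "g \<in> carrier (Func B D)"
    and eq: "F_class B C f = F_class B D g" and w: "w = val D g" by blast
  obtain h where h: "h \<in> carrier (Func B (C \<inter> D))" "f = res (C \<inter> D) C h" "g = res (C \<inter> D) D h"
    using F_common[OF C D f g eq] .
  show "w = val C f"
    unfolding w h(2,3) using nat[OF subalg_Int[OF C D] C _ h(1)] nat[OF subalg_Int[OF C D] D _ h(1)] by simp
qed

lemma the_binary:
  assumes nat: "\<And>C D f g. C \<in> comm_subalgs B \<Longrightarrow> D \<in> comm_subalgs B \<Longrightarrow> C \<subseteq> D \<Longrightarrow>
      f \<in> carrier (Func B C) \<Longrightarrow> g \<in> carrier (Func B C) \<Longrightarrow> val D (res C D f) (res C D g) = val C f g"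
    and C: "C \<in> comm_subalgs B" and f: "f \<in> carrier (Func B C)" and g: "g \<in> carrier (Func B C)"
  shows "(THE w. \<exists>C'\<in>comm_subalgs B. \<exists>f'\<in>carrier (Func B C'). \<exists>g'\<in>carrier (Func B C').
      F_class B C f = F_class B C' f' \<and> F_class B C g = F_class B C' g' \<and> w = val C' f' g') = val C f g"
proof (rule the_equality)
  show "\<exists>C'\<in>comm_subalgs B. \<exists>f'\<in>carrier (Func B C'). \<exists>g'\<in>carrier (Func B C').
      F_class B C f = F_class B C' f' \<and> F_class B C g = F_class B C' g' \<and> val C f g = val C' f' g'"
    using C f g by blast
  fix w assume "\<exists>C'\<in>comm_subalgs B. \<exists>f'\<in>carrier (Func B C'). \<exists>g'\<in>carrier (Func B C').
      F_class B C f = F_class B C' f' \<and> F_class B C g = F_class B C' g' \<and> w = val C' f' g'"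
  then obtain D f' g' where D: "D \<in> comm_subalgs B"
    and f': "f' \<in> carrier (Func B D)" "F_class B C f = F_class B D f'"
    and g': "g' \<in> carrier (Func B D)" "F_class B C g = F_class B D g'" and w: "w = val D f' g'" by blast
  obtain h where h: "h \<in> carrier (Func B (C \<inter> D))" "f = res (C \<inter> D) C h" "f' = res (C \<inter> D) D h"
    using F_common[OF C D f f'] .
  obtain k where k: "k \<in> carrier (Func B (C \<inter> D))" "g = res (C \<inter> D) C k" "g' = res (C \<inter> D) D k"
    using F_common[OF C D g g'] .
  show "w = val C f g"
    unfolding w h(2,3) k(2,3)
    using nat[OF subalg_Int[OF C D] C _ h(1) k(1)] nat[OF subalg_Int[OF C D] D _ h(1) k(1)] by simp
qed

lemma res_op:
  assumes "C \<in> comm_subalgs B" "C \<subseteq> D"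
  shows "(\<lambda>h\<in>St B D. \<phi> (res C D f h) (res C D g h)) = res C D (\<lambda>h\<in>St B C. \<phi> (f h) (g h))"
  using St_restrict[OF assms] by (auto simp: res_apply fun_eq_iff Func_map_def)

lemma cnorm_res:
  assumes C: "C \<in> comm_subalgs B" and D: "D \<in> comm_subalgs B" and CD: "C \<subseteq> D"
  shows "cnorm (Func B D) (res C D f) = cnorm (Func B C) f"
proof -
  have "(\<lambda>h. cmod (res C D f h)) ` St B D = (\<lambda>h. cmod (f h)) ` St B C" (is "?l = ?r")
  proof (intro equalityI subsetI)
    fix x assume "x \<in> ?l"
    then show "x \<in> ?r" using St_restrict[OF C CD] by (auto simp: res_apply)
  next
    fix x assume "x \<in> ?r"
    then obtain h where h: "h \<in> St B C" "x = cmod (f h)" by blast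
    obtain k where k: "k \<in> St B D" "h = (\<lambda>x\<in>C. k x)" using St_extend[OF C D CD h(1)] .
    then show "x \<in> ?l" using h by (auto simp: res_apply intro!: image_eqI[of _ _ k])
  qed
  then show ?thesis by (simp add: Func_simps)
qed

context
  fixes C assumes C: "C \<in> comm_subalgs B"
begin

lemma F_add:
  assumes "f \<in> carrier (Func B C)" "g \<in> carrier (Func B C)"
  shows "F_class B C f \<oplus>\<^bsub>F B\<^esub> F_class B C g = F_class B C (\<lambda>h\<in>St B C. f h + g h)"
proof -
  have "F_class B D (\<lambda>h\<in>St B D. res E D f h + res E D g h) = F_class B E (\<lambda>h\<in>St B E. f h + g h)"
    if "E \<in> comm_subalgs B" "D \<in> comm_subalgs B" "E \<subseteq> D" "f \<in> carrier (Func B E)" "g \<in> carrier (Func B E)"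
    for D E f g
    using res_op[OF that(1,3), of "(+)" f g] F_class_res[OF that(1-3) Func_closed(2)[OF that(4,5)]] by simp
  from the_binary[where val = "\<lambda>C f g. F_class B C (\<lambda>h\<in>St B C. f h + g h)", OF this C assms] show ?thesis by (simp add: F_def Func_simps)
qed

lemma F_mult:
  assumes "f \<in> carrier (Func B C)" "g \<in> carrier (Func B C)"
  shows "F_class B C f \<otimes>\<^bsub>F B\<^esub> F_class B C g = F_class B C (\<lambda>h\<in>St B C. f h * g h)"
proof -
  have "F_class B D (\<lambda>h\<in>St B D. res E D f h * res E D g h) = F_class B E (\<lambda>h\<in>St B E. f h * g h)"
    if "E \<in> comm_subalgs B" "D \<in> comm_subalgs B" "E \<subseteq> D" "f \<in> carrier (Func B E)" "g \<in> carrier (Func B E)"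
    for D E f g
    using res_op[OF that(1,3), of "(*)" f g] F_class_res[OF that(1-3) Func_closed(1)[OF that(4,5)]] by simp
  from the_binary[where val = "\<lambda>C f g. F_class B C (\<lambda>h\<in>St B C. f h * g h)", OF this C assms] show ?thesis by (simp add: F_def Func_simps)
qed

lemma F_smult:
  assumes "f \<in> carrier (Func B C)"
  shows "c \<odot>\<^bsub>F B\<^esub> F_class B C f = F_class B C (\<lambda>h\<in>St B C. c * f h)"
proof -
  have "F_class B D (\<lambda>h\<in>St B D. c * res E D f h) = F_class B E (\<lambda>h\<in>St B E. c * f h)"
    if "E \<in> comm_subalgs B" "D \<in> comm_subalgs B" "E \<subseteq> D" "f \<in> carrier (Func B E)" for D E f
    using res_op[OF that(1,3), of "\<lambda>x _. c * x" f f] F_class_res[OF that(1-3) Func_closed(3)[OF that(4)]] by simp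
  from the_unary[where val = "\<lambda>C f. F_class B C (\<lambda>h\<in>St B C. c * f h)", OF this C assms] show ?thesis by (simp add: F_def Func_simps)
qed

lemma F_invol:
  assumes "f \<in> carrier (Func B C)"
  shows "invol (F B) (F_class B C f) = F_class B C (\<lambda>h\<in>St B C. cnj (f h))"
proof -
  have "F_class B D (\<lambda>h\<in>St B D. cnj (res E D f h)) = F_class B E (\<lambda>h\<in>St B E. cnj (f h))"
    if "E \<in> comm_subalgs B" "D \<in> comm_subalgs B" "E \<subseteq> D" "f \<in> carrier (Func B E)" for D E f
    using res_op[OF that(1,3), of "\<lambda>x _. cnj x" f f] F_class_res[OF that(1-3) Func_closed(4)[OF that(4)]] by simp
  from the_unary[where val = "\<lambda>C f. F_class B C (\<lambda>h\<in>St B C. cnj (f h))", OF this C assms] show ?thesis by (simp add: F_def Func_simps)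
qed

lemma F_cnorm:
  assumes "f \<in> carrier (Func B C)"
  shows "cnorm (F B) (F_class B C f) = cnorm (Func B C) f"
  using the_unary[of "\<lambda>C. cnorm (Func B C)", OF cnorm_res C assms] by (simp add: F_def)

lemma F_const:
  shows "\<one>\<^bsub>F B\<^esub> = F_class B C (\<lambda>h\<in>St B C. 1)" "\<zero>\<^bsub>F B\<^esub> = F_class B C (\<lambda>h\<in>St B C. 0)"
proof -
  have eq: "F_class B D (\<lambda>h\<in>St B D. z) = F_class B C (\<lambda>h\<in>St B C. z)" if D: "D \<in> comm_subalgs B" for D and z :: complex
  proof -
    note E = subalg_Int[OF C D]
    have "F_class B D' (\<lambda>h\<in>St B D'. z) = F_class B (C \<inter> D) (\<lambda>h\<in>St B (C \<inter> D). z)"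
      if "D' \<in> comm_subalgs B" "C \<inter> D \<subseteq> D'" for D'
      using F_class_res[OF E that Func_const[where c = z]] res_op[OF E that(2), of "\<lambda>_ _. z"] by simp
    then show ?thesis using C D by simp
  qed
  have "(THE w. \<exists>C\<in>comm_subalgs B. w = F_class B C (\<lambda>h\<in>St B C. z)) = F_class B C (\<lambda>h\<in>St B C. z)" for z :: complex
  proof (rule the_equality)
    show "\<exists>D\<in>comm_subalgs B. F_class B C (\<lambda>h\<in>St B C. z) = F_class B D (\<lambda>h\<in>St B D. z)"
      using C by (rule bexI[rotated]) (rule refl)
    show "w = F_class B C (\<lambda>h\<in>St B C. z)"
      if "\<exists>D\<in>comm_subalgs B. w = F_class B D (\<lambda>h\<in>St B D. z)" for w
      using that eq by (elim bexE) simp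
  qed
  then show "\<one>\<^bsub>F B\<^esub> = F_class B C (\<lambda>h\<in>St B C. 1)" "\<zero>\<^bsub>F B\<^esub> = F_class B C (\<lambda>h\<in>St B C. 0)"
    by (simp_all add: F_def Func_simps)
qed

lemma F_class_chi: "b \<in> C \<Longrightarrow> F_class B C (chi B C b) = eta B b"
proof -
  assume b: "b \<in> C"
  have eq: "F_class B C (chi B C b) = F_class B D (chi B D b)" if D: "D \<in> comm_subalgs B" "b \<in> D" for D
    using F_class_res[OF subalg_Int[OF C D(1)] C _ chi_in[OF subalg_Int[OF C D(1)]], of b]
      F_class_res[OF subalg_Int[OF C D(1)] D(1) _ chi_in[OF subalg_Int[OF C D(1)]], of b]
      res_chi[OF subalg_Int[OF C D(1)] C, of b] res_chi[OF subalg_Int[OF C D(1)] D(1), of b] b D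
    by simp
  have "\<exists>D\<in>comm_subalgs B. b \<in> D \<and> eta B b = F_class B D (chi B D b)"
    unfolding eta_def by (rule someI[of _ "F_class B C (chi B C b)"]) (use C b in blast)
  then show ?thesis using eq by metis
qed

end

lemma subalg_of_elem: "b \<in> carrier B \<Longrightarrow> \<exists>C\<in>comm_subalgs B. b \<in> C"
proof -
  assume "b \<in> carrier B"
  then have "{b} \<subseteq> carrier B" "{b} \<times> {b} \<subseteq> bcomm B" using pcb by (auto simp: is_pCBool_def)
  then obtain C where "C \<in> comm_subalgs B" "{b} \<subseteq> C" by (rule commeasurable_in_subalg)
  then show ?thesis by blast
qed

lemma eta_inj:
  assumes "b \<in> carrier B" "c \<in> carrier B" "eta B b = eta B c"
  shows "b = c"
proof -
  obtain C where C: "C \<in> comm_subalgs B" "b \<in> C" using subalg_of_elem assms by blast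
  obtain D where D: "D \<in> comm_subalgs B" "c \<in> D" using subalg_of_elem assms by blast
  have "equivclp (F_link B) (C, chi B C b) (D, chi B D c)"
    using assms C D F_class_chi F_class_eq_iff by metis
  then show ?thesis
    using spec_equivclp[of "(C, chi B C b)" "(D, chi B D c)" "ball 1 (1/2)"] spec_chi C D by simp
qed

lemma subalg_sub: "C \<in> comm_subalgs B \<Longrightarrow> C \<subseteq> carrier B"
  by (auto simp: comm_subalgs_def)

lemma F_carrier_hat: "carrier (F B) = (\<Union>C\<in>comm_subalgs B. hat B C)"
  by (simp add: F_def set_eq_iff F_carrier_iff hat_def image_iff)

lemma F_comm_iff: "(u, v) \<in> comm (F B) \<longleftrightarrow> (\<exists>C\<in>comm_subalgs B. u \<in> hat B C \<and> v \<in> hat B C)"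
  by (auto simp: F_def hat_def)

lemma hat_mono:
  assumes "C \<in> comm_subalgs B" "D \<in> comm_subalgs B" "C \<subseteq> D"
  shows "hat B C \<subseteq> hat B D"
  using F_class_res[OF assms] res_in[OF assms] by (force simp: hat_def)

lemma hat_Int:
  assumes C: "C \<in> comm_subalgs B" and D: "D \<in> comm_subalgs B"
  shows "hat B C \<inter> hat B D = hat B (C \<inter> D)"
proof (intro equalityI subsetI)
  fix u assume "u \<in> hat B C \<inter> hat B D"
  then obtain f g where f: "f \<in> carrier (Func B C)" "u = F_class B C f"
    and g: "g \<in> carrier (Func B D)" "u = F_class B D g" by (auto simp: hat_def)
  obtain h where h: "h \<in> carrier (Func B (C \<inter> D))" "f = res (C \<inter> D) C h"
    using F_common[OF C D f(1) g(1)] f(2) g(2) by metis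
  then show "u \<in> hat B (C \<inter> D)"
    using f(2) F_class_res[OF subalg_Int[OF C D] C _ h(1)] by (auto simp: hat_def)
qed (use hat_mono[OF subalg_Int[OF C D]] C D in auto)

text \<open>
  A set of pairwise commeasurable classes lives in one algebra: the spectral projections
  of its members are pairwise commeasurable.
\<close>

lemma commeasurable_in_hat:
  assumes X: "X \<subseteq> carrier (F B)" "X \<times> X \<subseteq> comm (F B)"
  obtains T where "T \<in> comm_subalgs B" "X \<subseteq> hat B T"
proof -
  define S where "S = {spec B C f U | C f U. C \<in> comm_subalgs B \<and> f \<in> carrier (Func B C) \<and>
    F_class B C f \<in> X \<and> open U}"
  have common: "(a, b) \<in> bcomm B" if ab: "a \<in> S" "b \<in> S" for a b
  proof -
    obtain C f U where C: "C \<in> comm_subalgs B" "f \<in> carrier (Func B C)" "F_class B C f \<in> X" "open U"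
      "a = spec B C f U" using ab(1) unfolding S_def by blast
    obtain D g V where D: "D \<in> comm_subalgs B" "g \<in> carrier (Func B D)" "F_class B D g \<in> X" "open V"
      "b = spec B D g V" using ab(2) unfolding S_def by blast
    have "(F_class B C f, F_class B D g) \<in> comm (F B)" using X(2) C(3) D(3) by blast
    then obtain E f' g' where E: "E \<in> comm_subalgs B" "f' \<in> carrier (Func B E)" "g' \<in> carrier (Func B E)"
      "F_class B C f = F_class B E f'" "F_class B D g = F_class B E g'"
      unfolding F_comm_iff hat_def by blast
    have "a = spec B E f' U" "b = spec B E g' V"
      using spec_equivclp[of "(C, f)" "(E, f')" U] spec_equivclp[of "(D, g)" "(E, g')" V] C D E
      by (simp_all add: F_class_eq_iff)
    then have "a \<in> E" "b \<in> E" using spec_mem E by auto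
    then show ?thesis using E(1) by (auto simp: comm_subalgs_def)
  qed
  have "S \<subseteq> carrier B" unfolding S_def using spec_mem subalg_sub by blast
  then obtain T where T: "T \<in> comm_subalgs B" "S \<subseteq> T"
  proof -
    have "S \<times> S \<subseteq> bcomm B" using common by auto
    then show ?thesis using commeasurable_in_subalg[OF \<open>S \<subseteq> carrier B\<close>] that by metis
  qed
  have "X \<subseteq> hat B T"
  proof
    fix u assume u: "u \<in> X"
    then obtain C f where C: "C \<in> comm_subalgs B" and f: "f \<in> carrier (Func B C)" "u = F_class B C f"
      using X(1) by (auto simp: F_carrier_hat hat_def)
    note E = subalg_Int[OF C T(1)]
    have "spec B C f U \<in> C \<inter> T" if "open U" for U
    proof -
      have "spec B C f U \<in> S" unfolding S_def using that C f u by blast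
      then show ?thesis using spec_mem[OF C f(1)] T(2) by blast
    qed
    then obtain h where h: "h \<in> carrier (Func B (C \<inter> T))" "f = res (C \<inter> T) C h"
      using res_factor[OF E C _ f(1)] by blast
    have "u = F_class B (C \<inter> T) h" using F_class_res[OF E C _ h(1)] f(2) h(2) by simp
    then have "u \<in> hat B (C \<inter> T)" using h(1) by (auto simp: hat_def)
    then show "u \<in> hat B T" using hat_mono[OF E T(1)] by blast
  qed
  then show ?thesis using that T by blast
qed

section \<open>The commutative AW*-algebra of a subalgebra\<close>

context
  fixes T assumes T: "T \<in> comm_subalgs B"
begin

lemmas F_ops = F_add[OF T] F_mult[OF T] F_smult[OF T] F_invol[OF T] F_cnorm[OF T] F_const[OF T]

lemma F_pminus:
  assumes "f \<in> carrier (Func B T)" "g \<in> carrier (Func B T)"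
  shows "pminus (F B) (F_class B T f) (F_class B T g) = F_class B T (\<lambda>h\<in>St B T. f h - g h)"
proof -
  have "(\<lambda>h\<in>St B T. f h + (\<lambda>h\<in>St B T. - 1 * g h) h) = (\<lambda>h\<in>St B T. f h - g h)" by auto
  then show ?thesis unfolding pminus_def by (simp only: F_ops Func_closed(3)[OF assms(2)] assms)
qed

lemma Func_diff:
  "f \<in> carrier (Func B T) \<Longrightarrow> g \<in> carrier (Func B T) \<Longrightarrow> (\<lambda>h\<in>St B T. f h - g h) \<in> carrier (Func B T)"
  using Func_combine[of f B T g "\<lambda>z. fst z - snd z"] by (simp add: continuous_intros)

lemma Func_restrict: "f \<in> carrier (Func B T) \<Longrightarrow> (\<lambda>h\<in>St B T. f h) = f"
  by (simp add: Func_carrier extensional_restrict)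

lemma Func_uminus: "f \<in> carrier (Func B T) \<Longrightarrow> (\<lambda>h\<in>St B T. - f h) \<in> carrier (Func B T)"
  using Func_closed(3)[of f B T "-1"] by simp

lemma hat_algebra: "algebra complex_ring ((F B)\<lparr>carrier := hat B T\<rparr>)"
proof (rule algebra_complexI)
  show "\<zero>\<^bsub>F B\<^esub> \<in> hat B T" "\<one>\<^bsub>F B\<^esub> \<in> hat B T" by (auto simp: hat_def F_ops Func_const)
qed (simp_all add: hat_def, elim imageE,
  auto simp: F_ops Func_closed Func_const Func_restrict Func_uminus algebra_simps cong: restrict_cong)

lemma hat_complete:
  assumes s: "range s \<subseteq> hat B T"
    and cau: "\<forall>e>0. \<exists>N. \<forall>m\<ge>N. \<forall>n\<ge>N. cnorm (F B) (pminus (F B) (s m) (s n)) < e"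
  shows "\<exists>x\<in>hat B T. (\<lambda>n. cnorm (F B) (pminus (F B) (s n) x)) \<longlonglongrightarrow> 0"
proof -
  have "\<forall>n. \<exists>f\<in>carrier (Func B T). s n = F_class B T f" using s by (auto simp: hat_def)
  then obtain f where f: "\<And>n. f n \<in> carrier (Func B T)" "\<And>n. s n = F_class B T (f n)" by metis
  have cau': "\<exists>N. \<forall>m\<ge>N. \<forall>n\<ge>N. \<forall>h\<in>St B T. cmod (f m h - f n h) < e" if e: "e > 0" for e
  proof -
    obtain N where N: "\<forall>m\<ge>N. \<forall>n\<ge>N. cnorm (F B) (pminus (F B) (s m) (s n)) < e" using cau e by blast
    have "cmod (f m h - f n h) < e" if "m \<ge> N" "n \<ge> N" "h \<in> St B T" for m n h
    proof -
      have "cmod (f m h - f n h) \<le> cnorm (Func B T) (\<lambda>h\<in>St B T. f m h - f n h)"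
        using cnorm_upper[OF T Func_diff[OF f(1) f(1)] that(3)] that(3) by simp
      also have "\<dots> < e" using N that by (simp add: f F_pminus F_ops Func_diff)
      finally show ?thesis .
    qed
    then show ?thesis by blast
  qed
  define g where "g = (\<lambda>h\<in>St B T. lim (\<lambda>n. f n h))"
  have lim: "(\<lambda>n. f n h) \<longlonglongrightarrow> g h" if h: "h \<in> St B T" for h
  proof -
    have "Cauchy (\<lambda>n. f n h)" unfolding Cauchy_def dist_norm using cau' h by meson
    then show ?thesis using h by (simp add: g_def Cauchy_convergent_iff convergent_LIMSEQ_iff)
  qed
  have unif: "\<exists>N. \<forall>n\<ge>N. \<forall>h\<in>St B T. cmod (f n h - g h) \<le> e" if e: "e > 0" for e
  proof -
    obtain N where N: "\<forall>m\<ge>N. \<forall>n\<ge>N. \<forall>h\<in>St B T. cmod (f m h - f n h) < e" using cau' e by blast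
    have "cmod (f n h - g h) \<le> e" if "n \<ge> N" "h \<in> St B T" for n h
    proof (rule LIMSEQ_le_const2)
      show "(\<lambda>m. cmod (f n h - f m h)) \<longlonglongrightarrow> cmod (f n h - g h)"
        by (intro tendsto_intros lim that)
      show "\<exists>N. \<forall>m\<ge>N. cmod (f n h - f m h) \<le> e" using N that by (meson less_imp_le)
    qed
    then show ?thesis by blast
  qed
  have g: "g \<in> carrier (Func B T)"
  proof (rule Func_I[OF T])
    show "g \<in> extensional (St B T)" by (simp add: g_def)
    fix h and e :: real assume h: "h \<in> St B T" and e: "e > 0"
    obtain n where n: "\<forall>h\<in>St B T. cmod (f n h - g h) \<le> e/4" using unif[of "e/4"] e by auto
    obtain c where c: "c \<in> T" "h c" "\<forall>k\<in>St B T. k c \<longrightarrow> dist (f n k) (f n h) < e/4"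
      using Func_D[OF T f(1) h, of "e/4"] e by auto
    have "dist (g k) (g h) < e" if k: "k \<in> St B T" "k c" for k
    proof -
      have "dist (g k) (g h) \<le> dist (g k) (f n k) + dist (f n k) (f n h) + dist (f n h) (g h)"
        using dist_triangle[of "g k" "g h" "f n k"] dist_triangle[of "f n k" "g h" "f n h"] by simp
      moreover have "dist (g k) (f n k) \<le> e/4" "dist (f n h) (g h) \<le> e/4"
        using n[rule_format, OF k(1)] n[rule_format, OF h] by (simp_all add: dist_norm norm_minus_commute)
      moreover have "dist (f n k) (f n h) < e/4" using c(3) k by blast
      ultimately show ?thesis using e by linarith
    qed
    then show "\<exists>c\<in>T. h c \<and> (\<forall>k\<in>St B T. k c \<longrightarrow> dist (g k) (g h) < e)" using c by blast
  qed
  have "(\<lambda>n. cnorm (F B) (pminus (F B) (s n) (F_class B T g))) \<longlonglongrightarrow> 0"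
  proof (rule LIMSEQ_I)
    fix e :: real assume e: "e > 0"
    obtain N where N: "\<forall>n\<ge>N. \<forall>h\<in>St B T. cmod (f n h - g h) \<le> e/2" using unif[of "e/2"] e by auto
    have "norm (cnorm (F B) (pminus (F B) (s n) (F_class B T g)) - 0) < e" if "n \<ge> N" for n
    proof -
      have "cnorm (Func B T) (\<lambda>h\<in>St B T. f n h - g h) \<le> e/2"
        using N that e by (subst cnorm_le_iff[OF T Func_diff[OF f(1) g]]) auto
      then show ?thesis
        using cnorm_nonneg[OF T Func_diff[OF f(1) g]] e by (simp add: f F_pminus F_ops Func_diff g)
    qed
    then show "\<exists>N. \<forall>n\<ge>N. norm (cnorm (F B) (pminus (F B) (s n) (F_class B T g)) - 0) < e" by blast
  qed
  then show ?thesis using g by (auto simp: hat_def)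
qed

lemma hat_limit_unique:
  assumes s: "\<And>n. s n \<in> hat B T" and x: "x \<in> hat B T" and y: "y \<in> hat B T"
    and lx: "(\<lambda>n. cnorm (F B) (pminus (F B) (s n) x)) \<longlonglongrightarrow> 0"
    and ly: "(\<lambda>n. cnorm (F B) (pminus (F B) (s n) y)) \<longlonglongrightarrow> 0"
  shows "x = y"
proof -
  have "\<forall>n. \<exists>f\<in>carrier (Func B T). s n = F_class B T f" using s by (auto simp: hat_def)
  then obtain f where f: "\<And>n. f n \<in> carrier (Func B T)" "\<And>n. s n = F_class B T (f n)" by metis
  obtain g where g: "g \<in> carrier (Func B T)" "x = F_class B T g" using x by (auto simp: hat_def)
  obtain k where k: "k \<in> carrier (Func B T)" "y = F_class B T k" using y by (auto simp: hat_def)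
  have lim: "(\<lambda>n. f n h) \<longlonglongrightarrow> u h" if h: "h \<in> St B T" and u: "u \<in> carrier (Func B T)"
    and l: "(\<lambda>n. cnorm (F B) (pminus (F B) (s n) (F_class B T u))) \<longlonglongrightarrow> 0" for h u
  proof -
    have "(\<lambda>n. f n h - u h) \<longlonglongrightarrow> 0"
    proof (rule Lim_null_comparison[OF _ l], rule always_eventually, rule allI)
      fix n show "cmod (f n h - u h) \<le> cnorm (F B) (pminus (F B) (s n) (F_class B T u))"
        using cnorm_upper[OF T Func_diff[OF f(1)[of n] u] h] h u f by (simp add: F_pminus F_ops Func_diff)
    qed
    then show ?thesis by (simp add: LIM_zero_iff)
  qed
  have "g = k"
    by (rule Func_eqI[OF g(1) k(1)]) (use LIMSEQ_unique[OF lim lim] g k lx ly in auto)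
  then show ?thesis using g k by simp
qed

end

text \<open>
  A limit of a sequence in \<open>hat B T\<close> may a priori lie outside; but then it shares another algebra
  \<open>hat B T'\<close> with the sequence, which thus lies in \<open>hat B (T \<inter> T')\<close> and has a limit there, and by
  uniqueness in \<open>hat B T\<close> and in \<open>hat B T'\<close> the three limits agree.
\<close>

lemma hat_Cstar:
  assumes T: "T \<in> comm_subalgs B"
  shows "comm_Cstar_on (F B) (hat B T)"
proof -
  note ops = F_ops[OF T]
  have ff: "(\<lambda>h\<in>St B T. cnj (f h) * f h) \<in> carrier (Func B T)" if f: "f \<in> carrier (Func B T)" for f
  proof -
    have "(\<lambda>h\<in>St B T. cnj (f h) * f h) = (\<lambda>h\<in>St B T. (\<lambda>h\<in>St B T. cnj (f h)) h * f h)" by auto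
    then show ?thesis using Func_closed(1)[OF Func_closed(4)[OF f] f] by simp
  qed
  have norm2: "cnorm (Func B T) (\<lambda>h\<in>St B T. cnj (f h) * f h) = (cnorm (Func B T) f)\<^sup>2"
    if f: "f \<in> carrier (Func B T)" for f
  proof (rule antisym)
    show "cnorm (Func B T) (\<lambda>h\<in>St B T. cnj (f h) * f h) \<le> (cnorm (Func B T) f)\<^sup>2"
      using cnorm_upper[OF T f] cnorm_nonneg[OF T f]
      by (subst cnorm_le_iff[OF T ff[OF f]]) (auto simp: norm_mult power2_eq_square intro: mult_mono)
    have "cnorm (Func B T) f \<le> sqrt (cnorm (Func B T) (\<lambda>h\<in>St B T. cnj (f h) * f h))"
      using cnorm_upper[OF T ff[OF f]] cnorm_nonneg[OF T ff[OF f]]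
      by (subst cnorm_le_iff[OF T f]) (auto simp: norm_mult power2_eq_square intro: real_le_rsqrt)
    then show "(cnorm (Func B T) f)\<^sup>2 \<le> cnorm (Func B T) (\<lambda>h\<in>St B T. cnj (f h) * f h)"
      using cnorm_nonneg[OF T f] cnorm_nonneg[OF T ff[OF f]] by (metis real_sqrt_ge_zero power_mono real_sqrt_pow2)
  qed
  have norm0: "cnorm (Func B T) f = 0 \<longleftrightarrow> f = (\<lambda>h\<in>St B T. 0)" if f: "f \<in> carrier (Func B T)" for f
  proof
    assume "cnorm (Func B T) f = 0"
    then show "f = (\<lambda>h\<in>St B T. 0)"
      using cnorm_upper[OF T f] by (intro Func_eqI[OF f Func_const]) auto
  next
    assume "f = (\<lambda>h\<in>St B T. 0)"
    then show "cnorm (Func B T) f = 0"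
      using cnorm_le_iff[OF T f, of 0] cnorm_nonneg[OF T f] by auto
  qed
  have norm_add: "cnorm (Func B T) (\<lambda>h\<in>St B T. f h + g h) \<le> cnorm (Func B T) f + cnorm (Func B T) g"
    if f: "f \<in> carrier (Func B T)" and g: "g \<in> carrier (Func B T)" for f g
    using cnorm_upper[OF T f] cnorm_upper[OF T g] cnorm_nonneg[OF T f] cnorm_nonneg[OF T g]
    by (subst cnorm_le_iff[OF T Func_closed(2)[OF f g]]) (auto intro: order_trans[OF norm_triangle_ineq] add_mono)
  have nmult: "cnorm (Func B T) (\<lambda>h\<in>St B T. f h * g h) \<le> cnorm (Func B T) f * cnorm (Func B T) g"
    if f: "f \<in> carrier (Func B T)" and g: "g \<in> carrier (Func B T)" for f g
    using cnorm_upper[OF T f] cnorm_upper[OF T g] cnorm_nonneg[OF T f] cnorm_nonneg[OF T g]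
    by (subst cnorm_le_iff[OF T Func_closed(1)[OF f g]]) (auto simp: norm_mult intro: mult_mono)
  have norm_scal: "cnorm (Func B T) (\<lambda>h\<in>St B T. c * f h) = cmod c * cnorm (Func B T) f"
    if f: "f \<in> carrier (Func B T)" for c f
  proof (rule antisym)
    note cf = Func_closed(3)[OF f, of c]
    show "cnorm (Func B T) (\<lambda>h\<in>St B T. c * f h) \<le> cmod c * cnorm (Func B T) f"
      using cnorm_upper[OF T f] cnorm_nonneg[OF T f]
      by (subst cnorm_le_iff[OF T cf]) (auto simp: norm_mult intro: mult_left_mono)
    show "cmod c * cnorm (Func B T) f \<le> cnorm (Func B T) (\<lambda>h\<in>St B T. c * f h)"
    proof (cases "c = 0")
      case True then show ?thesis using cnorm_nonneg[OF T cf] by simp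
    next
      case False
      have "cnorm (Func B T) f \<le> cnorm (Func B T) (\<lambda>h\<in>St B T. c * f h) / cmod c"
        using cnorm_upper[OF T cf] cnorm_nonneg[OF T cf] False
        by (subst cnorm_le_iff[OF T f]) (auto simp: norm_mult field_simps)
      then show ?thesis using False by (simp add: field_simps)
    qed
  qed
  have compl: "\<exists>x\<in>hat B T. norm_limit (F B) s x \<and> (\<forall>y. norm_limit (F B) s y \<longrightarrow> y = x)"
    if s: "range s \<subseteq> hat B T"
      and cau: "\<forall>e>0. \<exists>N. \<forall>m\<ge>N. \<forall>n\<ge>N. cnorm (F B) (pminus (F B) (s m) (s n)) < e" for s
  proof -
    obtain x where x: "x \<in> hat B T" "(\<lambda>n. cnorm (F B) (pminus (F B) (s n) x)) \<longlonglongrightarrow> 0"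
      using hat_complete[OF T s cau] by blast
    have sT: "s n \<in> hat B T" for n using s by auto
    have "norm_limit (F B) s x"
      using x sT T unfolding norm_limit_def F_carrier_hat F_comm_iff by blast
    moreover have "y = x" if y: "norm_limit (F B) s y" for y
    proof -
      have yc: "y \<in> carrier (F B)" "\<And>n. (s n, y) \<in> comm (F B)"
        and ly: "(\<lambda>n. cnorm (F B) (pminus (F B) (s n) y)) \<longlonglongrightarrow> 0"
        using y by (auto simp: norm_limit_def)
      let ?X = "insert y (range s)"
      have "?X \<subseteq> carrier (F B)" using yc(1) sT T by (auto simp: F_carrier_hat)
      moreover have "?X \<times> ?X \<subseteq> comm (F B)"
      proof -
        have "(y, y) \<in> comm (F B)" using yc(1) by (auto simp: F_comm_iff F_carrier_hat)
        moreover have "(y, s n) \<in> comm (F B)" for n using yc(2)[of n] by (auto simp: F_comm_iff)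
        moreover have "(s m, s n) \<in> comm (F B)" for m n using sT T by (auto simp: F_comm_iff)
        ultimately show ?thesis using yc(2) by auto
      qed
      ultimately obtain T' where T': "T' \<in> comm_subalgs B" "?X \<subseteq> hat B T'"
        using commeasurable_in_hat by blast
      note W = subalg_Int[OF T T'(1)]
      have sW: "s n \<in> hat B (T \<inter> T')" for n
      proof -
        have "s n \<in> hat B T \<inter> hat B T'" using sT[of n] T'(2) by auto
        then show ?thesis using hat_Int[OF T T'(1)] by simp
      qed
      then have "range s \<subseteq> hat B (T \<inter> T')" by auto
      then obtain z where z: "z \<in> hat B (T \<inter> T')" "(\<lambda>n. cnorm (F B) (pminus (F B) (s n) z)) \<longlonglongrightarrow> 0"
        using hat_complete[OF W _ cau] by blast
      have zT: "z \<in> hat B T" "z \<in> hat B T'" using z hat_Int[OF T T'(1)] by auto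
      have "x = z" using hat_limit_unique[OF T sT x(1) zT(1) x(2) z(2)] .
      moreover have "y = z" using hat_limit_unique[OF T'(1) _ _ zT(2) ly z(2)] T'(2) by auto
      ultimately show ?thesis by simp
    qed
    ultimately show ?thesis using x(1) by blast
  qed
  show ?thesis
    unfolding comm_Cstar_on_def
  proof (intro conjI ballI allI impI)
    show "algebra complex_ring ((F B)\<lparr>carrier := hat B T\<rparr>)" by (rule hat_algebra[OF T])
    fix s :: "nat \<Rightarrow> _" assume "range s \<subseteq> hat B T \<and>
      (\<forall>e>0. \<exists>N. \<forall>m\<ge>N. \<forall>n\<ge>N. cnorm (F B) (pminus (F B) (s m) (s n)) < e)"
    then show "\<exists>x\<in>hat B T. norm_limit (F B) s x \<and> (\<forall>y. norm_limit (F B) s y \<longrightarrow> y = x)"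
      using compl by blast
  next
    fix a assume "a \<in> hat B T"
    then obtain f where f: "f \<in> carrier (Func B T)" "a = F_class B T f" by (auto simp: hat_def)
    show "invol (F B) a \<in> hat B T" "invol (F B) (invol (F B) a) = a"
      using f by (auto simp: hat_def ops Func_closed Func_restrict[OF T] cong: restrict_cong)
    show "cnorm (F B) a \<ge> 0" "cnorm (F B) a = 0 \<longleftrightarrow> a = \<zero>\<^bsub>F B\<^esub>"
      using f norm0 by (auto simp: ops cnorm_nonneg[OF T] F_class_inj[OF T] Func_const)
    show "cnorm (F B) (invol (F B) a \<otimes>\<^bsub>F B\<^esub> a) = (cnorm (F B) a)\<^sup>2"
      using f norm2[OF f(1)] ff[OF f(1)] by (simp add: ops Func_closed cong: restrict_cong)
    show "invol (F B) (c \<odot>\<^bsub>F B\<^esub> a) = cnj c \<odot>\<^bsub>F B\<^esub> invol (F B) a" for c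
      using f by (simp add: ops Func_closed cong: restrict_cong)
    show "cnorm (F B) (c \<odot>\<^bsub>F B\<^esub> a) = cmod c * cnorm (F B) a" for c
      using f norm_scal by (simp add: ops Func_closed)
    fix b assume "b \<in> hat B T"
    then obtain g where g: "g \<in> carrier (Func B T)" "b = F_class B T g" by (auto simp: hat_def)
    show "invol (F B) (a \<oplus>\<^bsub>F B\<^esub> b) = invol (F B) a \<oplus>\<^bsub>F B\<^esub> invol (F B) b"
      "invol (F B) (a \<otimes>\<^bsub>F B\<^esub> b) = invol (F B) b \<otimes>\<^bsub>F B\<^esub> invol (F B) a"
      using f g by (simp_all add: ops Func_closed mult.commute cong: restrict_cong)
    show "cnorm (F B) (a \<oplus>\<^bsub>F B\<^esub> b) \<le> cnorm (F B) a + cnorm (F B) b"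
      "cnorm (F B) (a \<otimes>\<^bsub>F B\<^esub> b) \<le> cnorm (F B) a * cnorm (F B) b"
      using f g norm_add nmult by (auto simp: ops Func_closed)
  qed
qed

end


section \<open>F yields piecewise AW*-algebras\<close>

context pcbool
begin

lemma F_rproj:
  assumes C: "C \<in> comm_subalgs B" and f: "f \<in> carrier (Func B C)"
  shows "rproj (F B) (F_class B C f) = eta B (spec B C f (- {0}))"
proof -
  have nat: "eta B (spec B D (res E D f) (- {0})) = eta B (spec B E f (- {0}))"
    if "E \<in> comm_subalgs B" "D \<in> comm_subalgs B" "E \<subseteq> D" "f \<in> carrier (Func B E)" for D E f
    using spec_res[OF that, of "- {0}"] by (simp add: open_Compl)
  have "(\<exists>p. u = F_class B D g \<and> is_RP (Func B D) g p \<and> w = F_class B D p) \<longleftrightarrow>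
      u = F_class B D g \<and> w = eta B (spec B D g (- {0}))"
    if "D \<in> comm_subalgs B" "g \<in> carrier (Func B D)" for D g u w
    using is_RP_Func[OF that] F_class_chi[OF that(1) spec_mem[OF that]] by auto
  then have "rproj (F B) (F_class B C f) = (THE w. \<exists>D\<in>comm_subalgs B. \<exists>g\<in>carrier (Func B D).
      F_class B C f = F_class B D g \<and> w = eta B (spec B D g (- {0})))"
    by (simp add: F_def cong: bex_cong)
  also have "\<dots> = eta B (spec B C f (- {0}))"
    using the_unary[where val = "\<lambda>C f. eta B (spec B C f (- {0}))", OF nat C f] .
  finally show ?thesis .
qed

lemma inj_eta: "inj_on (eta B) (carrier B)"
  by (rule inj_onI) (rule eta_inj)

lemma F_class_chi_image:
  "C \<in> comm_subalgs B \<Longrightarrow> X \<subseteq> C \<Longrightarrow> F_class B C ` chi B C ` X = eta B ` X"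
  unfolding image_image by (rule image_cong) (auto simp: F_class_chi)

lemma F_pjoin:
  assumes C: "C \<in> comm_subalgs B" and X: "X \<subseteq> C"
  shows "pjoin (F B) (eta B ` X) = eta B (bjoin B X)"
proof -
  let ?P = "\<lambda>w. \<exists>C\<in>comm_subalgs B. \<exists>Y\<subseteq>projections (Func B C). \<exists>p.
        eta B ` X = F_class B C ` Y \<and> is_lub (proj_order (Func B C)) p Y \<and> w = F_class B C p"
  have "(THE w. ?P w) = eta B (bjoin B X)"
  proof (rule the_equality)
    show "?P (eta B (bjoin B X))"
    proof (intro bexI[OF _ C] exI conjI)
      show "chi B C ` X \<subseteq> projections (Func B C)" using X by (auto simp: projections_Func[OF C])
      show "eta B ` X = F_class B C ` chi B C ` X" using F_class_chi_image[OF C X] by simp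
      show "is_lub (proj_order (Func B C)) (chi B C (bjoin B X)) (chi B C ` X)"
        using is_lub_chi[OF C X] by blast
      show "eta B (bjoin B X) = F_class B C (chi B C (bjoin B X))"
        using F_class_chi[OF C bjoin_mem[OF C X]] by simp
    qed
    fix w assume "?P w"
    then obtain D Y p where D: "D \<in> comm_subalgs B" and Y: "Y \<subseteq> projections (Func B D)"
      and eq: "eta B ` X = F_class B D ` Y" and p: "is_lub (proj_order (Func B D)) p Y" "w = F_class B D p"
      by blast
    define Z where "Z = {d\<in>D. chi B D d \<in> Y}"
    have Z: "Z \<subseteq> D" "Y = chi B D ` Z" using Y by (auto simp: Z_def projections_Func[OF D])
    have "eta B ` X = eta B ` Z" using eq F_class_chi_image[OF D Z(1)] Z(2) by simp
    then have "X = Z"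
      using inj_on_image_eq_iff[OF inj_eta, of X Z] X Z(1) subalg_sub[OF C] subalg_sub[OF D] by auto
    moreover have "p = chi B D (bjoin B Z)" using p(1) is_lub_chi[OF D Z(1)] Z(2) by simp
    ultimately show "w = eta B (bjoin B X)"
      using p(2) F_class_chi[OF D bjoin_mem[OF D Z(1)]] by simp
  qed
  then show ?thesis by (simp add: F_def)
qed

lemma eta_in_hat: "C \<in> comm_subalgs B \<Longrightarrow> c \<in> C \<Longrightarrow> eta B c \<in> hat B C"
  using F_class_chi chi_in by (force simp: hat_def)

lemma projections_hat:
  assumes T: "T \<in> comm_subalgs B"
  shows "projections (F B) \<inter> hat B T = eta B ` T"
proof (intro equalityI subsetI)
  fix p assume p: "p \<in> projections (F B) \<inter> hat B T"
  then obtain f where f: "f \<in> carrier (Func B T)" "p = F_class B T f" by (auto simp: hat_def)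
  have "F_class B T (\<lambda>h\<in>St B T. cnj (f h)) = F_class B T f" "F_class B T (\<lambda>h\<in>St B T. f h * f h) = F_class B T f"
    using p f F_invol[OF T f(1)] F_mult[OF T f(1) f(1)] by (auto simp: projections_def)
  then have "f \<in> projections (Func B T)"
    using F_class_inj[OF T Func_closed(4)[OF f(1)] f(1)] F_class_inj[OF T Func_closed(1)[OF f(1) f(1)] f(1)] f(1)
    by (simp add: projections_def Func_simps)
  then show "p \<in> eta B ` T" using f(2) F_class_chi[OF T] by (auto simp: projections_Func[OF T])
next
  fix p assume "p \<in> eta B ` T"
  then obtain c where c: "c \<in> T" "p = eta B c" by blast
  have "chi B T c \<in> projections (Func B T)" using c by (auto simp: projections_Func[OF T])
  then have "(\<lambda>h\<in>St B T. cnj (chi B T c h)) = chi B T c" "(\<lambda>h\<in>St B T. chi B T c h * chi B T c h) = chi B T c"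
    by (simp_all add: projections_def Func_simps)
  then show "p \<in> projections (F B) \<inter> hat B T"
    using eta_in_hat[OF T c(1)] c F_invol[OF T chi_in[OF T c(1)]] F_mult[OF T chi_in[OF T c(1)] chi_in[OF T c(1)]]
      F_class_chi[OF T c(1)] T
    by (auto simp: projections_def F_carrier_hat)
qed

lemma projections_F: "projections (F B) = eta B ` carrier B"
proof (intro equalityI subsetI)
  fix p assume p: "p \<in> projections (F B)"
  then obtain C where C: "C \<in> comm_subalgs B" "p \<in> hat B C" by (auto simp: projections_def F_carrier_hat)
  then have "p \<in> eta B ` C" using p projections_hat[OF C(1)] by blast
  then show "p \<in> eta B ` carrier B" using subalg_sub[OF C(1)] by blast
next
  fix p assume "p \<in> eta B ` carrier B"
  then obtain c where c: "c \<in> carrier B" "p = eta B c" by blast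
  obtain C where "C \<in> comm_subalgs B" "c \<in> C" using subalg_of_elem[OF c(1)] by blast
  then show "p \<in> projections (F B)" using projections_hat c(2) by blast
qed

lemma eta_neg:
  assumes T: "T \<in> comm_subalgs B" and c: "c \<in> T"
  shows "eta B (bneg B c) = pminus (F B) \<one>\<^bsub>F B\<^esub> (eta B c)"
proof -
  have "(\<lambda>h\<in>St B T. (\<lambda>h\<in>St B T. 1) h - chi B T c h) = chi B T (bneg B c)"
    using St_neg[of _ B T c] c by (auto simp: chi_def fun_eq_iff)
  then show ?thesis
    using F_pminus[OF T Func_const[where c = 1] chi_in[OF T c]] F_const(1)[OF T] F_class_chi[OF T c]
      F_class_chi[OF T bneg_mem[OF T c]] by simp
qed

lemma hat_sub: "T \<in> comm_subalgs B \<Longrightarrow> hat B T \<subseteq> carrier (F B)"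
  by (auto simp: F_carrier_hat)

text \<open>The annihilator of a set of functions is generated by the complement of the join of their supports.\<close>

lemma hat_annihilator:
  assumes T: "T \<in> comm_subalgs B" and X: "X \<subseteq> hat B T"
  shows "\<exists>p\<in>projections (F B) \<inter> hat B T.
     {b\<in>hat B T. \<forall>x\<in>X. x \<otimes>\<^bsub>F B\<^esub> b = \<zero>\<^bsub>F B\<^esub>} = {p \<otimes>\<^bsub>F B\<^esub> c | c. c \<in> hat B T}"
proof -
  define Y where "Y = {f\<in>carrier (Func B T). F_class B T f \<in> X}"
  have XY: "X = F_class B T ` Y" using X by (auto simp: Y_def hat_def)
  define e where "e = bjoin B ((\<lambda>f. spec B T f (- {0})) ` Y)"
  have sub: "(\<lambda>f. spec B T f (- {0})) ` Y \<subseteq> T" using spec_mem[OF T] by (auto simp: Y_def)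
  have e: "e \<in> T" using bjoin_mem[OF T sub] by (simp add: e_def)
  note ne = bneg_mem[OF T e]
  have o: "open (- {0 :: complex})" by (simp add: open_Compl)
  have zero_iff: "x \<otimes>\<^bsub>F B\<^esub> F_class B T g = \<zero>\<^bsub>F B\<^esub> \<longleftrightarrow> (\<forall>h\<in>St B T. f h * g h = 0)"
    if "f \<in> carrier (Func B T)" "x = F_class B T f" "g \<in> carrier (Func B T)" for f g x
    using that F_mult[OF T that(1,3)] F_const(2)[OF T] F_class_inj[OF T Func_closed(1)[OF that(1,3)] Func_const]
    by (auto simp: fun_eq_iff)
  have key: "(\<forall>f\<in>Y. \<forall>h\<in>St B T. f h * g h = 0) \<longleftrightarrow> (\<forall>h\<in>St B T. g h \<noteq> 0 \<longrightarrow> \<not> h e)"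
    if g: "g \<in> carrier (Func B T)" for g
  proof
    assume z: "\<forall>f\<in>Y. \<forall>h\<in>St B T. f h * g h = 0"
    let ?k = "spec B T g (- {0})"
    have k: "?k \<in> T" using spec_mem[OF T g] .
    have "ble B (spec B T f (- {0})) (bneg B ?k)" if f: "f \<in> Y" for f
    proof (rule spec_least[OF T _ bneg_mem[OF T k]])
      show fK: "f \<in> carrier (Func B T)" using f by (simp add: Y_def)
      fix h assume h: "h \<in> St B T" "f h \<in> - {0}"
      have "\<not> h ?k"
      proof
        assume hk: "h ?k"
        obtain c where c: "c \<in> T" "h c" "\<forall>k\<in>St B T. k c \<longrightarrow> dist (f k) (f h) < cmod (f h)"
          using Func_D[OF T fK h(1), of "cmod (f h)"] h(2) by auto
        have "ble B ?k (bneg B c)"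
        proof (rule spec_least[OF T g bneg_mem[OF T c(1)]])
          fix k assume k: "k \<in> St B T" "g k \<in> - {0}"
          have "f k * g k = 0" using z f k(1) by blast
          then have "f k = 0" using k(2) by simp
          then have "\<not> k c" using c(3)[rule_format, OF k(1)] by (auto simp: dist_norm)
          then show "k (bneg B c)" using St_neg[OF k(1) c(1)] by blast
        qed
        then have "h (bneg B c)" using St_le[OF h(1) k bneg_mem[OF T c(1)]] hk by blast
        then show False using St_neg[OF h(1) c(1)] c(2) by blast
      qed
      then show "h (bneg B ?k)" using St_neg[OF h(1) k] by blast
    qed
    then have "ble B e (bneg B ?k)"
      unfolding e_def using join_least[OF T sub bneg_mem[OF T k]] by blast
    then have "\<not> h e" if "h \<in> St B T" "g h \<noteq> 0" for h
      using St_le[OF that(1) e bneg_mem[OF T k]] St_neg[OF that(1) k] spec_covers[OF T g o that(1)] that(2) by auto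
    then show "\<forall>h\<in>St B T. g h \<noteq> 0 \<longrightarrow> \<not> h e" by blast
  next
    assume *: "\<forall>h\<in>St B T. g h \<noteq> 0 \<longrightarrow> \<not> h e"
    have "f h * g h = 0" if f: "f \<in> Y" and h: "h \<in> St B T" for f h
    proof (cases "f h = 0")
      case False
      have fK: "f \<in> carrier (Func B T)" using f by (simp add: Y_def)
      have "ble B (spec B T f (- {0})) e" unfolding e_def by (rule join_upper[OF T sub]) (use f in blast)
      then have "h e" using St_le[OF h spec_mem[OF T fK] e] spec_covers[OF T fK o h] False by auto
      then show ?thesis using * h by auto
    qed simp
    then show "\<forall>f\<in>Y. \<forall>h\<in>St B T. f h * g h = 0" by blast
  qed
  have pm: "eta B (bneg B e) \<otimes>\<^bsub>F B\<^esub> F_class B T g = F_class B T (\<lambda>h\<in>St B T. chi B T (bneg B e) h * g h)"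
    if "g \<in> carrier (Func B T)" for g
    using F_mult[OF T chi_in[OF T ne] that] F_class_chi[OF T ne] by simp
  have "{b\<in>hat B T. \<forall>x\<in>X. x \<otimes>\<^bsub>F B\<^esub> b = \<zero>\<^bsub>F B\<^esub>} = {eta B (bneg B e) \<otimes>\<^bsub>F B\<^esub> c | c. c \<in> hat B T}"
  proof (intro equalityI subsetI)
    fix b assume "b \<in> {b\<in>hat B T. \<forall>x\<in>X. x \<otimes>\<^bsub>F B\<^esub> b = \<zero>\<^bsub>F B\<^esub>}"
    then obtain g where g: "g \<in> carrier (Func B T)" "b = F_class B T g"
      and z: "\<forall>x\<in>X. x \<otimes>\<^bsub>F B\<^esub> b = \<zero>\<^bsub>F B\<^esub>" by (auto simp: hat_def)
    have "\<forall>f\<in>Y. \<forall>h\<in>St B T. f h * g h = 0"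
    proof
      fix f assume f: "f \<in> Y"
      then have "F_class B T f \<otimes>\<^bsub>F B\<^esub> F_class B T g = \<zero>\<^bsub>F B\<^esub>" using z g(2) XY by blast
      then show "\<forall>h\<in>St B T. f h * g h = 0" using zero_iff[OF _ refl g(1)] f by (simp add: Y_def)
    qed
    then have ng: "\<forall>h\<in>St B T. g h \<noteq> 0 \<longrightarrow> \<not> h e" using key[OF g(1)] by blast
    have "(\<lambda>h\<in>St B T. chi B T (bneg B e) h * g h) = g"
      by (rule Func_eqI[OF Func_closed(1)[OF chi_in[OF T ne] g(1)] g(1)])
        (use ng St_neg[OF _ e] in \<open>auto simp: chi_def\<close>)
    then have "b = eta B (bneg B e) \<otimes>\<^bsub>F B\<^esub> b" using pm[OF g(1)] g(2) by simp
    then show "b \<in> {eta B (bneg B e) \<otimes>\<^bsub>F B\<^esub> c | c. c \<in> hat B T}" using g by (auto simp: hat_def)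
  next
    fix b assume "b \<in> {eta B (bneg B e) \<otimes>\<^bsub>F B\<^esub> c | c. c \<in> hat B T}"
    then obtain c where c: "c \<in> carrier (Func B T)" "b = eta B (bneg B e) \<otimes>\<^bsub>F B\<^esub> F_class B T c"
      by (auto simp: hat_def)
    define g where "g = (\<lambda>h\<in>St B T. chi B T (bneg B e) h * c h)"
    have g: "g \<in> carrier (Func B T)" "b = F_class B T g"
      using Func_closed(1)[OF chi_in[OF T ne] c(1)] pm[OF c(1)] c(2) by (simp_all add: g_def)
    have "\<forall>h\<in>St B T. g h \<noteq> 0 \<longrightarrow> \<not> h e"
      using St_neg[OF _ e] by (auto simp: g_def chi_def)
    then have "\<forall>f\<in>Y. \<forall>h\<in>St B T. f h * g h = 0" using key[OF g(1)] by blast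
    then have "x \<otimes>\<^bsub>F B\<^esub> b = \<zero>\<^bsub>F B\<^esub>" if x: "x \<in> X" for x
    proof -
      obtain f where "f \<in> Y" "x = F_class B T f" using x XY by blast
      then show ?thesis using zero_iff[of f x g] g \<open>\<forall>f\<in>Y. _\<close> by (simp add: Y_def)
    qed
    then show "b \<in> {b\<in>hat B T. \<forall>x\<in>X. x \<otimes>\<^bsub>F B\<^esub> b = \<zero>\<^bsub>F B\<^esub>}" using g by (auto simp: hat_def)
  qed
  moreover have "eta B (bneg B e) \<in> projections (F B) \<inter> hat B T" using projections_hat[OF T] ne by blast
  ultimately show ?thesis by blast
qed

lemma hat_AWstar:
  assumes T: "T \<in> comm_subalgs B"
  shows "comm_AWstar_on (F B) (hat B T)"
proof -
  let ?L = "proj_order (Func B T)" and ?L' = "proj_order ((F B)\<lparr>carrier := hat B T\<rparr>)"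
  have pr: "projections ((F B)\<lparr>carrier := hat B T\<rparr>) = projections (F B) \<inter> hat B T"
    using hat_sub[OF T] by (auto simp: projections_def)
  have cL: "carrier ?L = chi B T ` T" by (simp add: proj_order_def projections_Func[OF T])
  have cL': "carrier ?L' = F_class B T ` carrier ?L"
  proof -
    have "carrier ?L' = eta B ` T" by (simp add: proj_order_def pr projections_hat[OF T])
    then show ?thesis unfolding cL using F_class_chi_image[OF T order_refl] by simp
  qed
  have le: "le ?L' (F_class B T x) (F_class B T y) \<longleftrightarrow> le ?L x y"
    if xy: "x \<in> carrier ?L" "y \<in> carrier ?L" for x y
  proof -
    have m: "x \<in> carrier (Func B T)" "y \<in> carrier (Func B T)" using xy chi_in[OF T] by (auto simp: cL)
    show ?thesis using F_mult[OF T m] F_class_inj[OF T m(1) Func_closed(1)[OF m]]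
      by (simp add: proj_order_def Func_simps)
  qed
  have rp: "is_RP ((F B)\<lparr>carrier := hat B T\<rparr>) a (rproj (F B) a)" if a: "a \<in> hat B T" for a
  proof -
    obtain f where f: "f \<in> carrier (Func B T)" "a = F_class B T f" using a by (auto simp: hat_def)
    let ?p = "chi B T (spec B T f (- {0}))" and ?S = "{q \<in> projections (Func B T). f \<otimes>\<^bsub>Func B T\<^esub> q = f}"
    have S: "?S \<subseteq> carrier ?L" by (auto simp: proj_order_def)
    have "F_class B T ` ?S = {q \<in> projections (F B) \<inter> hat B T. a \<otimes>\<^bsub>F B\<^esub> q = a}"
    proof -
      have iff: "a \<otimes>\<^bsub>F B\<^esub> F_class B T q = a \<longleftrightarrow> f \<otimes>\<^bsub>Func B T\<^esub> q = f" if "q \<in> chi B T ` T" for q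
      proof -
        have "q \<in> carrier (Func B T)" using that chi_in[OF T] by auto
        then show ?thesis using F_mult[OF T f(1)] F_class_inj[OF T Func_closed(1)[OF f(1)] f(1)] f(2)
          by (simp add: Func_simps)
      qed
      have "projections (F B) \<inter> hat B T = F_class B T ` chi B T ` T"
        using F_class_chi_image[OF T order_refl] projections_hat[OF T] by simp
      moreover have "F_class B T ` {q \<in> P. f \<otimes>\<^bsub>Func B T\<^esub> q = f} = {q \<in> F_class B T ` P. a \<otimes>\<^bsub>F B\<^esub> q = a}"
        if "P = chi B T ` T" for P
      proof (intro equalityI subsetI)
        fix q assume "q \<in> F_class B T ` {q \<in> P. f \<otimes>\<^bsub>Func B T\<^esub> q = f}"
        then obtain k where "q = F_class B T k" "k \<in> P" "f \<otimes>\<^bsub>Func B T\<^esub> k = f" by blast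
        then show "q \<in> {q \<in> F_class B T ` P. a \<otimes>\<^bsub>F B\<^esub> q = a}" using iff[of k] that by simp
      next
        fix q assume "q \<in> {q \<in> F_class B T ` P. a \<otimes>\<^bsub>F B\<^esub> q = a}"
        then obtain k where "q = F_class B T k" "k \<in> P" "a \<otimes>\<^bsub>F B\<^esub> F_class B T k = a" by blast
        then show "q \<in> F_class B T ` {q \<in> P. f \<otimes>\<^bsub>Func B T\<^esub> q = f}" using iff[of k] that by simp
      qed
      ultimately show ?thesis unfolding projections_Func[OF T] by simp
    qed
    moreover have "least ?L ?p ?S" using is_RP_Func[OF T f(1), of ?p] by (simp add: is_RP_def)
    from least_image[OF cL' le S this] have "least ?L' (F_class B T ?p) (F_class B T ` ?S)" .
    moreover have "rproj (F B) a = F_class B T ?p"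
      using F_rproj[OF T f(1)] F_class_chi[OF T spec_mem[OF T f(1)]] f(2) by simp
    ultimately show ?thesis by (simp add: is_RP_def pr)
  qed
  have lub: "is_lub ?L' (pjoin (F B) X) X" if X: "X \<subseteq> projections (F B) \<inter> hat B T" for X
  proof -
    obtain Y where Y: "Y \<subseteq> T" "X = eta B ` Y" using X projections_hat[OF T] by (metis subset_imageE)
    then have XY: "X = F_class B T ` chi B T ` Y" using F_class_chi_image[OF T Y(1)] by simp
    have S: "chi B T ` Y \<subseteq> carrier ?L" using Y by (auto simp: cL)
    have "is_lub ?L (chi B T (bjoin B Y)) (chi B T ` Y)" using is_lub_chi[OF T Y(1)] by blast
    from least_image[OF cL' le Upper_closed this] Upper_image[OF cL' le S]
    have "is_lub ?L' (F_class B T (chi B T (bjoin B Y))) X" unfolding XY by simp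
    then show ?thesis
      using F_pjoin[OF T Y(1)] F_class_chi[OF T bjoin_mem[OF T Y(1)]] Y(2) by simp
  qed
  show ?thesis
    unfolding comm_AWstar_on_def using hat_Cstar[OF T] hat_annihilator[OF T] rp lub by blast
qed

lemma hat_closed:
  assumes T: "T \<in> comm_subalgs B"
  shows "a \<in> hat B T \<Longrightarrow> b \<in> hat B T \<Longrightarrow> a \<oplus>\<^bsub>F B\<^esub> b \<in> hat B T \<and> a \<otimes>\<^bsub>F B\<^esub> b \<in> hat B T"
    "a \<in> hat B T \<Longrightarrow> invol (F B) a \<in> hat B T" "a \<in> hat B T \<Longrightarrow> c \<odot>\<^bsub>F B\<^esub> a \<in> hat B T"
    "\<zero>\<^bsub>F B\<^esub> \<in> hat B T" "\<one>\<^bsub>F B\<^esub> \<in> hat B T"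
  by (auto simp: hat_def F_ops[OF T] Func_closed Func_const)

theorem is_pAWstar_F: "is_pAWstar (F B)"
proof -
  have hat_comm: "hat B T \<times> hat B T \<subseteq> comm (F B)" if "T \<in> comm_subalgs B" for T
    using that by (auto simp: F_comm_iff)
  have ex: "\<exists>T\<subseteq>carrier (F B). X \<subseteq> T \<and> T \<times> T \<subseteq> comm (F B) \<and> comm_AWstar_on (F B) T"
    if "X \<subseteq> carrier (F B)" "X \<times> X \<subseteq> comm (F B)" for X
    using commeasurable_in_hat[OF that] hat_sub hat_comm hat_AWstar by metis
  obtain C where C: "C \<in> comm_subalgs B" using subalg_exists by blast
  have cl: "invol (F B) a \<in> carrier (F B) \<and> c \<odot>\<^bsub>F B\<^esub> a \<in> carrier (F B)" if "a \<in> carrier (F B)" for a c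
    using that hat_closed(2,3) unfolding F_carrier_hat by blast
  have cl2: "a \<oplus>\<^bsub>F B\<^esub> b \<in> carrier (F B) \<and> a \<otimes>\<^bsub>F B\<^esub> b \<in> carrier (F B)" if "(a, b) \<in> comm (F B)" for a b
    using that hat_closed(1) unfolding F_carrier_hat F_comm_iff by blast
  have "is_pCstar (F B)"
    unfolding is_pCstar_def
  proof (intro conjI)
    show "comm (F B) \<subseteq> carrier (F B) \<times> carrier (F B)" "\<forall>a\<in>carrier (F B). (a, a) \<in> comm (F B)"
      "sym (comm (F B))"
      by (auto simp: F_comm_iff F_carrier_hat sym_def)
    show "\<zero>\<^bsub>F B\<^esub> \<in> carrier (F B)" "\<one>\<^bsub>F B\<^esub> \<in> carrier (F B)"
      using hat_closed(4,5)[OF C] hat_sub[OF C] by auto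
    show "\<forall>X\<subseteq>carrier (F B). X \<times> X \<subseteq> comm (F B) \<longrightarrow>
      (\<exists>T\<subseteq>carrier (F B). X \<subseteq> T \<and> T \<times> T \<subseteq> comm (F B) \<and> comm_Cstar_on (F B) T)"
    proof (intro allI impI)
      fix X assume "X \<subseteq> carrier (F B)" "X \<times> X \<subseteq> comm (F B)"
      then obtain T where T: "T \<subseteq> carrier (F B)" "X \<subseteq> T" "T \<times> T \<subseteq> comm (F B)" "comm_AWstar_on (F B) T"
        using ex by metis
      have "comm_Cstar_on (F B) T" using T(4) unfolding comm_AWstar_on_def by (rule conjunct1)
      with T(1-3) show "\<exists>T\<subseteq>carrier (F B). X \<subseteq> T \<and> T \<times> T \<subseteq> comm (F B) \<and> comm_Cstar_on (F B) T"
        by (intro exI[of _ T] conjI)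
    qed
  qed (use cl cl2 in auto)
  moreover have "rproj (F B) a \<in> projections (F B)" if a: "a \<in> carrier (F B)" for a
  proof -
    obtain C f where "C \<in> comm_subalgs B" "f \<in> carrier (Func B C)" "a = F_class B C f"
      using a by (auto simp: F_carrier_hat hat_def)
    then show ?thesis using F_rproj spec_mem projections_hat by (metis IntD1 image_eqI)
  qed
  moreover have "pjoin (F B) X \<in> projections (F B)"
    if X: "X \<subseteq> projections (F B)" "X \<times> X \<subseteq> comm (F B)" for X
  proof -
    have "X \<subseteq> carrier (F B)" using X by (auto simp: projections_def)
    then obtain T where T: "T \<in> comm_subalgs B" "X \<subseteq> hat B T" using commeasurable_in_hat X(2) by metis
    then have "X \<subseteq> eta B ` T" using X(1) projections_hat[OF T(1)] by blast
    then obtain Y where Y: "Y \<subseteq> T" "X = eta B ` Y" by (metis subset_imageE)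
    then show ?thesis using F_pjoin[OF T(1) Y(1)] bjoin_mem[OF T(1) Y(1)] projections_hat[OF T(1)] by auto
  qed
  ultimately show ?thesis unfolding is_pAWstar_def using ex by blast
qed

end

section \<open>Bijective morphisms that reflect commeasurability\<close>

lemma pCBool_isoI:
  assumes B: "is_pCBool B" and g: "g \<in> pCBool_hom B B'" and bij: "bij_betw g (carrier B) (carrier B')"
    and refl: "\<And>x y. x \<in> carrier B \<Longrightarrow> y \<in> carrier B \<Longrightarrow> (g x, g y) \<in> bcomm B' \<Longrightarrow> (x, y) \<in> bcomm B"
    and comm: "bcomm B' \<subseteq> carrier B' \<times> carrier B'"
  shows "pCBool_iso B B' g"
proof -
  define h where "h = restrict (inv_into (carrier B) g) (carrier B')"
  have hg: "h (g x) = x" if "x \<in> carrier B" for x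
    using that bij bij_betw_inv_into_left[OF bij that] by (auto simp: h_def bij_betw_def)
  have gh: "g (h y) = y" "h y \<in> carrier B" if "y \<in> carrier B'" for y
    using that bij bij_betw_inv_into_right[OF bij that]
    by (auto simp: h_def bij_betw_def inv_into_into)
  have "h \<in> pCBool_hom B' B"
    unfolding pCBool_hom_def
  proof (intro CollectI conjI ballI allI impI)
    show "h \<in> carrier B' \<rightarrow>\<^sub>E carrier B" using gh by (auto simp: h_def)
    fix p assume "p \<in> bcomm B'"
    then show "case p of (x, y) \<Rightarrow> (h x, h y) \<in> bcomm B"
      using refl[of "h (fst p)" "h (snd p)"] gh comm by (cases p) auto
  next
    fix y assume y: "y \<in> carrier B'"
    have "g (bneg B (h y)) = bneg B' y" using g gh[OF y] by (auto simp: pCBool_hom_def)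
    moreover have "bneg B (h y) \<in> carrier B" using B gh[OF y] by (auto simp: is_pCBool_def)
    ultimately show "h (bneg B' y) = bneg B (h y)" using hg by metis
  next
    fix X assume X: "X \<subseteq> carrier B'" "X \<times> X \<subseteq> bcomm B'"
    have hX: "h ` X \<subseteq> carrier B" using X gh by auto
    have "(h x, h y) \<in> bcomm B" if xy: "x \<in> X" "y \<in> X" for x y
    proof (rule refl)
      have "x \<in> carrier B'" "y \<in> carrier B'" using xy X by auto
      then show "h x \<in> carrier B" "h y \<in> carrier B" "(g (h x), g (h y)) \<in> bcomm B'"
        using gh X(2) xy by auto
    qed
    then have hX2: "h ` X \<times> h ` X \<subseteq> bcomm B" by auto
    have "g ` h ` X = X" using X(1) gh by (force simp: image_image)
    then have "g (bjoin B (h ` X)) = bjoin B' X" using g hX hX2 by (auto simp: pCBool_hom_def)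
    moreover have "bjoin B (h ` X) \<in> carrier B" using B hX hX2 by (auto simp: is_pCBool_def)
    ultimately show "h (bjoin B' X) = bjoin B (h ` X)" using hg by metis
  qed
  moreover have "compose (carrier B) h g = (\<lambda>x\<in>carrier B. x)" "compose (carrier B') g h = (\<lambda>x\<in>carrier B'. x)"
    using hg gh by (auto simp: compose_def fun_eq_iff)
  ultimately show ?thesis using g unfolding pCBool_iso_def by blast
qed

lemma pAWstar_iso_inv:
  assumes A: "is_pAWstar A" and g: "g \<in> pAWstar_hom A A'" and bij: "bij_betw g (carrier A) (carrier A')"
    and refl: "\<And>x y. x \<in> carrier A \<Longrightarrow> y \<in> carrier A \<Longrightarrow> (g x, g y) \<in> comm A' \<Longrightarrow> (x, y) \<in> comm A"
    and comm: "comm A' \<subseteq> carrier A' \<times> carrier A'"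
  shows "pAWstar_iso A' A (restrict (inv_into (carrier A) g) (carrier A'))"
proof -
  define h where "h = restrict (inv_into (carrier A) g) (carrier A')"
  have Ac: "is_pCstar A" using A by (simp add: is_pAWstar_def)
  have hg: "h (g x) = x" if "x \<in> carrier A" for x
    using that bij bij_betw_inv_into_left[OF bij that] by (auto simp: h_def bij_betw_def)
  have gh: "g (h y) = y" "h y \<in> carrier A" if "y \<in> carrier A'" for y
    using that bij bij_betw_inv_into_right[OF bij that]
    by (auto simp: h_def bij_betw_def inv_into_into)
  have gc: "g (a \<oplus>\<^bsub>A\<^esub> b) = g a \<oplus>\<^bsub>A'\<^esub> g b" "g (a \<otimes>\<^bsub>A\<^esub> b) = g a \<otimes>\<^bsub>A'\<^esub> g b" if "(a, b) \<in> comm A" for a b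
    using g that by (auto simp: pAWstar_hom_def)
  have cl: "a \<oplus>\<^bsub>A\<^esub> b \<in> carrier A" "a \<otimes>\<^bsub>A\<^esub> b \<in> carrier A" if "(a, b) \<in> comm A" for a b
    using Ac that by (auto simp: is_pCstar_def)
  have proj: "h p \<in> projections A" if p: "p \<in> projections A'" for p
  proof -
    have p': "p \<in> carrier A'" "invol A' p = p" "p \<otimes>\<^bsub>A'\<^esub> p = p" using p by (auto simp: projections_def)
    have hp: "h p \<in> carrier A" using gh p' by blast
    then have "(h p, h p) \<in> comm A" "invol A (h p) \<in> carrier A" using Ac by (auto simp: is_pCstar_def)
    moreover have "g (invol A (h p)) = p" using g hp gh p' by (auto simp: pAWstar_hom_def)
    moreover have "g (h p \<otimes>\<^bsub>A\<^esub> h p) = p" using gc(2) calculation(1) gh p' by simp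
    ultimately show ?thesis using hg cl hp by (metis (mono_tags, lifting) mem_Collect_eq projections_def)
  qed
  have "h \<in> pAWstar_hom A' A"
    unfolding pAWstar_hom_def
  proof (intro CollectI conjI ballI allI impI)
    show "h \<in> carrier A' \<rightarrow>\<^sub>E carrier A" using gh by (auto simp: h_def)
    fix p assume p: "p \<in> comm A'"
    obtain x y where xy: "p = (x, y)" "x \<in> carrier A'" "y \<in> carrier A'" using p comm by auto
    have c: "(h x, h y) \<in> comm A" using refl[of "h x" "h y"] gh xy p by auto
    have "h (x \<oplus>\<^bsub>A'\<^esub> y) = h x \<oplus>\<^bsub>A\<^esub> h y" "h (x \<otimes>\<^bsub>A'\<^esub> y) = h x \<otimes>\<^bsub>A\<^esub> h y"
      using hg[OF cl(1)[OF c]] hg[OF cl(2)[OF c]] gc[OF c] gh xy by auto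
    then show "case p of (a, b) \<Rightarrow> (h a, h b) \<in> comm A \<and> h (a \<oplus>\<^bsub>A'\<^esub> b) = h a \<oplus>\<^bsub>A\<^esub> h b \<and>
        h (a \<otimes>\<^bsub>A'\<^esub> b) = h a \<otimes>\<^bsub>A\<^esub> h b"
      using c xy by simp
  next
    fix c y assume y: "y \<in> carrier A'"
    have "g (c \<odot>\<^bsub>A\<^esub> h y) = c \<odot>\<^bsub>A'\<^esub> y" using g gh[OF y] by (auto simp: pAWstar_hom_def)
    moreover have "c \<odot>\<^bsub>A\<^esub> h y \<in> carrier A" using Ac gh[OF y] by (auto simp: is_pCstar_def)
    ultimately show "h (c \<odot>\<^bsub>A'\<^esub> y) = c \<odot>\<^bsub>A\<^esub> h y" using hg by metis
  next
    fix y assume y: "y \<in> carrier A'"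
    have "g (invol A (h y)) = invol A' y" using g gh[OF y] by (auto simp: pAWstar_hom_def)
    moreover have "invol A (h y) \<in> carrier A" using Ac gh[OF y] by (auto simp: is_pCstar_def)
    ultimately show "h (invol A' y) = invol A (h y)" using hg by metis
  next
    have "\<one>\<^bsub>A\<^esub> \<in> carrier A" "g \<one>\<^bsub>A\<^esub> = \<one>\<^bsub>A'\<^esub>" using Ac g by (auto simp: is_pCstar_def pAWstar_hom_def)
    then show "h \<one>\<^bsub>A'\<^esub> = \<one>\<^bsub>A\<^esub>" using hg by metis
  next
    fix X assume X: "X \<subseteq> projections A'" "X \<times> X \<subseteq> comm A'"
    have Xc: "X \<subseteq> carrier A'" using X by (auto simp: projections_def)
    have hX: "h ` X \<subseteq> projections A" using X proj by auto
    have "(h x, h y) \<in> comm A" if xy: "x \<in> X" "y \<in> X" for x y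
    proof (rule refl)
      have "x \<in> carrier A'" "y \<in> carrier A'" using xy Xc by auto
      then show "h x \<in> carrier A" "h y \<in> carrier A" "(g (h x), g (h y)) \<in> comm A'"
        using gh X(2) xy by auto
    qed
    then have hX2: "h ` X \<times> h ` X \<subseteq> comm A" by auto
    have "g ` h ` X = X" using Xc gh by (force simp: image_image)
    then have "g (pjoin A (h ` X)) = pjoin A' X" using g hX hX2 by (auto simp: pAWstar_hom_def)
    moreover have "pjoin A (h ` X) \<in> carrier A" using A hX hX2 by (auto simp: is_pAWstar_def projections_def)
    ultimately show "h (pjoin A' X) = pjoin A (h ` X)" using hg by metis
  qed
  moreover have "compose (carrier A) h g = (\<lambda>x\<in>carrier A. x)" "compose (carrier A') g h = (\<lambda>x\<in>carrier A'. x)"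
    using hg gh by (auto simp: compose_def fun_eq_iff)
  ultimately show "pAWstar_iso A' A (restrict (inv_into (carrier A) g) (carrier A'))"
    using g unfolding pAWstar_iso_def h_def[symmetric] by blast
qed

section \<open>The functor F and the unit of the equivalence\<close>

context pcbool
begin

lemma eta_iso: "pCBool_iso B (Proj (F B)) (restrict (eta B) (carrier B))"
proof (rule pCBool_isoI)
  let ?e = "restrict (eta B) (carrier B)"
  have sub: "\<exists>T\<in>comm_subalgs B. X \<subseteq> T" if "X \<subseteq> carrier B" "X \<times> X \<subseteq> bcomm B" for X
    using commeasurable_in_subalg[OF that] by metis
  have bc: "bcomm B \<subseteq> carrier B \<times> carrier B" "sym (bcomm B)" "\<And>x. x \<in> carrier B \<Longrightarrow> (x, x) \<in> bcomm B"
    using pcb by (auto simp: is_pCBool_def)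
  show "?e \<in> pCBool_hom B (Proj (F B))"
    unfolding pCBool_hom_def
  proof (intro CollectI conjI ballI allI impI)
    show "?e \<in> carrier B \<rightarrow>\<^sub>E carrier (Proj (F B))" by (auto simp: Proj_def projections_F)
    fix p assume p: "p \<in> bcomm B"
    obtain x y where xy: "p = (x, y)" "x \<in> carrier B" "y \<in> carrier B" using p bc by auto
    have "{x, y} \<times> {x, y} \<subseteq> bcomm B" using p xy bc by (auto dest: symD)
    then obtain T where T: "T \<in> comm_subalgs B" "{x, y} \<subseteq> T" using sub[of "{x, y}"] xy by auto
    then have "(eta B x, eta B y) \<in> comm (F B)" using eta_in_hat[OF T(1)] by (auto simp: F_comm_iff)
    then show "case p of (x, y) \<Rightarrow> (?e x, ?e y) \<in> bcomm (Proj (F B))"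
      using xy by (auto simp: Proj_def projections_F)
  next
    fix x assume x: "x \<in> carrier B"
    obtain T where T: "T \<in> comm_subalgs B" "x \<in> T" using subalg_of_elem[OF x] by blast
    then show "?e (bneg B x) = bneg (Proj (F B)) (?e x)"
      using x eta_neg[OF T] bneg_mem[OF T] subalg_sub[OF T(1)] by (auto simp: Proj_def)
  next
    fix X assume X: "X \<subseteq> carrier B" "X \<times> X \<subseteq> bcomm B"
    obtain T where T: "T \<in> comm_subalgs B" "X \<subseteq> T" using sub[OF X] by blast
    have "?e ` X = eta B ` X" using X(1) by (auto simp: image_iff)
    moreover have "bjoin B X \<in> carrier B" using bjoin_mem[OF T] subalg_sub[OF T(1)] by blast
    ultimately show "?e (bjoin B X) = bjoin (Proj (F B)) (?e ` X)"
      using F_pjoin[OF T] by (simp add: Proj_def)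
  qed
  show "bij_betw ?e (carrier B) (carrier (Proj (F B)))"
    using inj_eta by (simp add: bij_betw_def Proj_def projections_F inj_on_restrict_eq)
  show "(x, y) \<in> bcomm B" if xy: "x \<in> carrier B" "y \<in> carrier B" "(?e x, ?e y) \<in> bcomm (Proj (F B))" for x y
  proof -
    obtain C where C: "C \<in> comm_subalgs B" "eta B x \<in> hat B C" "eta B y \<in> hat B C"
      using xy by (auto simp: Proj_def F_comm_iff)
    have "eta B x \<in> projections (F B)" "eta B y \<in> projections (F B)" using xy projections_F by auto
    then have "eta B x \<in> eta B ` C" "eta B y \<in> eta B ` C"
      using C(2,3) unfolding projections_hat[OF C(1), symmetric] by simp_all
    then have "x \<in> C" "y \<in> C"
      using inj_on_image_mem_iff[OF inj_eta _ subalg_sub[OF C(1)]] xy by simp_all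
    then show ?thesis using C(1) by (auto simp: comm_subalgs_def)
  qed
  show "bcomm (Proj (F B)) \<subseteq> carrier (Proj (F B)) \<times> carrier (Proj (F B))" by (auto simp: Proj_def)
qed (rule pcb)

end

lemma pCBool_homD:
  assumes "g \<in> pCBool_hom B B'"
  shows "x \<in> carrier B \<Longrightarrow> g x \<in> carrier B'"
    and "(x, y) \<in> bcomm B \<Longrightarrow> (g x, g y) \<in> bcomm B'"
    and "x \<in> carrier B \<Longrightarrow> g (bneg B x) = bneg B' (g x)"
    and "X \<subseteq> carrier B \<Longrightarrow> X \<times> X \<subseteq> bcomm B \<Longrightarrow> g (bjoin B X) = bjoin B' (g ` X)"
  using assms by (auto simp: pCBool_hom_def)

lemma pcbool_of: "is_pCBool B \<Longrightarrow> pcbool B"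
  by (simp add: pcbool_def)

context
  fixes B :: "'b pCBool" and B' :: "'c pCBool" and g
  assumes B: "is_pCBool B" and B': "is_pCBool B'" and g: "g \<in> pCBool_hom B B'"
begin

interpretation B: pcbool B by (rule pcbool_of[OF B])
interpretation B': pcbool B' by (rule pcbool_of[OF B'])

lemma hom_subalg_hom:
  assumes C: "C \<in> comm_subalgs B" and gC: "g ` C \<subseteq> D"
  shows "subalg_hom B B' C D g"
proof -
  have c: "C \<subseteq> carrier B" "C \<times> C \<subseteq> bcomm B" using C by (auto simp: comm_subalgs_def)
  show ?thesis
    unfolding subalg_hom_def
  proof (intro conjI ballI allI impI gC)
    show "g (bneg B x) = bneg B' (g x)" if "x \<in> C" for x using pCBool_homD(3)[OF g] c(1) that by blast
    show "g (bjoin B X) = bjoin B' (g ` X)" if "X \<subseteq> C" for X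
      by (rule pCBool_homD(4)[OF g]) (use that c in auto)
  qed
qed

lemma hom_image_in_subalg:
  assumes C: "C \<in> comm_subalgs B"
  obtains D where "D \<in> comm_subalgs B'" "g ` C \<subseteq> D"
proof -
  have c: "C \<subseteq> carrier B" "C \<times> C \<subseteq> bcomm B" using C by (auto simp: comm_subalgs_def)
  have "g ` C \<subseteq> carrier B'" using c(1) pCBool_homD(1)[OF g] by blast
  moreover have "g ` C \<times> g ` C \<subseteq> bcomm B'" using c(2) pCBool_homD(2)[OF g] by blast
  ultimately show ?thesis using B'.commeasurable_in_subalg that by metis
qed

text \<open>
  Independence of the chosen representative and of \<open>D\<close>: the spectral projections of the image are the
  images under \<open>g\<close> of those of \<open>f\<close>, and these depend on the class only.
\<close>

lemma F_map_class:
  assumes C: "C \<in> comm_subalgs B" and D: "D \<in> comm_subalgs B'" and gC: "g ` C \<subseteq> D"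
    and f: "f \<in> carrier (Func B C)"
  shows "F_map B B' g (F_class B C f) = F_class B' D (Func_map B' C D g f)"
proof -
  note pB' = pcbool_of[OF B']
  let ?P = "\<lambda>w. \<exists>C'\<in>comm_subalgs B. \<exists>f'\<in>carrier (Func B C'). \<exists>D\<in>comm_subalgs B'.
       F_class B C f = F_class B C' f' \<and> g ` C' \<subseteq> D \<and> w = F_class B' D (Func_map B' C' D g f')"
  have "(THE w. ?P w) = F_class B' D (Func_map B' C D g f)"
  proof (rule the_equality)
    show "?P (F_class B' D (Func_map B' C D g f))" using assms by blast
    fix w assume "?P w"
    then obtain C' f' D' where C': "C' \<in> comm_subalgs B" "f' \<in> carrier (Func B C')" "D' \<in> comm_subalgs B'"
      "F_class B C f = F_class B C' f'" "g ` C' \<subseteq> D'" "w = F_class B' D' (Func_map B' C' D' g f')" by blast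
    note h = hom_subalg_hom[OF C gC] and h' = hom_subalg_hom[OF C'(1,5)]
    show "w = F_class B' D (Func_map B' C D g f)"
      unfolding C'(6)
    proof (rule B'.F_class_eqI[OF C'(3) D])
      show "Func_map B' C' D' g f' \<in> carrier (Func B' D')"
        using B.Func_map_in[OF pB' C'(1,3) h' C'(2)] .
      show "Func_map B' C D g f \<in> carrier (Func B' D)" using B.Func_map_in[OF pB' C D h f] .
      fix U :: "complex set" assume U: "open U"
      have "spec B C f U = spec B C' f' U"
        using C'(4) B.spec_equivclp[of "(C, f)" "(C', f')" U] U by (simp add: F_class_eq_iff)
      then show "spec B' D' (Func_map B' C' D' g f') U = spec B' D (Func_map B' C D g f) U"
        using B.spec_Func_map[OF pB' C'(1,3) h' C'(2) U] B.spec_Func_map[OF pB' C D h f U] by simp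
    qed
  qed
  moreover have "F_class B C f \<in> F_carrier B" using C f by (auto simp: F_carrier_iff)
  ultimately show ?thesis by (simp add: F_map_def)
qed

lemma F_map_eta:
  assumes b: "b \<in> carrier B"
  shows "F_map B B' g (eta B b) = eta B' (g b)"
proof -
  obtain C where C: "C \<in> comm_subalgs B" "b \<in> C" using B.subalg_of_elem[OF b] by blast
  obtain D where D: "D \<in> comm_subalgs B'" "g ` C \<subseteq> D" using hom_image_in_subalg[OF C(1)] .
  show ?thesis
    using F_map_class[OF C(1) D B.chi_in[OF C]]
      B.Func_map_chi[OF pcbool_of[OF B'] C(1) D(1) hom_subalg_hom[OF C(1) D(2)] C(2)]
      B.F_class_chi[OF C] B'.F_class_chi[OF D(1), of "g b"] D(2) C(2) by auto
qed

lemma F_map_hom: "F_map B B' g \<in> pAWstar_hom (F B) (F B')"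
  unfolding pAWstar_hom_def
proof (intro CollectI conjI ballI allI impI)
  note pB' = pcbool_of[OF B']
  have rep: "\<exists>C f D. C \<in> comm_subalgs B \<and> f \<in> carrier (Func B C) \<and> u = F_class B C f \<and>
      D \<in> comm_subalgs B' \<and> g ` C \<subseteq> D \<and> Func_map B' C D g f \<in> carrier (Func B' D) \<and>
      F_map B B' g u = F_class B' D (Func_map B' C D g f)" if "u \<in> carrier (F B)" for u
  proof -
    obtain C f where C: "C \<in> comm_subalgs B" "f \<in> carrier (Func B C)" "u = F_class B C f"
      using \<open>u \<in> carrier (F B)\<close> by (auto simp: B.F_carrier_hat hat_def)
    obtain D where D: "D \<in> comm_subalgs B'" "g ` C \<subseteq> D" using hom_image_in_subalg[OF C(1)] .
    show ?thesis
      using C D F_map_class[OF C(1) D C(2)] B.Func_map_in[OF pB' C(1) D(1) hom_subalg_hom[OF C(1) D(2)] C(2)]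
      by blast
  qed
  show "F_map B B' g \<in> carrier (F B) \<rightarrow>\<^sub>E carrier (F B')"
  proof
    show "F_map B B' g x = undefined" if "x \<notin> carrier (F B)" for x
      using that by (simp add: F_map_def F_def)
    show "F_map B B' g u \<in> carrier (F B')" if "u \<in> carrier (F B)" for u
      using rep[OF that] by (auto simp: B'.F_carrier_hat hat_def)
  qed
  have pull: "(\<lambda>x\<in>C. h (g x)) \<in> St B C" if "C \<in> comm_subalgs B" "g ` C \<subseteq> D" "h \<in> St B' D" for C D h
    using B.St_pullback[OF that(1) hom_subalg_hom[OF that(1,2)] that(3)] .
  fix p assume "p \<in> comm (F B)"
  then obtain u v C f k where p: "p = (u, v)" and C: "C \<in> comm_subalgs B"
    and f: "f \<in> carrier (Func B C)" "u = F_class B C f" and k: "k \<in> carrier (Func B C)" "v = F_class B C k"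
    by (cases p) (auto simp: B.F_comm_iff hat_def)
  obtain D where D: "D \<in> comm_subalgs B'" "g ` C \<subseteq> D" using hom_image_in_subalg[OF C] .
  note hh = hom_subalg_hom[OF C D(2)]
  note im = B.Func_map_in[OF pB' C D(1) hh]
  note mc = F_map_class[OF C D]
  have "Func_map B' C D g (\<lambda>h\<in>St B C. f h + k h)
      = (\<lambda>h\<in>St B' D. Func_map B' C D g f h + Func_map B' C D g k h)"
    "Func_map B' C D g (\<lambda>h\<in>St B C. f h * k h)
      = (\<lambda>h\<in>St B' D. Func_map B' C D g f h * Func_map B' C D g k h)"
    using pull[OF C D(2)] by (auto simp: Func_map_def fun_eq_iff)
  then show "case p of (a, b) \<Rightarrow> (F_map B B' g a, F_map B B' g b) \<in> comm (F B') \<and>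
        F_map B B' g (a \<oplus>\<^bsub>F B\<^esub> b) = F_map B B' g a \<oplus>\<^bsub>F B'\<^esub> F_map B B' g b \<and>
        F_map B B' g (a \<otimes>\<^bsub>F B\<^esub> b) = F_map B B' g a \<otimes>\<^bsub>F B'\<^esub> F_map B B' g b"
    using f k im[OF f(1)] im[OF k(1)] mc[OF f(1)] mc[OF k(1)] D(1)
      mc[OF Func_closed(1)[OF f(1) k(1)]] mc[OF Func_closed(2)[OF f(1) k(1)]]
    by (auto simp: p B.F_ops[OF C] B'.F_ops[OF D(1)] B'.F_comm_iff hat_def)
next
  note pB' = pcbool_of[OF B']
  have pull: "(\<lambda>x\<in>C. h (g x)) \<in> St B C" if "C \<in> comm_subalgs B" "g ` C \<subseteq> D" "h \<in> St B' D" for C D h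
    using B.St_pullback[OF that(1) hom_subalg_hom[OF that(1,2)] that(3)] .
  {
    fix a assume "a \<in> carrier (F B)"
    then obtain C f where C: "C \<in> comm_subalgs B" and f: "f \<in> carrier (Func B C)" "a = F_class B C f"
      by (auto simp: B.F_carrier_hat hat_def)
    obtain D where D: "D \<in> comm_subalgs B'" "g ` C \<subseteq> D" using hom_image_in_subalg[OF C] .
    note im = B.Func_map_in[OF pB' C D(1) hom_subalg_hom[OF C D(2)]]
    note mc = F_map_class[OF C D]
    have "Func_map B' C D g (\<lambda>h\<in>St B C. c * f h) = (\<lambda>h\<in>St B' D. c * Func_map B' C D g f h)"
      "Func_map B' C D g (\<lambda>h\<in>St B C. cnj (f h)) = (\<lambda>h\<in>St B' D. cnj (Func_map B' C D g f h))" for c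
      using pull[OF C D(2)] by (auto simp: Func_map_def fun_eq_iff)
    then have "F_map B B' g (c \<odot>\<^bsub>F B\<^esub> a) = c \<odot>\<^bsub>F B'\<^esub> F_map B B' g a \<and>
        F_map B B' g (invol (F B) a) = invol (F B') (F_map B B' g a)" for c
      using f im[OF f(1)] mc[OF f(1)] mc[OF Func_closed(3)[OF f(1)]] mc[OF Func_closed(4)[OF f(1)]]
      by (simp add: B.F_ops[OF C] B'.F_ops[OF D(1)])
  }
  then show "F_map B B' g (c \<odot>\<^bsub>F B\<^esub> a) = c \<odot>\<^bsub>F B'\<^esub> F_map B B' g a"
    "F_map B B' g (invol (F B) a) = invol (F B') (F_map B B' g a)" if "a \<in> carrier (F B)" for a c
    using that by blast+
  obtain C where C: "C \<in> comm_subalgs B" using B.subalg_exists by blast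
  obtain D where D: "D \<in> comm_subalgs B'" "g ` C \<subseteq> D" using hom_image_in_subalg[OF C] .
  have "Func_map B' C D g (\<lambda>h\<in>St B C. 1) = (\<lambda>h\<in>St B' D. 1)"
    using pull[OF C D(2)] by (auto simp: Func_map_def fun_eq_iff)
  then show "F_map B B' g \<one>\<^bsub>F B\<^esub> = \<one>\<^bsub>F B'\<^esub>"
    using F_map_class[OF C D Func_const[where c = 1]] by (simp add: B.F_const[OF C] B'.F_const[OF D(1)])
next
  fix X assume X: "X \<subseteq> projections (F B)" "X \<times> X \<subseteq> comm (F B)"
  have "X \<subseteq> carrier (F B)" using X by (auto simp: projections_def)
  then obtain T where T: "T \<in> comm_subalgs B" "X \<subseteq> hat B T" using B.commeasurable_in_hat X(2) by metis
  then have "X \<subseteq> eta B ` T" using X(1) B.projections_hat[OF T(1)] by blast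
  then obtain Y where Y: "Y \<subseteq> T" "X = eta B ` Y" by (metis subset_imageE)
  obtain D where D: "D \<in> comm_subalgs B'" "g ` T \<subseteq> D" using hom_image_in_subalg[OF T(1)] .
  have Tc: "T \<subseteq> carrier B" using B.subalg_sub[OF T(1)] .
  have "F_map B B' g ` X = eta B' ` g ` Y"
    unfolding Y(2) image_image using Y(1) Tc by (intro image_cong) (auto simp: F_map_eta)
  moreover have "g ` Y \<subseteq> D" using Y D by auto
  moreover have "g (bjoin B Y) = bjoin B' (g ` Y)"
    using hom_subalg_hom[OF T(1) D(2)] Y(1) by (auto simp: subalg_hom_def)
  moreover have "bjoin B Y \<in> carrier B" using B.bjoin_mem[OF T(1) Y(1)] Tc by blast
  ultimately show "F_map B B' g (pjoin (F B) X) = pjoin (F B') (F_map B B' g ` X)"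
    using B.F_pjoin[OF T(1) Y(1)] B'.F_pjoin[OF D(1), of "g ` Y"] Y(2) by (simp add: F_map_eta)
qed

end

lemma F_map_ident:
  assumes B: "is_pCBool B" and id: "(\<lambda>x\<in>carrier B. x) \<in> pCBool_hom B B"
  shows "F_map B B (\<lambda>x\<in>carrier B. x) = (\<lambda>u\<in>carrier (F B). u)"
proof
  interpret pcbool B by (rule pcbool_of[OF B])
  fix u
  show "F_map B B (\<lambda>x\<in>carrier B. x) u = (\<lambda>u\<in>carrier (F B). u) u"
  proof (cases "u \<in> carrier (F B)")
    case True
    then obtain C f where C: "C \<in> comm_subalgs B" and f: "f \<in> carrier (Func B C)" "u = F_class B C f"
      by (auto simp: F_carrier_hat hat_def)
    have sub: "(\<lambda>x\<in>carrier B. x) ` C \<subseteq> C" using subalg_sub[OF C] by auto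
    have "Func_map B C C (\<lambda>x\<in>carrier B. x) f = f"
    proof (rule Func_eqI[OF _ f(1)])
      show "Func_map B C C (\<lambda>x\<in>carrier B. x) f \<in> carrier (Func B C)"
        using Func_map_in[OF pcbool_axioms C C hom_subalg_hom[OF B B id C sub] f(1)] .
      fix h assume h: "h \<in> St B C"
      have "(\<lambda>x\<in>C. h ((\<lambda>x\<in>carrier B. x) x)) = h"
        using subalg_sub[OF C] St_ext[OF h] by (auto simp: fun_eq_iff PiE_def extensional_def)
      then show "Func_map B C C (\<lambda>x\<in>carrier B. x) f h = f h" using h by (simp add: Func_map_def)
    qed
    then show ?thesis using F_map_class[OF B B id C C sub f(1)] f(2) True by simp
  qed (simp add: F_map_def F_def)
qed

lemma F_map_comp:
  assumes B: "is_pCBool B" "is_pCBool B'" "is_pCBool B''"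
    and f: "f \<in> pCBool_hom B B'" and g: "g \<in> pCBool_hom B' B''"
    and gf: "compose (carrier B) g f \<in> pCBool_hom B B''"
  shows "F_map B B'' (compose (carrier B) g f) = compose (carrier (F B)) (F_map B' B'' g) (F_map B B' f)"
proof
  interpret B: pcbool B by (rule pcbool_of[OF B(1)])
  interpret B': pcbool B' by (rule pcbool_of[OF B(2)])
  interpret B'': pcbool B'' by (rule pcbool_of[OF B(3)])
  fix u
  show "F_map B B'' (compose (carrier B) g f) u = compose (carrier (F B)) (F_map B' B'' g) (F_map B B' f) u"
  proof (cases "u \<in> carrier (F B)")
    case True
    then obtain C k where C: "C \<in> comm_subalgs B" and k: "k \<in> carrier (Func B C)" "u = F_class B C k"
      by (auto simp: B.F_carrier_hat hat_def)
    obtain D where D: "D \<in> comm_subalgs B'" "f ` C \<subseteq> D" using hom_image_in_subalg[OF B(1,2) f C] .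
    obtain E where E: "E \<in> comm_subalgs B''" "g ` D \<subseteq> E" using hom_image_in_subalg[OF B(2,3) g D(1)] .
    have sub: "compose (carrier B) g f ` C \<subseteq> E"
      using D E B.subalg_sub[OF C] by (auto simp: compose_def)
    note fk = B.Func_map_in[OF B'.pcbool_axioms C D(1) hom_subalg_hom[OF B(1,2) f C D(2)] k(1)]
    note gh = hom_subalg_hom[OF B(2,3) g D(1) E(2)]
    have "Func_map B'' D E g (Func_map B' C D f k) = Func_map B'' C E (compose (carrier B) g f) k"
    proof (rule ext)
      fix h
      show "Func_map B'' D E g (Func_map B' C D f k) h = Func_map B'' C E (compose (carrier B) g f) k h"
      proof (cases "h \<in> St B'' E")
        case True
        have "(\<lambda>x\<in>C. (\<lambda>y\<in>D. h (g y)) (f x)) = (\<lambda>x\<in>C. h (compose (carrier B) g f x))"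
          using D(2) B.subalg_sub[OF C] by (auto simp: fun_eq_iff compose_def)
        then show ?thesis using True B'.St_pullback[OF D(1) gh True] by (simp add: Func_map_def)
      qed (simp add: Func_map_def)
    qed
    then show ?thesis
      using F_map_class[OF B(1,3) gf C E(1) sub k(1)] F_map_class[OF B(1,2) f C D k(1)]
        F_map_class[OF B(2,3) g D(1) E fk] k(2) True by (simp add: compose_def)
  qed (simp add: F_map_def F_def compose_def)
qed


section \<open>Projections of a piecewise AW*-algebra\<close>

text \<open>
  The pairwise commeasurable commutative AW*-algebras from which a piecewise AW*-algebra is built.
\<close>

locale awblock = awstar A T for A :: "'a pAWstar" (structure) and T +
  assumes sub: "T \<subseteq> carrier A" and T_comm: "T \<times> T \<subseteq> comm A"
begin

abbreviation P :: "'a set" where "P \<equiv> projections A \<inter> T"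

lemma P_D:
  assumes "p \<in> P" shows P_in: "p \<in> T" and P_star: "star p = p" and P_idem: "p \<otimes> p = p"
  using assms by (auto simp: projections_def)

lemma P_I: "p \<in> T \<Longrightarrow> star p = p \<Longrightarrow> p \<otimes> p = p \<Longrightarrow> p \<in> P"
  using sub by (auto simp: projections_def)

lemma P_idem2: "p \<in> P \<Longrightarrow> a \<in> T \<Longrightarrow> p \<otimes> (p \<otimes> a) = p \<otimes> a"
  using P_D[of p] by (simp add: mult_assoc[symmetric])

lemma projections_restrict: "projections (A\<lparr>carrier := T\<rparr>) = P"
  using sub by (auto simp: projections_def)

lemma one_P: "\<one> \<in> P" and zero_P: "\<zero> \<in> P"
  by (rule P_I; simp)+

lemma neg_P: "p \<in> P \<Longrightarrow> sub \<one> p \<in> P"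
proof (rule P_I)
  assume p: "p \<in> P"
  note [simp] = P_D[OF p]
  show "sub \<one> p \<in> T" "star (sub \<one> p) = sub \<one> p" by (simp_all add: star_sub)
  show "sub \<one> p \<otimes> sub \<one> p = sub \<one> p"
    using P_in[OF p] by - (rule lincons_eqI; simp add: lin P_idem[OF p])
qed

lemma mult_P: "p \<in> P \<Longrightarrow> q \<in> P \<Longrightarrow> p \<otimes> q \<in> P"
proof (rule P_I)
  assume p: "p \<in> P" and q: "q \<in> P"
  show "p \<otimes> q \<in> T" "star (p \<otimes> q) = p \<otimes> q"
    using P_D[OF p] P_D[OF q] by (simp_all add: star_mult mult_comm)
  show "p \<otimes> q \<otimes> (p \<otimes> q) = p \<otimes> q"
    using P_in[OF p] P_in[OF q]
    by - (rule lincons_eqI; simp add: lin P_idem[OF p] P_idem[OF q] P_idem2[OF p] P_idem2[OF q])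
qed

lemma union_P: "p \<in> P \<Longrightarrow> q \<in> P \<Longrightarrow> sub (p \<oplus> q) (p \<otimes> q) \<in> P"
proof (rule P_I)
  assume p: "p \<in> P" and q: "q \<in> P"
  show "sub (p \<oplus> q) (p \<otimes> q) \<in> T" "star (sub (p \<oplus> q) (p \<otimes> q)) = sub (p \<oplus> q) (p \<otimes> q)"
    using P_D[OF p] P_D[OF q] by (simp_all add: star_mult star_add star_sub mult_comm)
  show "sub (p \<oplus> q) (p \<otimes> q) \<otimes> sub (p \<oplus> q) (p \<otimes> q) = sub (p \<oplus> q) (p \<otimes> q)"
    using P_in[OF p] P_in[OF q]
    by - (rule lincons_eqI; simp add: lin P_idem[OF p] P_idem[OF q] P_idem2[OF p] P_idem2[OF q])
qed

lemma
  assumes X: "X \<subseteq> P"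
  shows pjoin_in: "pjoin A X \<in> P"
    and pjoin_upper: "x \<in> X \<Longrightarrow> x = x \<otimes> pjoin A X"
    and pjoin_least: "z \<in> P \<Longrightarrow> (\<And>x. x \<in> X \<Longrightarrow> x = x \<otimes> z) \<Longrightarrow> pjoin A X = pjoin A X \<otimes> z"
proof -
  have l: "is_lub (proj_order (A\<lparr>carrier := T\<rparr>)) (pjoin A X) X"
    using aw X unfolding comm_AWstar_on_def by blast
  note d = l[unfolded least_def Upper_def proj_order_def, simplified, unfolded projections_restrict]
  show "pjoin A X \<in> P" using d by auto
  show "x \<in> X \<Longrightarrow> x = x \<otimes> pjoin A X" using d X by auto
  show "z \<in> P \<Longrightarrow> (\<And>x. x \<in> X \<Longrightarrow> x = x \<otimes> z) \<Longrightarrow> pjoin A X = pjoin A X \<otimes> z" using d X by blast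
qed

lemma
  assumes a: "a \<in> T"
  shows rproj_in: "rproj A a \<in> P"
    and rproj_mult: "a \<otimes> rproj A a = a"
    and rproj_least: "q \<in> P \<Longrightarrow> a \<otimes> q = a \<Longrightarrow> rproj A a = rproj A a \<otimes> q"
proof -
  have l: "is_RP (A\<lparr>carrier := T\<rparr>) a (rproj A a)"
    using aw a unfolding comm_AWstar_on_def by blast
  note d = l[unfolded is_RP_def least_def proj_order_def, simplified, unfolded projections_restrict]
  show "rproj A a \<in> P" "a \<otimes> rproj A a = a" using d by auto
  show "q \<in> P \<Longrightarrow> a \<otimes> q = a \<Longrightarrow> rproj A a = rproj A a \<otimes> q" using d by blast
qed

lemma P_antisym: "p \<in> P \<Longrightarrow> q \<in> P \<Longrightarrow> p = p \<otimes> q \<Longrightarrow> q = q \<otimes> p \<Longrightarrow> p = q"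
  using mult_comm[of p q] P_in by metis

lemma P_trans: "p \<in> P \<Longrightarrow> q \<in> P \<Longrightarrow> r \<in> P \<Longrightarrow> p = p \<otimes> q \<Longrightarrow> q = q \<otimes> r \<Longrightarrow> p = p \<otimes> r"
  using mult_assoc[of p q r] P_in by metis

lemma pjoin2:
  assumes p: "p \<in> P" and q: "q \<in> P"
  shows "pjoin A {p, q} = sub (p \<oplus> q) (p \<otimes> q)"
proof (rule P_antisym)
  let ?u = "sub (p \<oplus> q) (p \<otimes> q)"
  have X: "{p, q} \<subseteq> P" using assms by auto
  note T' = P_in[OF p] P_in[OF q]
  note idem = P_idem[OF p] P_idem[OF q] P_idem2[OF p] P_idem2[OF q]
  show j: "pjoin A {p, q} \<in> P" using pjoin_in[OF X] .
  show "?u \<in> P" using union_P[OF p q] .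
  have "p = p \<otimes> ?u" "q = q \<otimes> ?u" using T' by - (rule lincons_eqI; simp add: lin idem)+
  then show "pjoin A {p, q} = pjoin A {p, q} \<otimes> ?u"
    by (intro pjoin_least[OF X union_P[OF p q]]) auto
  let ?j = "pjoin A {p, q}"
  have pj: "p \<otimes> ?j = p" "q \<otimes> ?j = q" using pjoin_upper[OF X, of p] pjoin_upper[OF X, of q] by simp_all
  have pqj: "(p \<otimes> q) \<otimes> ?j = p \<otimes> q" using mult_assoc[OF T' P_in[OF j]] pj(2) by simp
  have "?u \<otimes> ?j = sub (p \<otimes> ?j \<oplus> q \<otimes> ?j) ((p \<otimes> q) \<otimes> ?j)"
    using T' P_in[OF j] by - (rule lincons_eqI; simp add: lin)
  then show "?u = ?u \<otimes> ?j" by (simp only: pj pqj)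
qed

lemma pjoin_empty: "pjoin A {} = \<zero>"
  using pjoin_least[of "{}" \<zero>] zero_P P_in[OF pjoin_in[of "{}"]] by simp

lemma Proj_simps:
  "bjoin (Proj A) = pjoin A" "bneg (Proj A) p = sub \<one> p" "carrier (Proj A) = projections A"
  "bcomm (Proj A) = comm A \<inter> (projections A \<times> projections A)"
  by (simp_all add: Proj_def)

lemma btop_Proj: "btop (Proj A) = \<one>"
proof -
  have "sub \<one> \<zero> = \<one>" by - (rule lincons_eqI; simp add: lin)
  then show ?thesis by (simp add: Proj_simps pjoin_empty)
qed

lemma ble_Proj: "x \<in> P \<Longrightarrow> y \<in> P \<Longrightarrow> ble (Proj A) x y \<longleftrightarrow> x = x \<otimes> y"
proof
  assume x: "x \<in> P" and y: "y \<in> P"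
  have X: "{x, y} \<subseteq> P" using x y by auto
  show "x = x \<otimes> y" if "ble (Proj A) x y"
    using pjoin_upper[OF X, of x] that by (simp add: ble_def Proj_simps)
  show "ble (Proj A) x y" if le: "x = x \<otimes> y"
    unfolding ble_def Proj_simps
  proof (rule P_antisym[OF pjoin_in[OF X] y])
    show "pjoin A {x, y} = pjoin A {x, y} \<otimes> y"
      by (rule pjoin_least[OF X y]) (use le P_idem[OF y] in auto)
    show "y = y \<otimes> pjoin A {x, y}" using pjoin_upper[OF X, of y] by simp
  qed
qed

text \<open>
  Meets are products, joins are \<open>p + q - p q\<close>, and distributivity is an identity between polynomials in idempotents.
\<close>

lemma P_Boolean: "complete_Boolean_on (Proj A) P"
proof (rule complete_Boolean_onI[where m = "(\<otimes>)"])
  fix x assume x: "x \<in> P"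
  show "ble (Proj A) x x" using x P_idem[OF x] by (simp add: ble_Proj)
  show "bneg (Proj A) x \<in> P" using neg_P[OF x] by (simp add: Proj_simps)
  have "sub (x \<oplus> sub \<one> x) (x \<otimes> sub \<one> x) = \<one>"
    using P_in[OF x] by - (rule lincons_eqI; simp add: lin P_idem[OF x])
  then show "bjoin (Proj A) {x, bneg (Proj A) x} = btop (Proj A)"
    unfolding btop_Proj using pjoin2[OF x neg_P[OF x]] by (simp add: Proj_simps)
  have "x \<otimes> sub \<one> x = \<zero>" using P_in[OF x] by - (rule lincons_eqI; simp add: lin P_idem[OF x])
  then show "x \<otimes> bneg (Proj A) x = bzero (Proj A)" by (simp add: Proj_simps pjoin_empty)
  fix y assume y: "y \<in> P"
  show "x = y" if "ble (Proj A) x y" "ble (Proj A) y x"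
    using that P_antisym[OF x y] ble_Proj[OF x y] ble_Proj[OF y x] by blast
  show "x \<otimes> y \<in> P" using mult_P[OF x y] .
  have "x \<otimes> y = x \<otimes> y \<otimes> x" "x \<otimes> y = x \<otimes> y \<otimes> y"
    using P_in[OF x] P_in[OF y]
    by - (rule lincons_eqI; simp add: lin P_idem[OF x] P_idem[OF y] P_idem2[OF x] P_idem2[OF y])+
  then show "ble (Proj A) (x \<otimes> y) x \<and> ble (Proj A) (x \<otimes> y) y"
    using ble_Proj[OF mult_P[OF x y] x] ble_Proj[OF mult_P[OF x y] y] by blast
  fix z assume z: "z \<in> P"
  show "ble (Proj A) x z" if "ble (Proj A) x y" "ble (Proj A) y z"
    using that P_trans[OF x y z] ble_Proj[OF x y] ble_Proj[OF y z] ble_Proj[OF x z] by blast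
  show "ble (Proj A) z (x \<otimes> y)" if "ble (Proj A) z x" "ble (Proj A) z y"
  proof -
    have "z = z \<otimes> x" "z = z \<otimes> y" using that ble_Proj[OF z x] ble_Proj[OF z y] by blast+
    then have "z = z \<otimes> (x \<otimes> y)" using mult_assoc[OF P_in[OF z] P_in[OF x] P_in[OF y]] by simp
    then show ?thesis using ble_Proj[OF z mult_P[OF x y]] by blast
  qed
  have "x \<otimes> sub (y \<oplus> z) (y \<otimes> z) = sub (x \<otimes> y \<oplus> x \<otimes> z) (x \<otimes> y \<otimes> (x \<otimes> z))"
    using P_in[OF x] P_in[OF y] P_in[OF z] by - (rule lincons_eqI; simp add: lin P_idem[OF x] P_idem2[OF x])
  then show "x \<otimes> bjoin (Proj A) {y, z} = bjoin (Proj A) {x \<otimes> y, x \<otimes> z}"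
    using pjoin2[OF y z] pjoin2[OF mult_P[OF x y] mult_P[OF x z]] by (simp add: Proj_simps)
next
  fix X assume X: "X \<subseteq> P"
  show "bjoin (Proj A) X \<in> P" using pjoin_in[OF X] by (simp add: Proj_simps)
  show "ble (Proj A) x (bjoin (Proj A) X)" if "x \<in> X" for x
  proof -
    have x: "x \<in> P" using that X by blast
    show ?thesis unfolding Proj_simps using ble_Proj[OF x pjoin_in[OF X]] pjoin_upper[OF X that] by blast
  qed
  fix z assume z: "z \<in> P" and up: "\<And>x. x \<in> X \<Longrightarrow> ble (Proj A) x z"
  have "pjoin A X = pjoin A X \<otimes> z"
  proof (rule pjoin_least[OF X z])
    fix x assume "x \<in> X"
    moreover from this have "x \<in> P" using X by blast
    ultimately show "x = x \<otimes> z" using up ble_Proj[OF _ z] by blast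
  qed
  then show "ble (Proj A) (bjoin (Proj A) X) z"
    unfolding Proj_simps using ble_Proj[OF pjoin_in[OF X] z] by blast
qed

lemma P_subalg: "P \<in> comm_subalgs (Proj A)"
  by (rule complete_Boolean_subalg[OF P_Boolean]) (use T_comm in \<open>auto simp: Proj_simps\<close>)

end

lemma awblock_iff: "awblock A T \<longleftrightarrow> T \<subseteq> carrier A \<and> T \<times> T \<subseteq> comm A \<and> comm_AWstar_on A T"
  by (auto simp: awblock_def awblock_axioms_def awstar_def awstar_axioms_def cstar_def comm_AWstar_on_def)

lemma awblock_exists:
  assumes "is_pAWstar A" "X \<subseteq> carrier A" "X \<times> X \<subseteq> comm A"
  shows "\<exists>T. awblock A T \<and> X \<subseteq> T"
proof -
  have "\<exists>T\<subseteq>carrier A. X \<subseteq> T \<and> T \<times> T \<subseteq> comm A \<and> comm_AWstar_on A T"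
    using assms unfolding is_pAWstar_def by blast
  then show ?thesis unfolding awblock_iff by blast
qed

lemma is_pAWstarD:
  assumes "is_pAWstar A"
  shows "comm A \<subseteq> carrier A \<times> carrier A" "a \<in> carrier A \<Longrightarrow> (a, a) \<in> comm A" "(a, b) \<in> comm A \<Longrightarrow> (b, a) \<in> comm A"
    "\<one>\<^bsub>A\<^esub> \<in> carrier A"
  using assms unfolding is_pAWstar_def is_pCstar_def sym_def by auto

lemma awblock_pair:
  assumes A: "is_pAWstar A" and ab: "(a, b) \<in> comm A"
  obtains T where "awblock A T" "a \<in> T" "b \<in> T"
proof -
  have "{a, b} \<subseteq> carrier A" "{a, b} \<times> {a, b} \<subseteq> comm A" using is_pAWstarD[OF A] ab by auto
  then show ?thesis using awblock_exists[OF A] that by (metis insert_subset)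
qed

lemma awblock_elem:
  assumes A: "is_pAWstar A" and a: "a \<in> carrier A"
  obtains T where "awblock A T" "a \<in> T"
  using awblock_pair[OF A is_pAWstarD(2)[OF A a]] by metis

lemma subalg_in_awblock:
  assumes A: "is_pAWstar A" and C: "C \<in> comm_subalgs (Proj A)"
  obtains T where "awblock A T" "C \<subseteq> projections A \<inter> T"
proof -
  have "C \<subseteq> projections A" "C \<times> C \<subseteq> comm A" using C by (auto simp: comm_subalgs_def Proj_def)
  moreover have "projections A \<subseteq> carrier A" by (auto simp: projections_def)
  ultimately obtain T where "awblock A T" "C \<subseteq> T" using awblock_exists[OF A, of C] by blast
  then show ?thesis using that \<open>C \<subseteq> projections A\<close> by blast
qed

theorem is_pCBool_Proj:
  assumes A: "is_pAWstar A"
  shows "is_pCBool (Proj A)"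
  unfolding is_pCBool_def
proof (intro conjI ballI allI impI)
  have pc: "projections A \<subseteq> carrier A" by (auto simp: projections_def)
  show "bcomm (Proj A) \<subseteq> carrier (Proj A) \<times> carrier (Proj A)" "sym (bcomm (Proj A))"
    using is_pAWstarD(3)[OF A] by (auto simp: Proj_def sym_def)
  show "(x, x) \<in> bcomm (Proj A)" if "x \<in> carrier (Proj A)" for x
    using that is_pAWstarD(2)[OF A] pc by (auto simp: Proj_def)
  show "bneg (Proj A) x \<in> carrier (Proj A)" if "x \<in> carrier (Proj A)" for x
  proof -
    have x: "x \<in> projections A" "x \<in> carrier A" using that pc by (auto simp: Proj_def)
    obtain T where T: "awblock A T" "x \<in> T" using awblock_elem[OF A x(2)] .
    then show ?thesis using awblock.neg_P[OF T(1)] x by (auto simp: Proj_def)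
  qed
  fix X assume X: "X \<subseteq> carrier (Proj A)" "X \<times> X \<subseteq> bcomm (Proj A)"
  have X': "X \<subseteq> projections A" "X \<subseteq> carrier A" "X \<times> X \<subseteq> comm A" using X pc by (auto simp: Proj_def)
  then show "bjoin (Proj A) X \<in> carrier (Proj A)" using A by (simp add: is_pAWstar_def Proj_def)
  obtain T where T: "awblock A T" "X \<subseteq> T" using awblock_exists[OF A X'(2,3)] by blast
  interpret awblock A T by (rule T(1))
  show "\<exists>T\<subseteq>carrier (Proj A). X \<subseteq> T \<and> T \<times> T \<subseteq> bcomm (Proj A) \<and> complete_Boolean_on (Proj A) T"
    by (rule exI[of _ P]) (use P_Boolean X' T T_comm in \<open>auto simp: Proj_def\<close>)
qed

lemma pAWstar_homD:
  assumes "g \<in> pAWstar_hom A A'"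
  shows "a \<in> carrier A \<Longrightarrow> g a \<in> carrier A'"
    and "(a, b) \<in> comm A \<Longrightarrow> (g a, g b) \<in> comm A'"
    and "(a, b) \<in> comm A \<Longrightarrow> g (a \<oplus>\<^bsub>A\<^esub> b) = g a \<oplus>\<^bsub>A'\<^esub> g b"
    and "(a, b) \<in> comm A \<Longrightarrow> g (a \<otimes>\<^bsub>A\<^esub> b) = g a \<otimes>\<^bsub>A'\<^esub> g b"
    and "a \<in> carrier A \<Longrightarrow> g (c \<odot>\<^bsub>A\<^esub> a) = c \<odot>\<^bsub>A'\<^esub> g a"
    and "a \<in> carrier A \<Longrightarrow> g (invol A a) = invol A' (g a)"
    and "g \<one>\<^bsub>A\<^esub> = \<one>\<^bsub>A'\<^esub>"
    and "X \<subseteq> projections A \<Longrightarrow> X \<times> X \<subseteq> comm A \<Longrightarrow> g (pjoin A X) = pjoin A' (g ` X)"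
    and "g \<in> extensional (carrier A)"
proof -
  note D = assms[unfolded pAWstar_hom_def mem_Collect_eq]
  note f = D[THEN conjunct1] and c = D[THEN conjunct2, THEN conjunct1]
    and s = D[THEN conjunct2, THEN conjunct2, THEN conjunct1]
    and i = D[THEN conjunct2, THEN conjunct2, THEN conjunct2, THEN conjunct1]
    and o = D[THEN conjunct2, THEN conjunct2, THEN conjunct2, THEN conjunct2, THEN conjunct1]
    and j = D[THEN conjunct2, THEN conjunct2, THEN conjunct2, THEN conjunct2, THEN conjunct2]
  show "a \<in> carrier A \<Longrightarrow> g a \<in> carrier A'" "g \<in> extensional (carrier A)" using f by (auto simp: PiE_iff)
  show "(a, b) \<in> comm A \<Longrightarrow> (g a, g b) \<in> comm A'" "(a, b) \<in> comm A \<Longrightarrow> g (a \<oplus>\<^bsub>A\<^esub> b) = g a \<oplus>\<^bsub>A'\<^esub> g b"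
    "(a, b) \<in> comm A \<Longrightarrow> g (a \<otimes>\<^bsub>A\<^esub> b) = g a \<otimes>\<^bsub>A'\<^esub> g b" using bspec[OF c, of "(a, b)"] by simp_all
  show "a \<in> carrier A \<Longrightarrow> g (c \<odot>\<^bsub>A\<^esub> a) = c \<odot>\<^bsub>A'\<^esub> g a" using s by simp
  show "a \<in> carrier A \<Longrightarrow> g (invol A a) = invol A' (g a)" using i by simp
  show "g \<one>\<^bsub>A\<^esub> = \<one>\<^bsub>A'\<^esub>" by (rule o)
  show "X \<subseteq> projections A \<Longrightarrow> X \<times> X \<subseteq> comm A \<Longrightarrow> g (pjoin A X) = pjoin A' (g ` X)" using j by simp
qed

lemma hom_projections:
  assumes A: "is_pAWstar A" and g: "g \<in> pAWstar_hom A A'" and p: "p \<in> projections A"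
  shows "g p \<in> projections A'"
proof -
  have p': "p \<in> carrier A" "invol A p = p" "p \<otimes>\<^bsub>A\<^esub> p = p" using p by (auto simp: projections_def)
  then show ?thesis
    using pAWstar_homD(1,6)[OF g p'(1)] pAWstar_homD(4)[OF g is_pAWstarD(2)[OF A p'(1)]]
    by (simp add: projections_def)
qed

lemma hom_in_awblock:
  assumes A': "is_pAWstar A'" and T: "awblock A T" and g: "g \<in> pAWstar_hom A A'"
  obtains T' where "awblock A' T'" "g ` T \<subseteq> T'"
proof -
  have "T \<subseteq> carrier A" "T \<times> T \<subseteq> comm A" using T by (auto simp: awblock_iff)
  then have "g ` T \<subseteq> carrier A'" "g ` T \<times> g ` T \<subseteq> comm A'"
    using pAWstar_homD(1,2)[OF g] by blast+
  then show ?thesis using awblock_exists[OF A'] that by metis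
qed

lemma Proj_map_hom:
  assumes A: "is_pAWstar A" and A': "is_pAWstar A'" and g: "g \<in> pAWstar_hom A A'"
  shows "Proj_map A A' g \<in> pCBool_hom (Proj A) (Proj A')"
  unfolding pCBool_hom_def
proof (intro CollectI conjI ballI allI impI)
  have pc: "projections A \<subseteq> carrier A" by (auto simp: projections_def)
  show "Proj_map A A' g \<in> carrier (Proj A) \<rightarrow>\<^sub>E carrier (Proj A')"
    using hom_projections[OF A g] by (auto simp: Proj_map_def Proj_def)
  fix p assume "p \<in> bcomm (Proj A)"
  then show "case p of (x, y) \<Rightarrow> (Proj_map A A' g x, Proj_map A A' g y) \<in> bcomm (Proj A')"
    using hom_projections[OF A g] pAWstar_homD(2)[OF g] by (auto simp: Proj_map_def Proj_def)
next
  have pc: "projections A \<subseteq> carrier A" by (auto simp: projections_def)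
  fix x assume x: "x \<in> carrier (Proj A)"
  have x': "x \<in> projections A" "x \<in> carrier A" using x pc by (auto simp: Proj_def)
  obtain T where T: "awblock A T" "x \<in> T" using awblock_elem[OF A x'(2)] .
  interpret awblock A T by (rule T(1))
  have "(\<one>\<^bsub>A\<^esub>, (- 1) \<odot>\<^bsub>A\<^esub> x) \<in> comm A" using T(2) T_comm by auto
  then have "g (pminus A \<one>\<^bsub>A\<^esub> x) = pminus A' \<one>\<^bsub>A'\<^esub> (g x)"
    using pAWstar_homD(3,5,7)[OF g] x' by (simp add: pminus_def)
  moreover have "pminus A \<one>\<^bsub>A\<^esub> x \<in> projections A" using neg_P[of x] x' T(2) by auto
  ultimately show "Proj_map A A' g (bneg (Proj A) x) = bneg (Proj A') (Proj_map A A' g x)"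
    using x' by (simp add: Proj_map_def Proj_def)
next
  fix X assume X: "X \<subseteq> carrier (Proj A)" "X \<times> X \<subseteq> bcomm (Proj A)"
  have X': "X \<subseteq> projections A" "X \<times> X \<subseteq> comm A" using X by (auto simp: Proj_def)
  have "Proj_map A A' g ` X = g ` X" using X'(1) by (auto simp: Proj_map_def image_iff)
  moreover have "pjoin A X \<in> projections A" using A X' by (simp add: is_pAWstar_def)
  ultimately show "Proj_map A A' g (bjoin (Proj A) X) = bjoin (Proj A') (Proj_map A A' g ` X)"
    using pAWstar_homD(8)[OF g X'] by (simp add: Proj_map_def Proj_def)
qed

section \<open>Intersections of commutative AW*-algebras\<close>

text \<open>
  Limits are unique in the whole piecewise algebra, so the limits formed in the two algebras coincide.
\<close>

lemma cstar_Int: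
  assumes T: "cstar A T" and T': "cstar A T'"
  shows "cstar A (T \<inter> T')"
proof -
  interpret T: cstar A T by (rule T)
  interpret T': cstar A T' by (rule T')
  have "algebra complex_ring (A\<lparr>carrier := T \<inter> T'\<rparr>)"
  proof (rule algebra_complexI)
    show "a \<oplus>\<^bsub>A\<^esub> b = b \<oplus>\<^bsub>A\<^esub> a" "a \<otimes>\<^bsub>A\<^esub> b = b \<otimes>\<^bsub>A\<^esub> a" if "a \<in> T \<inter> T'" "b \<in> T \<inter> T'" for a b
      using T.add_comm[of a b] T.mult_comm[of a b] that by auto
    show "(- 1) \<odot>\<^bsub>A\<^esub> a \<oplus>\<^bsub>A\<^esub> a = \<zero>\<^bsub>A\<^esub>" if "a \<in> T \<inter> T'" for a
      using that by - (rule T.lincons_eqI; simp add: T.lin)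
  qed (simp_all add: T.add_assoc T.mult_assoc T.distr_l T.scal_distr T.scal_add T.scal_scal T.scal_mult_l)
  moreover have "\<exists>x\<in>T \<inter> T'. norm_limit A s x \<and> (\<forall>y. norm_limit A s y \<longrightarrow> y = x)"
    if s: "range s \<subseteq> T \<inter> T'" "\<forall>e>0. \<exists>N. \<forall>m\<ge>N. \<forall>n\<ge>N. cnorm A (pminus A (s m) (s n)) < e" for s
  proof -
    obtain x where x: "x \<in> T" "norm_limit A s x" "\<And>y. norm_limit A s y \<Longrightarrow> y = x"
      using T.complete[OF _ s(2)] s(1) by blast
    obtain y where y: "y \<in> T'" "norm_limit A s y" using T'.complete[OF _ s(2)] s(1) by blast
    then show ?thesis using x by blast
  qed
  ultimately show ?thesis
    unfolding cstar_def comm_Cstar_on_def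
    by (auto simp: T.star_add T.star_mult T.star_scal T.nrm_ge T.nrm_zero_iff T.nrm_add T.nrm_scal
        T.nrm_mult T.nrm_cstar)
qed

text \<open>
  The annihilator of a set is generated by the complement of the join of the right projections of its
  elements, and this projection lies in both algebras.
\<close>

lemma awblock_Int:
  assumes T: "awblock A T" and T': "awblock A T'"
  shows "awblock A (T \<inter> T')"
proof -
  interpret T: awblock A T by (rule T)
  interpret T': awblock A T' by (rule T')
  let ?S = "T \<inter> T'"
  interpret S: cstar A ?S by (rule cstar_Int[OF T.cstar_axioms T'.cstar_axioms])
  have pr: "projections (A\<lparr>carrier := ?S\<rparr>) = projections A \<inter> ?S"
    using T.sub by (auto simp: projections_def)
  have ann: "\<exists>p\<in>projections A \<inter> ?S.
      {b\<in>?S. \<forall>x\<in>X. x \<otimes>\<^bsub>A\<^esub> b = \<zero>\<^bsub>A\<^esub>} = {p \<otimes>\<^bsub>A\<^esub> c | c. c \<in> ?S}" if X: "X \<subseteq> ?S" for X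
  proof -
    have RT: "rproj A ` X \<subseteq> T.P" "rproj A ` X \<subseteq> T'.P" using T.rproj_in T'.rproj_in X by blast+
    define q where "q = pjoin A (rproj A ` X)"
    have q: "q \<in> T.P" "q \<in> T'.P" using T.pjoin_in[OF RT(1)] T'.pjoin_in[OF RT(2)] by (auto simp: q_def)
    let ?p = "pminus A \<one>\<^bsub>A\<^esub> q"
    have p: "?p \<in> projections A \<inter> ?S" using T.neg_P[OF q(1)] T'.neg_P[OF q(2)] by auto
    note qT = T.P_in[OF q(1)]
    have "{b\<in>?S. \<forall>x\<in>X. x \<otimes>\<^bsub>A\<^esub> b = \<zero>\<^bsub>A\<^esub>} = {?p \<otimes>\<^bsub>A\<^esub> c | c. c \<in> ?S}"
    proof (intro equalityI subsetI)
      fix b assume b: "b \<in> {b\<in>?S. \<forall>x\<in>X. x \<otimes>\<^bsub>A\<^esub> b = \<zero>\<^bsub>A\<^esub>}"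
      have "X \<subseteq> T" using X by blast
      then obtain r where r0: "r \<in> projections A" "r \<in> T"
        "{b\<in>T. \<forall>x\<in>X. x \<otimes>\<^bsub>A\<^esub> b = \<zero>\<^bsub>A\<^esub>} = {r \<otimes>\<^bsub>A\<^esub> c | c. c \<in> T}"
        by (rule T.annihilator)
      then have r: "r \<in> T.P"
        "{b\<in>T. \<forall>x\<in>X. x \<otimes>\<^bsub>A\<^esub> b = \<zero>\<^bsub>A\<^esub>} = {r \<otimes>\<^bsub>A\<^esub> c | c. c \<in> T}" by auto
      note rT = T.P_in[OF r(1)]
      have "r \<in> {r \<otimes>\<^bsub>A\<^esub> c | c. c \<in> T}" using T.P_idem[OF r(1)] rT by (intro CollectI exI[of _ r]) simp
      then have xr: "x \<otimes>\<^bsub>A\<^esub> r = \<zero>\<^bsub>A\<^esub>" if "x \<in> X" for x using r(2) that by blast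
      have "q = q \<otimes>\<^bsub>A\<^esub> pminus A \<one>\<^bsub>A\<^esub> r"
        unfolding q_def
      proof (rule T.pjoin_least[OF RT(1) T.neg_P[OF r(1)]])
        fix y assume "y \<in> rproj A ` X"
        then obtain x where x: "x \<in> X" "y = rproj A x" by blast
        have xT: "x \<in> T" using x X by blast
        have "x \<otimes>\<^bsub>A\<^esub> pminus A \<one>\<^bsub>A\<^esub> r = pminus A x (x \<otimes>\<^bsub>A\<^esub> r)"
          using xT rT by - (rule T.lincons_eqI; simp add: T.lin)
        also have "\<dots> = x" unfolding xr[OF x(1)] using xT by - (rule T.lincons_eqI; simp add: T.lin)
        finally show "y = y \<otimes>\<^bsub>A\<^esub> pminus A \<one>\<^bsub>A\<^esub> r"
          using T.rproj_least[OF xT T.neg_P[OF r(1)]] x(2) by simp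
      qed
      moreover have "q \<otimes>\<^bsub>A\<^esub> pminus A \<one>\<^bsub>A\<^esub> r \<otimes>\<^bsub>A\<^esub> r = \<zero>\<^bsub>A\<^esub>"
        using qT rT by - (rule T.lincons_eqI; simp add: T.lin T.P_idem[OF r(1)])
      ultimately have qr: "q \<otimes>\<^bsub>A\<^esub> r = \<zero>\<^bsub>A\<^esub>" by simp
      have "b \<in> {r \<otimes>\<^bsub>A\<^esub> c | c. c \<in> T}" using b r(2) by blast
      then obtain c where c: "c \<in> T" "b = r \<otimes>\<^bsub>A\<^esub> c" by blast
      have "q \<otimes>\<^bsub>A\<^esub> b = \<zero>\<^bsub>A\<^esub>" using T.mult_assoc[OF qT rT c(1)] qr c by simp
      moreover have "?p \<otimes>\<^bsub>A\<^esub> b = pminus A b (q \<otimes>\<^bsub>A\<^esub> b)"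
        using b qT by - (rule T.lincons_eqI; simp add: T.lin)
      moreover have "pminus A b \<zero>\<^bsub>A\<^esub> = b" using b by - (rule T.lincons_eqI; simp add: T.lin)
      ultimately have "b = ?p \<otimes>\<^bsub>A\<^esub> b" by simp
      then show "b \<in> {?p \<otimes>\<^bsub>A\<^esub> c | c. c \<in> ?S}" using b by blast
    next
      fix b assume "b \<in> {?p \<otimes>\<^bsub>A\<^esub> c | c. c \<in> ?S}"
      then obtain c where c: "c \<in> ?S" "b = ?p \<otimes>\<^bsub>A\<^esub> c" by blast
      have "x \<otimes>\<^bsub>A\<^esub> b = \<zero>\<^bsub>A\<^esub>" if x: "x \<in> X" for x
      proof -
        have xT: "x \<in> T" using x X by blast
        have rT: "rproj A x \<in> T" using T.P_in[OF T.rproj_in[OF xT]] .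
        have rq: "rproj A x = rproj A x \<otimes>\<^bsub>A\<^esub> q"
          unfolding q_def by (rule T.pjoin_upper[OF RT(1)]) (use x in blast)
        have "x \<otimes>\<^bsub>A\<^esub> q = x \<otimes>\<^bsub>A\<^esub> rproj A x \<otimes>\<^bsub>A\<^esub> q" using T.rproj_mult[OF xT] by simp
        also have "\<dots> = x \<otimes>\<^bsub>A\<^esub> (rproj A x \<otimes>\<^bsub>A\<^esub> q)" using T.mult_assoc[OF xT rT qT] .
        also have "\<dots> = x" unfolding rq[symmetric] using T.rproj_mult[OF xT] .
        finally have xq: "x \<otimes>\<^bsub>A\<^esub> q = x" .
        have "x \<otimes>\<^bsub>A\<^esub> b = pminus A x (x \<otimes>\<^bsub>A\<^esub> q) \<otimes>\<^bsub>A\<^esub> c"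
          unfolding c(2) using c(1) xT qT by - (rule T.lincons_eqI; simp add: T.lin)
        then show ?thesis unfolding xq using xT c(1) by simp
      qed
      moreover have "b \<in> ?S" using c p S.mult_in[of ?p c] by auto
      ultimately show "b \<in> {b\<in>?S. \<forall>x\<in>X. x \<otimes>\<^bsub>A\<^esub> b = \<zero>\<^bsub>A\<^esub>}" by blast
    qed
    then show ?thesis using p by blast
  qed
  have rp: "is_RP (A\<lparr>carrier := ?S\<rparr>) a (rproj A a)" if a: "a \<in> ?S" for a
  proof -
    have aT: "a \<in> T" "a \<in> T'" using a by auto
    show ?thesis
      unfolding is_RP_def least_def proj_order_def pr
      using T.rproj_in[OF aT(1)] T'.rproj_in[OF aT(2)] T.rproj_mult[OF aT(1)] T.rproj_least[OF aT(1)] by auto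
  qed
  have lub: "is_lub (proj_order (A\<lparr>carrier := ?S\<rparr>)) (pjoin A X) X" if X: "X \<subseteq> projections A \<inter> ?S" for X
  proof -
    have XT: "X \<subseteq> T.P" "X \<subseteq> T'.P" using X by auto
    show ?thesis
      unfolding least_def Upper_def proj_order_def
      using T.pjoin_in[OF XT(1)] T'.pjoin_in[OF XT(2)] T.pjoin_upper[OF XT(1)] T.pjoin_least[OF XT(1)] X
      by (simp add: pr subset_iff)
  qed
  have "comm_AWstar_on A ?S"
    unfolding comm_AWstar_on_def using S.cstar_on ann rp lub by blast
  then show ?thesis using T.sub T.T_comm by (auto simp: awblock_iff)
qed


lemma inverse_Suc_small:
  fixes e :: real assumes "e > 0"
  shows "\<exists>N. \<forall>n\<ge>N. inverse (real (Suc n)) < e"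
proof -
  obtain N where N: "inverse (real (Suc N)) < e" using reals_Archimedean[OF assms] by blast
  have "inverse (real (Suc n)) \<le> inverse (real (Suc N))" if "n \<ge> N" for n
    using that by (intro le_imp_inverse_le) auto
  then show ?thesis using N by (meson le_less_trans)
qed

section \<open>The Gelfand transform of a commutative AW*-algebra\<close>

context awblock
begin

lemma nrm_P: "p \<in> P \<Longrightarrow> nrm p \<le> 1"
  using nrm_idem_le P_D by blast

lemma nrm_cut: "p \<in> P \<Longrightarrow> a \<in> T \<Longrightarrow> nrm (a \<otimes> p) \<le> nrm a"
  using nrm_mult[of a p] nrm_P[of p] mult_left_mono[of "nrm p" 1 "nrm a"] nrm_ge[of a] P_in[of p] by simp

text \<open>
  The character of the algebra that extends the Boolean homomorphism \<open>h\<close> takes the value \<open>z\<close> at \<open>a\<close>: near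
  the point \<open>h\<close>, that is, cut down to some projection on which \<open>h\<close> is true, \<open>a\<close> is close to the scalar \<open>z\<close>.
\<close>

definition char_at :: "('a \<Rightarrow> bool) \<Rightarrow> 'a \<Rightarrow> complex \<Rightarrow> bool" where
  "char_at h a z \<longleftrightarrow> (\<forall>e>0. \<exists>p\<in>P. h p \<and> nrm (sub a (z \<odot> \<one>) \<otimes> p) < e)"

definition gelf :: "'a \<Rightarrow> 'a cfun" where
  "gelf a = (\<lambda>h\<in>St (Proj A) P. THE z. char_at h a z)"

context
  fixes h assumes h: "h \<in> St (Proj A) P"
begin

lemma h_neg: "p \<in> P \<Longrightarrow> h (sub \<one> p) \<longleftrightarrow> \<not> h p"
  using St_neg[OF h] by (simp add: Proj_simps)

lemma h_zero: "\<not> h \<zero>"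
  using St_zero[OF h] by (simp add: Proj_simps pjoin_empty)

lemma h_one: "h \<one>"
  using h_neg[OF zero_P] h_zero btop_Proj by (simp add: Proj_simps pjoin_empty)

lemma h_mult:
  assumes p: "p \<in> P" and q: "q \<in> P"
  shows "h (p \<otimes> q) \<longleftrightarrow> h p \<and> h q"
proof -
  note n = neg_P[OF p] neg_P[OF q]
  have "sub \<one> (pjoin A {sub \<one> p, sub \<one> q}) = p \<otimes> q"
    unfolding pjoin2[OF n] using P_in[OF p] P_in[OF q] by - (rule lincons_eqI; simp add: lin)
  moreover have "pjoin A {sub \<one> p, sub \<one> q} \<in> P" using pjoin_in n by simp
  ultimately have "h (p \<otimes> q) \<longleftrightarrow> \<not> h (pjoin A {sub \<one> p, sub \<one> q})" using h_neg by metis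
  also have "\<dots> \<longleftrightarrow> h p \<and> h q"
    using St_join[OF h n] h_neg[OF p] h_neg[OF q] by (simp add: Proj_simps)
  finally show ?thesis .
qed

lemma nrm_P_eq: "p \<in> P \<Longrightarrow> h p \<Longrightarrow> nrm p = 1"
proof -
  assume p: "p \<in> P" "h p"
  then have "p \<noteq> \<zero>" using h_zero by auto
  then have "nrm p \<noteq> 0" using nrm_zero_iff P_in[OF p(1)] by blast
  moreover have "nrm p = nrm p * nrm p"
    using nrm_sa[of p] P_D[OF p(1)] by (simp add: power2_eq_square)
  ultimately show ?thesis by simp
qed

lemma char_atE:
  assumes "char_at h a z" "e > 0"
  obtains p where "p \<in> P" "h p" "nrm (sub a (z \<odot> \<one>) \<otimes> p) < e"
  using assms unfolding char_at_def by blast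

lemma char_at_bound:
  assumes a: "a \<in> T" and z: "char_at h a z"
  shows "cmod z \<le> nrm a"
proof (rule field_le_epsilon)
  fix e :: real assume "e > 0"
  then obtain p where p: "p \<in> P" "h p" "nrm (sub a (z \<odot> \<one>) \<otimes> p) < e" using char_atE[OF z] by blast
  have "z \<odot> p = sub (a \<otimes> p) (sub a (z \<odot> \<one>) \<otimes> p)"
    using a P_in[OF p(1)] by - (rule lincons_eqI; simp add: lin)
  then have "cmod z * nrm p \<le> nrm (a \<otimes> p) + nrm (sub a (z \<odot> \<one>) \<otimes> p)"
    using nrm_sub_le[of "a \<otimes> p" "sub a (z \<odot> \<one>) \<otimes> p"] a P_in[OF p(1)] by (metis mult_in nrm_scal one_in scal_in sub_in)
  then show "cmod z \<le> nrm a + e" using p nrm_P_eq[OF p(1,2)] nrm_cut[OF p(1) a] by simp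
qed

lemma char_at_add:
  assumes a: "a \<in> T" "char_at h a z" and b: "b \<in> T" "char_at h b w"
  shows "char_at h (a \<oplus> b) (z + w)"
  unfolding char_at_def
proof (intro allI impI)
  fix e :: real assume e: "e > 0"
  obtain p where p: "p \<in> P" "h p" "nrm (sub a (z \<odot> \<one>) \<otimes> p) < e/2" using char_atE[OF a(2), of "e/2"] e by auto
  obtain q where q: "q \<in> P" "h q" "nrm (sub b (w \<odot> \<one>) \<otimes> q) < e/2" using char_atE[OF b(2), of "e/2"] e by auto
  note T' = P_in[OF p(1)] P_in[OF q(1)]
  have "sub (a \<oplus> b) ((z + w) \<odot> \<one>) \<otimes> (p \<otimes> q)
      = (sub a (z \<odot> \<one>) \<otimes> p) \<otimes> q \<oplus> (sub b (w \<odot> \<one>) \<otimes> q) \<otimes> p"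
    using a(1) b(1) T' by - (rule lincons_eqI; simp add: lin algebra_simps)
  then have "nrm (sub (a \<oplus> b) ((z + w) \<odot> \<one>) \<otimes> (p \<otimes> q))
      \<le> nrm ((sub a (z \<odot> \<one>) \<otimes> p) \<otimes> q) + nrm ((sub b (w \<odot> \<one>) \<otimes> q) \<otimes> p)"
    using nrm_add a(1) b(1) T' by simp
  also have "\<dots> < e"
    using nrm_cut[OF q(1), of "sub a (z \<odot> \<one>) \<otimes> p"] nrm_cut[OF p(1), of "sub b (w \<odot> \<one>) \<otimes> q"] p q a(1) b(1) T'
    by simp
  finally show "\<exists>r\<in>P. h r \<and> nrm (sub (a \<oplus> b) ((z + w) \<odot> \<one>) \<otimes> r) < e"
    using mult_P[OF p(1) q(1)] h_mult[OF p(1) q(1)] p q by blast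
qed

lemma char_at_mult:
  assumes a: "a \<in> T" "char_at h a z" and b: "b \<in> T" "char_at h b w"
  shows "char_at h (a \<otimes> b) (z * w)"
  unfolding char_at_def
proof (intro allI impI)
  fix e :: real assume e: "e > 0"
  define K where "K = nrm a + nrm b + 1"
  have K: "K > 0" "nrm b \<le> K" "cmod z \<le> K"
    using nrm_ge[OF a(1)] nrm_ge[OF b(1)] char_at_bound[OF a] by (auto simp: K_def)
  define d where "d = e / (2 * K)"
  have d: "d > 0" "K * d + K * d = e" using e K by (auto simp: d_def field_simps)
  obtain p where p: "p \<in> P" "h p" "nrm (sub a (z \<odot> \<one>) \<otimes> p) < d" using char_atE[OF a(2) d(1)] .
  obtain q where q: "q \<in> P" "h q" "nrm (sub b (w \<odot> \<one>) \<otimes> q) < d" using char_atE[OF b(2) d(1)] .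
  note T' = P_in[OF p(1)] P_in[OF q(1)]
  have "sub (a \<otimes> b) ((z * w) \<odot> \<one>) \<otimes> (p \<otimes> q)
      = b \<otimes> ((sub a (z \<odot> \<one>) \<otimes> p) \<otimes> q) \<oplus> z \<odot> ((sub b (w \<odot> \<one>) \<otimes> q) \<otimes> p)"
    using a(1) b(1) T' by - (rule lincons_eqI; simp add: lin algebra_simps)
  then have "nrm (sub (a \<otimes> b) ((z * w) \<odot> \<one>) \<otimes> (p \<otimes> q))
      \<le> nrm (b \<otimes> ((sub a (z \<odot> \<one>) \<otimes> p) \<otimes> q)) + nrm (z \<odot> ((sub b (w \<odot> \<one>) \<otimes> q) \<otimes> p))"
    using nrm_add a(1) b(1) T' by simp
  also have "\<dots> \<le> nrm b * nrm ((sub a (z \<odot> \<one>) \<otimes> p) \<otimes> q) + cmod z * nrm ((sub b (w \<odot> \<one>) \<otimes> q) \<otimes> p)"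
    using nrm_mult[of b "(sub a (z \<odot> \<one>) \<otimes> p) \<otimes> q"] a(1) b(1) T' by (simp add: nrm_scal)
  also have "\<dots> \<le> K * nrm (sub a (z \<odot> \<one>) \<otimes> p) + K * nrm (sub b (w \<odot> \<one>) \<otimes> q)"
    using nrm_cut[OF q(1), of "sub a (z \<odot> \<one>) \<otimes> p"] nrm_cut[OF p(1), of "sub b (w \<odot> \<one>) \<otimes> q"] K
      a(1) b(1) T' nrm_ge by (intro add_mono mult_mono) auto
  also have "\<dots> < K * d + K * d" using p q K by (intro add_strict_mono mult_strict_left_mono) auto
  finally show "\<exists>r\<in>P. h r \<and> nrm (sub (a \<otimes> b) ((z * w) \<odot> \<one>) \<otimes> r) < e"
    using mult_P[OF p(1) q(1)] h_mult[OF p(1) q(1)] p q d(2) by auto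
qed

lemma char_at_proj:
  assumes p: "p \<in> P" shows "char_at h p (if h p then 1 else 0)"
proof (cases "h p")
  case True
  have "sub p (1 \<odot> \<one>) \<otimes> p = \<zero>" using P_in[OF p] by - (rule lincons_eqI; simp add: lin P_idem[OF p])
  then show ?thesis unfolding char_at_def using True p by (auto intro!: bexI[of _ p])
next
  case False
  have "sub p (0 \<odot> \<one>) \<otimes> sub \<one> p = \<zero>" using P_in[OF p] by - (rule lincons_eqI; simp add: lin P_idem[OF p])
  then show ?thesis unfolding char_at_def using False neg_P[OF p] h_neg[OF p] by (auto intro!: bexI[of _ "sub \<one> p"])
qed

lemma char_at_const: "char_at h (z \<odot> \<one>) z"
  unfolding char_at_def using one_P h_one by (auto intro!: bexI[of _ \<one>])

lemma char_at_scal: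
  assumes "a \<in> T" "char_at h a z" shows "char_at h (c \<odot> a) (c * z)"
proof -
  have "(c \<odot> \<one>) \<otimes> a = c \<odot> a" using assms by - (rule lincons_eqI; simp add: lin)
  then show ?thesis using char_at_mult[OF _ char_at_const assms, of c] by simp
qed

lemma char_at_sub:
  assumes a: "a \<in> T" "char_at h a z" and b: "b \<in> T" "char_at h b w"
  shows "char_at h (sub a b) (z - w)"
  using char_at_add[OF a _ char_at_scal[OF b, of "-1"]] b(1) by (simp add: pminus_def)

lemma char_at_star:
  assumes a: "a \<in> T" "char_at h a z" shows "char_at h (star a) (cnj z)"
  unfolding char_at_def
proof (intro allI impI)
  fix e :: real assume "e > 0"
  then obtain p where p: "p \<in> P" "h p" "nrm (sub a (z \<odot> \<one>) \<otimes> p) < e" using char_atE[OF a(2)] by blast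
  have "sub (star a) (cnj z \<odot> \<one>) \<otimes> p = star (sub a (z \<odot> \<one>) \<otimes> p)"
    using a(1) P_D[OF p(1)] by (simp add: star_mult star_sub star_scal mult_comm)
  then have "nrm (sub (star a) (cnj z \<odot> \<one>) \<otimes> p) < e" using p a(1) P_in[OF p(1)] by simp
  then show "\<exists>p\<in>P. h p \<and> nrm (sub (star a) (cnj z \<odot> \<one>) \<otimes> p) < e" using p by blast
qed

lemma char_at_unique:
  assumes "a \<in> T" "char_at h a z" "char_at h a w" shows "z = w"
  using char_at_bound[OF _ char_at_sub[OF assms(1,2,1,3)]] assms(1) by simp

text \<open>Every element has a value, because projections do and the elements having one form a closed subspace.\<close>

lemma char_at_exists:
  assumes "a \<in> T" obtains z where "char_at h a z"
proof -
  define R where "R = {a\<in>T. \<exists>z. char_at h a z}"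
  have "R = T"
  proof (rule projections_dense)
    show "R \<subseteq> T" by (auto simp: R_def)
    show "P \<subseteq> R" using char_at_proj by (auto simp: R_def)
    show "\<one> \<in> R" using char_at_proj[OF one_P] by (auto simp: R_def)
    show "a \<oplus> b \<in> R" if ab: "a \<in> R" "b \<in> R" for a b
    proof -
      obtain z w where "a \<in> T" "char_at h a z" "b \<in> T" "char_at h b w"
        using ab unfolding R_def by blast
      then show ?thesis using char_at_add[of a z b w] unfolding R_def by auto
    qed
    show "c \<odot> a \<in> R" if "a \<in> R" for a c
      using that char_at_scal by (auto simp: R_def)
    fix a assume a: "a \<in> T" and app: "\<And>e. e > 0 \<Longrightarrow> \<exists>b\<in>R. nrm (sub a b) < e"
    have "\<forall>n::nat. \<exists>b z. b \<in> T \<and> char_at h b z \<and> nrm (sub a b) < inverse (real (Suc n))"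
      using app[of "inverse (real (Suc _))"] by (auto simp: R_def)
    then obtain b z where b: "\<And>n. b n \<in> T" "\<And>n. char_at h (b n) (z n)"
      "\<And>n::nat. nrm (sub a (b n)) < inverse (real (Suc n))" by metis
    have zz: "dist (z m) (z n) < inverse (real (Suc m)) + inverse (real (Suc n))" for m n
    proof -
      have "cmod (z m - z n) \<le> nrm (sub (b m) (b n))"
        using char_at_bound[OF _ char_at_sub[OF b(1,2) b(1,2)]] b(1) by simp
      also have "\<dots> \<le> nrm (sub a (b m)) + nrm (sub a (b n))"
        using nrm_triangle[OF b(1) a b(1), of m n] nrm_sub_commute[OF a b(1), of m] by simp
      also have "\<dots> < inverse (real (Suc m)) + inverse (real (Suc n))" by (intro add_strict_mono b(3))
      finally show ?thesis by (simp add: dist_norm)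
    qed
    have "Cauchy z"
      unfolding Cauchy_def
    proof (intro allI impI)
      fix e :: real assume e: "e > 0"
      then obtain N where N: "\<And>m. m \<ge> N \<Longrightarrow> inverse (real (Suc m)) < e/2"
        using inverse_Suc_small[of "e/2"] by auto
      then have "dist (z m) (z n) < e" if "m \<ge> N" "n \<ge> N" for m n
        using zz[of m n] N[OF that(1)] N[OF that(2)] by linarith
      then show "\<exists>M. \<forall>m\<ge>M. \<forall>n\<ge>M. dist (z m) (z n) < e" by blast
    qed
    then obtain w where w: "z \<longlonglongrightarrow> w" using Cauchy_convergent_iff convergent_def by blast
    have "char_at h a w"
      unfolding char_at_def
    proof (intro allI impI)
      fix e :: real assume e: "e > 0"
      obtain N1 where N1: "\<And>n. n \<ge> N1 \<Longrightarrow> dist (z n) w < e/3"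
        using metric_LIMSEQ_D[OF w, of "e/3"] e by auto
      obtain N2 where N2: "\<And>n. n \<ge> N2 \<Longrightarrow> inverse (real (Suc n)) < e/3"
        using inverse_Suc_small[of "e/3"] e by auto
      define n where "n = max N1 N2"
      have n1: "cmod (z n - w) < e/3" using N1[of n] by (simp add: n_def dist_norm)
      have n2: "nrm (sub a (b n)) < e/3"
        using b(3)[of n] N2[of n] unfolding n_def by (meson less_trans max.cobounded2)
      obtain p where p: "p \<in> P" "h p" "nrm (sub (b n) (z n \<odot> \<one>) \<otimes> p) < e/3"
        using char_atE[OF b(2), of "e/3" n] e by auto
      note pT = P_in[OF p(1)]
      let ?x = "sub a (b n) \<otimes> p" and ?y = "sub (b n) (z n \<odot> \<one>) \<otimes> p" and ?z = "(z n - w) \<odot> p"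
      have "sub a (w \<odot> \<one>) \<otimes> p = ?x \<oplus> (?y \<oplus> ?z)"
        using a b(1) pT by - (rule lincons_eqI; simp add: lin)
      then have "nrm (sub a (w \<odot> \<one>) \<otimes> p) \<le> nrm ?x + (nrm ?y + nrm ?z)"
        using nrm_add[of ?x "?y \<oplus> ?z"] nrm_add[of ?y ?z] a b(1) pT by simp
      moreover have "nrm ?x < e/3" using nrm_cut[OF p(1), of "sub a (b n)"] n2 a b(1) by simp
      moreover have "nrm ?z < e/3" using nrm_P_eq[OF p(1,2)] n1 pT by (simp add: nrm_scal)
      ultimately show "\<exists>p\<in>P. h p \<and> nrm (sub a (w \<odot> \<one>) \<otimes> p) < e" using p by (intro bexI[of _ p]) auto
    qed
    then show "a \<in> R" using a by (auto simp: R_def)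
  qed
  then show ?thesis using that assms by (auto simp: R_def)
qed

lemma gelf_char_at: "a \<in> T \<Longrightarrow> char_at h a (gelf a h)"
proof -
  assume a: "a \<in> T"
  then obtain z where z: "char_at h a z" using char_at_exists by blast
  have "(THE z. char_at h a z) = z" by (rule the_equality) (use z char_at_unique[OF a z] in blast)+
  then show ?thesis using z h by (simp add: gelf_def)
qed

lemma gelf_eqI: "a \<in> T \<Longrightarrow> char_at h a z \<Longrightarrow> gelf a h = z"
  using char_at_unique gelf_char_at by blast

end

lemma gelf_ext: "gelf a \<in> extensional (St (Proj A) P)"
  by (simp add: gelf_def)

lemma gelf_hom:
  assumes a: "a \<in> T" and b: "b \<in> T"
  shows "gelf (a \<oplus> b) = (\<lambda>h\<in>St (Proj A) P. gelf a h + gelf b h)"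
    and "gelf (a \<otimes> b) = (\<lambda>h\<in>St (Proj A) P. gelf a h * gelf b h)"
    and "gelf (c \<odot> a) = (\<lambda>h\<in>St (Proj A) P. c * gelf a h)"
    and "gelf (star a) = (\<lambda>h\<in>St (Proj A) P. cnj (gelf a h))"
    and "gelf (sub a b) = (\<lambda>h\<in>St (Proj A) P. gelf a h - gelf b h)"
proof -
  note g = gelf_char_at
  have *: "gelf x = (\<lambda>h\<in>St (Proj A) P. f h)" if "\<And>h. h \<in> St (Proj A) P \<Longrightarrow> gelf x h = f h" for x f
    by (rule extensionalityI[OF gelf_ext]) (use that in auto)
  show "gelf (a \<oplus> b) = (\<lambda>h\<in>St (Proj A) P. gelf a h + gelf b h)"
  proof (rule *)
    fix h assume h: "h \<in> St (Proj A) P"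
    show "gelf (a \<oplus> b) h = gelf a h + gelf b h"
      by (rule gelf_eqI[OF h _ char_at_add[OF h a g[OF h a] b g[OF h b]]]) (use a b in simp)
  qed
  show "gelf (a \<otimes> b) = (\<lambda>h\<in>St (Proj A) P. gelf a h * gelf b h)"
  proof (rule *)
    fix h assume h: "h \<in> St (Proj A) P"
    show "gelf (a \<otimes> b) h = gelf a h * gelf b h"
      by (rule gelf_eqI[OF h _ char_at_mult[OF h a g[OF h a] b g[OF h b]]]) (use a b in simp)
  qed
  show "gelf (c \<odot> a) = (\<lambda>h\<in>St (Proj A) P. c * gelf a h)"
  proof (rule *)
    fix h assume h: "h \<in> St (Proj A) P"
    show "gelf (c \<odot> a) h = c * gelf a h"
      by (rule gelf_eqI[OF h _ char_at_scal[OF h a g[OF h a]]]) (use a b in simp)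
  qed
  show "gelf (star a) = (\<lambda>h\<in>St (Proj A) P. cnj (gelf a h))"
  proof (rule *)
    fix h assume h: "h \<in> St (Proj A) P"
    show "gelf (star a) h = cnj (gelf a h)"
      by (rule gelf_eqI[OF h _ char_at_star[OF h a g[OF h a]]]) (use a b in simp)
  qed
  show "gelf (sub a b) = (\<lambda>h\<in>St (Proj A) P. gelf a h - gelf b h)"
  proof (rule *)
    fix h assume h: "h \<in> St (Proj A) P"
    show "gelf (sub a b) h = gelf a h - gelf b h"
      by (rule gelf_eqI[OF h _ char_at_sub[OF h a g[OF h a] b g[OF h b]]]) (use a b in simp)
  qed
qed

lemma gelf_proj: "p \<in> P \<Longrightarrow> gelf p = chi (Proj A) P p"
proof (rule extensionalityI[OF gelf_ext])
  assume p: "p \<in> P"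
  show "chi (Proj A) P p \<in> extensional (St (Proj A) P)" by (simp add: chi_def)
  fix h assume h: "h \<in> St (Proj A) P"
  show "gelf p h = chi (Proj A) P p h"
    using gelf_eqI[OF h P_in[OF p] char_at_proj[OF h p]] h by (simp add: chi_def)
qed

end

locale pawblock = awblock A T for A :: "'a pAWstar" (structure) and T +
  assumes paw: "is_pAWstar A"
begin

sublocale B: pcbool "Proj A"
  by (rule pcbool_of) (rule is_pCBool_Proj[OF paw])

text \<open>
  The projection that witnesses the value at \<open>h\<close> up to \<open>e\<close> also bounds the difference to the values at all points
  where it is true, so it is the required neighbourhood.
\<close>

lemma gelf_in:
  assumes a: "a \<in> T" shows "gelf a \<in> carrier (Func (Proj A) P)"
proof (rule B.Func_I[OF P_subalg gelf_ext])
  fix h and e :: real assume h: "h \<in> St (Proj A) P" and e: "e > 0"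
  obtain p where p: "p \<in> P" "h p" "nrm (sub a (gelf a h \<odot> \<one>) \<otimes> p) < e"
    using char_atE[OF h gelf_char_at[OF h a] e] .
  have "dist (gelf a k) (gelf a h) < e" if k: "k \<in> St (Proj A) P" "k p" for k
  proof -
    have s: "char_at k (sub a (gelf a h \<odot> \<one>)) (gelf a k - gelf a h)"
      using char_at_sub[OF k(1) a gelf_char_at[OF k(1) a] _ char_at_const[OF k(1)]] by simp
    have k1: "char_at k p 1" using char_at_proj[OF k(1) p(1)] k(2) by simp
    have "char_at k (sub a (gelf a h \<odot> \<one>) \<otimes> p) ((gelf a k - gelf a h) * 1)"
      using char_at_mult[OF k(1) _ s P_in[OF p(1)] k1] a by simp
    from char_at_bound[OF k(1) _ this] show ?thesis using p a P_in[OF p(1)] by (simp add: dist_norm)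
  qed
  then show "\<exists>c\<in>P. h c \<and> (\<forall>k\<in>St (Proj A) P. k c \<longrightarrow> dist (gelf a k) (gelf a h) < e)" using p by blast
qed

text \<open>
  The projections \<open>p\<close> for which \<open>a p\<close> is bounded by a given constant form an ideal.  If the constant exceeds
  all values of \<open>a\<close>, no point avoids this ideal, so it contains 1.
\<close>

lemma gelf_norm:
  assumes a: "a \<in> T" shows "cnorm (Func (Proj A) P) (gelf a) = nrm a"
proof (rule antisym)
  note ga = gelf_in[OF a]
  show "cnorm (Func (Proj A) P) (gelf a) \<le> nrm a"
    using B.cnorm_le_iff[OF P_subalg ga] nrm_ge[OF a] char_at_bound[OF _ a gelf_char_at[OF _ a]] by blast
  show "nrm a \<le> cnorm (Func (Proj A) P) (gelf a)"
  proof (rule field_le_epsilon)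
    fix e :: real assume e: "e > 0"
    let ?N = "cnorm (Func (Proj A) P) (gelf a)"
    define M where "M = ?N + e"
    have M: "M > 0" using B.cnorm_nonneg[OF P_subalg ga] e by (simp add: M_def)
    define I where "I = {p\<in>P. nrm (a \<otimes> p) \<le> M}"
    have I: "B.is_ideal P I"
      unfolding B.is_ideal_def
    proof (intro conjI ballI impI)
      show "I \<subseteq> P" by (auto simp: I_def)
      show "bzero (Proj A) \<in> I" using zero_P a M by (simp add: I_def Proj_simps pjoin_empty)
      show "y \<in> I" if x: "x \<in> I" and y: "y \<in> P" and le: "ble (Proj A) y x" for x y
      proof -
        have xP: "x \<in> P" "nrm (a \<otimes> x) \<le> M" using x by (auto simp: I_def)
        have "y = y \<otimes> x" using ble_Proj[OF y xP(1)] le by blast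
        then have "a \<otimes> y = (a \<otimes> x) \<otimes> y" using a P_in[OF y] P_in[OF xP(1)] mult_assoc mult_comm by metis
        then have "nrm (a \<otimes> y) \<le> nrm (a \<otimes> x)"
          using nrm_mult[of "a \<otimes> x" y] nrm_idem_le[OF P_D[OF y]] a P_in[OF y] P_in[OF xP(1)]
            mult_left_mono[of "nrm y" 1 "nrm (a \<otimes> x)"] nrm_ge[of "a \<otimes> x"] by simp
        then show ?thesis using xP y by (simp add: I_def)
      qed
      show "bjoin (Proj A) {x, y} \<in> I" if "x \<in> I" "y \<in> I" for x y
      proof -
        have x: "x \<in> P" "nrm (a \<otimes> x) \<le> M" and y: "y \<in> P" "nrm (a \<otimes> y) \<le> M" using that by (auto simp: I_def)
        show ?thesis
          using nrm_mult_join_le[OF a P_D[OF x(1)] P_D[OF y(1)] M x(2) y(2)] pjoin2[OF x(1) y(1)] union_P[OF x(1) y(1)]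
          by (simp add: I_def Proj_simps)
      qed
    qed
    have "btop (Proj A) \<in> I"
    proof (rule ccontr)
      assume "btop (Proj A) \<notin> I"
      then obtain h where h: "h \<in> St (Proj A) P" "\<And>x. x \<in> I \<Longrightarrow> \<not> h x"
        using B.ideal_avoided[OF P_subalg I] by blast
      let ?z = "gelf a h"
      have z: "cmod ?z \<le> ?N" using B.cnorm_upper[OF P_subalg ga h(1)] .
      obtain p where p: "p \<in> P" "h p" "nrm (sub a (?z \<odot> \<one>) \<otimes> p) < e"
        using char_atE[OF h(1) gelf_char_at[OF h(1) a] e] .
      have "a \<otimes> p = sub a (?z \<odot> \<one>) \<otimes> p \<oplus> ?z \<odot> p"
        using a P_in[OF p(1)] by - (rule lincons_eqI; simp add: lin)
      then have "nrm (a \<otimes> p) \<le> nrm (sub a (?z \<odot> \<one>) \<otimes> p) + cmod ?z * nrm p"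
        using nrm_add[of "sub a (?z \<odot> \<one>) \<otimes> p" "?z \<odot> p"] a P_in[OF p(1)] by (simp add: nrm_scal)
      then have "nrm (a \<otimes> p) \<le> M" using p z nrm_P_eq[OF h(1) p(1,2)] by (simp add: M_def)
      then have "p \<in> I" using p by (simp add: I_def)
      then show False using h(2) p(2) by blast
    qed
    then show "nrm a \<le> ?N + e" using a by (simp add: I_def btop_Proj M_def)
  qed
qed

definition delta :: "'a \<Rightarrow> 'a F_elem" where
  "delta a = F_class (Proj A) P (gelf a)"

abbreviation FA :: "'a F_elem pAWstar" where "FA \<equiv> F (Proj A)"

lemma delta_in: "a \<in> T \<Longrightarrow> delta a \<in> hat (Proj A) P"
  using gelf_in by (simp add: delta_def hat_def)

lemma delta_hom:
  assumes a: "a \<in> T" and b: "b \<in> T"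
  shows "delta (a \<oplus> b) = delta a \<oplus>\<^bsub>FA\<^esub> delta b"
    and "delta (a \<otimes> b) = delta a \<otimes>\<^bsub>FA\<^esub> delta b"
    and "delta (c \<odot> a) = c \<odot>\<^bsub>FA\<^esub> delta a"
    and "delta (star a) = invol FA (delta a)"
    and "delta (sub a b) = pminus FA (delta a) (delta b)"
    and "cnorm FA (delta a) = nrm a"
  using gelf_in[OF a] gelf_in[OF b] gelf_norm[OF a]
  by (simp_all add: delta_def gelf_hom[OF a b] B.F_ops[OF P_subalg] B.F_pminus[OF P_subalg])

lemma delta_smult: "a \<in> T \<Longrightarrow> delta (c \<odot> a) = c \<odot>\<^bsub>FA\<^esub> delta a"
  and delta_star: "a \<in> T \<Longrightarrow> delta (star a) = invol FA (delta a)"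
  and delta_norm: "a \<in> T \<Longrightarrow> cnorm FA (delta a) = nrm a"
  using delta_hom(3,4,6) by blast+

lemma delta_proj: "p \<in> P \<Longrightarrow> delta p = eta (Proj A) p"
  using gelf_proj B.F_class_chi[OF P_subalg] by (simp add: delta_def)

lemma delta_one: "delta \<one> = \<one>\<^bsub>FA\<^esub>"
proof -
  have "gelf \<one> = (\<lambda>h\<in>St (Proj A) P. 1)"
    unfolding gelf_proj[OF one_P] chi_def by (rule restrict_ext) (simp add: h_one)
  then show ?thesis by (simp add: delta_def B.F_const[OF P_subalg])
qed

lemma delta_inj: "a \<in> T \<Longrightarrow> b \<in> T \<Longrightarrow> delta a = delta b \<Longrightarrow> a = b"
proof -
  assume ab: "a \<in> T" "b \<in> T" "delta a = delta b"
  interpret H: cstar FA "hat (Proj A) P" using B.hat_Cstar[OF P_subalg] by (simp add: cstar_def)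
  have "nrm (sub a b) = cnorm FA (pminus FA (delta a) (delta b))"
    using delta_hom(5)[of a b] delta_norm[of "sub a b"] ab by simp
  also have "\<dots> = 0" using ab(3) delta_in[OF ab(2)] by simp
  finally show "a = b" using sub_eq_zero nrm_zero_iff ab by simp
qed

text \<open>
  The range is closed because the transform is isometric, and it contains the projections, which span a
  dense subspace.
\<close>

lemma delta_surj: "delta ` T = hat (Proj A) P"
proof -
  note aw' = B.hat_AWstar[OF P_subalg]
  interpret H: awstar FA "hat (Proj A) P"
    using aw' by (simp add: awstar_def awstar_axioms_def cstar_def comm_AWstar_on_def)
  show ?thesis
  proof (rule H.projections_dense)
    show "delta ` T \<subseteq> hat (Proj A) P" using delta_in by blast
    show "projections FA \<inter> hat (Proj A) P \<subseteq> delta ` T"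
      unfolding B.projections_hat[OF P_subalg] by (auto simp: delta_proj[symmetric])
    show "\<one>\<^bsub>FA\<^esub> \<in> delta ` T" by (simp add: delta_one[symmetric])
    show "u \<oplus>\<^bsub>FA\<^esub> v \<in> delta ` T" if "u \<in> delta ` T" "v \<in> delta ` T" for u v
      using that by (auto simp: delta_hom(1)[symmetric])
    show "c \<odot>\<^bsub>FA\<^esub> u \<in> delta ` T" if "u \<in> delta ` T" for u c
      using that by (auto simp: delta_smult[symmetric])
    fix u assume u: "u \<in> hat (Proj A) P"
      and app: "\<And>e. e > 0 \<Longrightarrow> \<exists>v\<in>delta ` T. cnorm FA (pminus FA u v) < e"
    have "\<forall>n::nat. \<exists>b. b \<in> T \<and> cnorm FA (pminus FA u (delta b)) < inverse (real (Suc n))"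
      using app[of "inverse (real (Suc _))"] by auto
    then obtain b where b: "\<And>n. b n \<in> T" "\<And>n::nat. cnorm FA (pminus FA u (delta (b n))) < inverse (real (Suc n))"
      by metis
    note db = delta_in[OF b(1)]
    have dist: "nrm (sub (b m) (b n)) < inverse (real (Suc m)) + inverse (real (Suc n))" for m n
    proof -
      have "nrm (sub (b m) (b n)) = cnorm FA (pminus FA (delta (b m)) (delta (b n)))"
        using delta_hom(5)[OF b(1) b(1), of m n] delta_norm[of "sub (b m) (b n)"] b(1) by simp
      also have "\<dots> \<le> cnorm FA (pminus FA u (delta (b m))) + cnorm FA (pminus FA u (delta (b n)))"
        using H.nrm_triangle[OF db u db, of m n] H.nrm_sub_commute[OF u db, of m] by simp
      also have "\<dots> < inverse (real (Suc m)) + inverse (real (Suc n))" by (intro add_strict_mono b(2))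
      finally show ?thesis .
    qed
    have "\<forall>e>0. \<exists>N. \<forall>m\<ge>N. \<forall>n\<ge>N. nrm (sub (b m) (b n)) < e"
    proof (intro allI impI)
      fix e :: real assume e: "e > 0"
      then obtain N where N: "\<And>m. m \<ge> N \<Longrightarrow> inverse (real (Suc m)) < e/2"
        using inverse_Suc_small[of "e/2"] by auto
      then have "nrm (sub (b m) (b n)) < e" if "m \<ge> N" "n \<ge> N" for m n
        using dist[of m n] N[OF that(1)] N[OF that(2)] by linarith
      then show "\<exists>N. \<forall>m\<ge>N. \<forall>n\<ge>N. nrm (sub (b m) (b n)) < e" by blast
    qed
    moreover have "range b \<subseteq> T" using b(1) by auto
    ultimately obtain x where x: "x \<in> T" "(\<lambda>n. nrm (sub (b n) x)) \<longlonglongrightarrow> 0" using complete' by blast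
    have "pminus FA u (delta x) = \<zero>\<^bsub>FA\<^esub>"
    proof (rule H.zero_by_limit)
      show "pminus FA u (delta x) \<in> hat (Proj A) P" using u delta_in[OF x(1)] by simp
      show "cnorm FA (pminus FA u (delta x)) \<le> inverse (real (Suc n)) + nrm (sub (b n) x)" for n
      proof -
        have "nrm (sub (b n) x) = cnorm FA (pminus FA (delta (b n)) (delta x))"
          using delta_hom(5)[OF b(1) x(1), of n] delta_norm[of "sub (b n) x"] b(1) x(1) by simp
        then show ?thesis using H.nrm_triangle[OF u db delta_in[OF x(1)], of n] b(2)[of n] by simp
      qed
      show "(\<lambda>n. inverse (real (Suc n)) + nrm (sub (b n) x)) \<longlonglongrightarrow> 0"
        using tendsto_add[OF LIMSEQ_inverse_real_of_nat x(2)] by simp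
    qed
    then have "u = delta x" using H.sub_eq_zero[OF u delta_in[OF x(1)]] by blast
    then show "u \<in> delta ` T" using x(1) by blast
  qed
qed

end

lemma gelf_mono:
  assumes A: "is_pAWstar A" and S: "awblock A S" and T: "awblock A T" and ST: "S \<subseteq> T" and a: "a \<in> S"
  shows "awblock.gelf A T a = Func_map (Proj A) (projections A \<inter> S) (projections A \<inter> T) (\<lambda>x. x) (awblock.gelf A S a)"
proof -
  interpret S: awblock A S by (rule S)
  interpret T: awblock A T by (rule T)
  show ?thesis
  proof (rule extensionalityI[OF T.gelf_ext])
    show "Func_map (Proj A) S.P T.P (\<lambda>x. x) (S.gelf a) \<in> extensional (St (Proj A) T.P)" by (simp add: Func_map_def)
    fix k assume k: "k \<in> St (Proj A) T.P"
    have k': "(\<lambda>x\<in>S.P. k x) \<in> St (Proj A) S.P"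
      using pcbool.St_restrict[OF pcbool_of[OF is_pCBool_Proj[OF A]] S.P_subalg _ k] ST by blast
    have "S.char_at (\<lambda>x\<in>S.P. k x) a (S.gelf a (\<lambda>x\<in>S.P. k x))" using S.gelf_char_at[OF k' a] .
    then have "T.char_at k a (S.gelf a (\<lambda>x\<in>S.P. k x))"
      unfolding S.char_at_def T.char_at_def using ST by fastforce
    then have "T.gelf a k = S.gelf a (\<lambda>x\<in>S.P. k x)" using T.gelf_eqI[OF k] a ST by blast
    then show "T.gelf a k = Func_map (Proj A) S.P T.P (\<lambda>x. x) (S.gelf a) k" using k by (simp add: Func_map_def)
  qed
qed


section \<open>The counit of the equivalence\<close>

text \<open>
  The inverse of the counit: an element of \<open>A\<close> is sent to the class of its Gelfand transform in any
  commutative AW*-algebra that contains it.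
\<close>

definition Delta :: "'a pAWstar \<Rightarrow> 'a \<Rightarrow> 'a F_elem" where
  "Delta A a = (SOME w. \<exists>T. awblock A T \<and> a \<in> T \<and>
     w = F_class (Proj A) (projections A \<inter> T) (awblock.gelf A T a))"

definition counit :: "'a pAWstar \<Rightarrow> 'a F_elem \<Rightarrow> 'a" where
  "counit A = restrict (inv_into (carrier A) (restrict (Delta A) (carrier A))) (carrier (F (Proj A)))"

context
  fixes A :: "'a pAWstar" assumes A: "is_pAWstar A"
begin

lemma pawblockI: "awblock A T \<Longrightarrow> pawblock A T"
  using A by (simp add: pawblock_def pawblock_axioms_def)

interpretation B: pcbool "Proj A"
  by (rule pcbool_of) (rule is_pCBool_Proj[OF A])

lemma delta_mono:
  assumes S: "awblock A S" and T: "awblock A T" and ST: "S \<subseteq> T" and a: "a \<in> S"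
  shows "pawblock.delta A T a = pawblock.delta A S a"
proof -
  interpret S: pawblock A S by (rule pawblockI[OF S])
  interpret T: pawblock A T by (rule pawblockI[OF T])
  show ?thesis
    unfolding S.delta_def T.delta_def gelf_mono[OF A S T ST a]
    by (rule B.F_class_res[OF S.P_subalg T.P_subalg _ S.gelf_in[OF a]]) (use ST in blast)
qed

lemma Delta_eq:
  assumes T: "awblock A T" and a: "a \<in> T"
  shows "Delta A a = pawblock.delta A T a"
proof -
  note pd = pawblock.delta_def[OF pawblockI]
  have "\<exists>T'. awblock A T' \<and> a \<in> T' \<and> Delta A a = F_class (Proj A) (projections A \<inter> T') (awblock.gelf A T' a)"
    unfolding Delta_def by (rule someI[of _ "pawblock.delta A T a"]) (use T a pd[OF T] in blast)
  then obtain T' where T': "awblock A T'" "a \<in> T'" "Delta A a = pawblock.delta A T' a" using pd by metis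
  note I = awblock_Int[OF T T'(1)]
  show ?thesis
    using T' delta_mono[OF I T _, of a] delta_mono[OF I T'(1) _, of a] a by simp
qed

lemma Delta_image: "awblock A T \<Longrightarrow> Delta A ` T = hat (Proj A) (projections A \<inter> T)"
  using pawblock.delta_surj[OF pawblockI] Delta_eq by (metis image_cong)

lemma Delta_inj_on_block: "awblock A T \<Longrightarrow> inj_on (Delta A) T"
  by (rule inj_onI) (metis Delta_eq pawblock.delta_inj pawblockI)

text \<open>
  The class of \<open>a\<close> is also represented over any algebra \<open>T'\<close> that contains \<open>a\<close>, hence over the intersection,
  where the transform is onto; injectivity over \<open>T'\<close> identifies \<open>a\<close> with an element of \<open>T\<close>.
\<close>

lemma Delta_in_hat:
  assumes a: "a \<in> carrier A" and T: "awblock A T" and m: "Delta A a \<in> hat (Proj A) (projections A \<inter> T)"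
  shows "a \<in> T"
proof -
  obtain T' where T': "awblock A T'" "a \<in> T'" using awblock_elem[OF A a] .
  interpret T: pawblock A T by (rule pawblockI[OF T])
  interpret T': pawblock A T' by (rule pawblockI[OF T'(1)])
  note I = awblock_Int[OF T T'(1)]
  have "Delta A a \<in> hat (Proj A) (projections A \<inter> T')" using Delta_image[OF T'(1)] T'(2) by blast
  then have "Delta A a \<in> hat (Proj A) (T.P \<inter> T'.P)" using m B.hat_Int[OF T.P_subalg T'.P_subalg] by blast
  moreover have "T.P \<inter> T'.P = projections A \<inter> (T \<inter> T')" by blast
  ultimately have "Delta A a \<in> Delta A ` (T \<inter> T')" using Delta_image[OF I] by simp
  then obtain c where c: "c \<in> T" "c \<in> T'" "Delta A a = Delta A c" by blast
  then have "a = c" using inj_onD[OF Delta_inj_on_block[OF T'(1)]] T'(2) by blast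
  then show ?thesis using c by blast
qed

lemma Delta_inj: "inj_on (Delta A) (carrier A)"
proof (rule inj_onI)
  fix a b assume ab: "a \<in> carrier A" "b \<in> carrier A" "Delta A a = Delta A b"
  obtain T where T: "awblock A T" "b \<in> T" using awblock_elem[OF A ab(2)] .
  then have "Delta A a \<in> hat (Proj A) (projections A \<inter> T)" using Delta_image[OF T(1)] ab(3) by auto
  then have "a \<in> T" using Delta_in_hat[OF ab(1) T(1)] by blast
  then show "a = b" using inj_onD[OF Delta_inj_on_block[OF T(1)]] ab T by blast
qed

lemma hat_in_block:
  assumes C: "C \<in> comm_subalgs (Proj A)"
  obtains T where "awblock A T" "hat (Proj A) C \<subseteq> Delta A ` T"
proof -
  obtain T where T: "awblock A T" "C \<subseteq> projections A \<inter> T" using subalg_in_awblock[OF A C] .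
  interpret T: awblock A T by (rule T(1))
  show ?thesis using that[OF T(1)] B.hat_mono[OF C T.P_subalg T(2)] Delta_image[OF T(1)] by blast
qed

lemma Delta_bij: "bij_betw (Delta A) (carrier A) (carrier (F (Proj A)))"
  unfolding bij_betw_def
proof (intro conjI Delta_inj equalityI subsetI)
  fix u assume "u \<in> Delta A ` carrier A"
  then obtain a where a: "a \<in> carrier A" "u = Delta A a" by blast
  obtain T where T: "awblock A T" "a \<in> T" using awblock_elem[OF A a(1)] .
  interpret T: awblock A T by (rule T(1))
  show "u \<in> carrier (F (Proj A))" using Delta_image[OF T(1)] T(2) a(2) B.hat_sub[OF T.P_subalg] by blast
next
  fix u assume "u \<in> carrier (F (Proj A))"
  then obtain C where C: "C \<in> comm_subalgs (Proj A)" "u \<in> hat (Proj A) C" by (auto simp: B.F_carrier_hat)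
  obtain T where T: "awblock A T" "hat (Proj A) C \<subseteq> Delta A ` T" using hat_in_block[OF C(1)] .
  then show "u \<in> Delta A ` carrier A" using C(2) awblock.sub[OF T(1)] by blast
qed

lemma Delta_hom: "restrict (Delta A) (carrier A) \<in> pAWstar_hom A (F (Proj A))" (is "?d \<in> _")
  unfolding pAWstar_hom_def
proof (intro CollectI conjI ballI allI impI)
  show "?d \<in> carrier A \<rightarrow>\<^sub>E carrier (F (Proj A))" using Delta_bij by (auto simp: bij_betw_def)
  fix p assume p: "p \<in> comm A"
  obtain a b where ab: "p = (a, b)" by (cases p)
  obtain T where T: "awblock A T" "a \<in> T" "b \<in> T" using awblock_pair[OF A] p ab by blast
  interpret T: pawblock A T by (rule pawblockI[OF T(1)])
  have d: "?d x = T.delta x" if "x \<in> T" for x using Delta_eq[OF T(1) that] T.sub that by auto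
  have "(T.delta a, T.delta b) \<in> comm (F (Proj A))"
    using T.delta_in T.P_subalg T by (auto simp: B.F_comm_iff)
  then show "case p of (a, b) \<Rightarrow> (?d a, ?d b) \<in> comm (F (Proj A)) \<and>
        ?d (a \<oplus>\<^bsub>A\<^esub> b) = ?d a \<oplus>\<^bsub>F (Proj A)\<^esub> ?d b \<and> ?d (a \<otimes>\<^bsub>A\<^esub> b) = ?d a \<otimes>\<^bsub>F (Proj A)\<^esub> ?d b"
    using T T.delta_hom(1,2)[OF T(2,3)] unfolding ab by (simp only: d T.add_in T.mult_in prod.case simp_thms)
next
  fix c a assume a: "a \<in> carrier A"
  obtain T where T: "awblock A T" "a \<in> T" using awblock_elem[OF A a] .
  interpret T: pawblock A T by (rule pawblockI[OF T(1)])
  have d: "?d x = T.delta x" if "x \<in> T" for x using Delta_eq[OF T(1) that] T.sub that by auto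
  show "?d (c \<odot>\<^bsub>A\<^esub> a) = c \<odot>\<^bsub>F (Proj A)\<^esub> ?d a"
    using T.delta_smult[OF T(2)] T(2) by (simp only: d T.scal_in)
next
  fix a assume a: "a \<in> carrier A"
  obtain T where T: "awblock A T" "a \<in> T" using awblock_elem[OF A a] .
  interpret T: pawblock A T by (rule pawblockI[OF T(1)])
  have d: "?d x = T.delta x" if "x \<in> T" for x using Delta_eq[OF T(1) that] T.sub that by auto
  show "?d (invol A a) = invol (F (Proj A)) (?d a)"
    using T.delta_star[OF T(2)] T(2) by (simp only: d T.star_in)
next
  obtain T where T: "awblock A T" using awblock_elem[OF A is_pAWstarD(4)[OF A]] by blast
  interpret T: pawblock A T by (rule pawblockI[OF T])
  show "?d \<one>\<^bsub>A\<^esub> = \<one>\<^bsub>F (Proj A)\<^esub>"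
    using Delta_eq[OF T T.one_in] T.delta_one is_pAWstarD(4)[OF A] by simp
next
  fix X assume X: "X \<subseteq> projections A" "X \<times> X \<subseteq> comm A"
  have Xc: "X \<subseteq> carrier A" using X by (auto simp: projections_def)
  obtain T where T: "awblock A T" "X \<subseteq> T" using awblock_exists[OF A Xc X(2)] by blast
  interpret T: pawblock A T by (rule pawblockI[OF T(1)])
  have d: "?d x = eta (Proj A) x" if "x \<in> T.P" for x
    using Delta_eq[OF T(1)] T.delta_proj[OF that] T.sub that by auto
  have XP: "X \<subseteq> T.P" using X T by blast
  have "?d ` X = eta (Proj A) ` X"
  proof (rule image_cong[OF refl])
    show "?d x = eta (Proj A) x" if "x \<in> X" for x by (rule d) (use that XP in blast)
  qed
  then show "?d (pjoin A X) = pjoin (F (Proj A)) (?d ` X)"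
    using B.F_pjoin[OF T.P_subalg XP] d[OF T.pjoin_in[OF XP]] by (simp add: T.Proj_simps)
qed

lemma Delta_reflects_comm:
  assumes ab: "a \<in> carrier A" "b \<in> carrier A" "(Delta A a, Delta A b) \<in> comm (F (Proj A))"
  shows "(a, b) \<in> comm A"
proof -
  obtain C where C: "C \<in> comm_subalgs (Proj A)" "Delta A a \<in> hat (Proj A) C" "Delta A b \<in> hat (Proj A) C"
    using ab(3) by (auto simp: B.F_comm_iff)
  obtain T where T: "awblock A T" "hat (Proj A) C \<subseteq> Delta A ` T" using hat_in_block[OF C(1)] .
  have "a \<in> T" "b \<in> T" using T C Delta_image[OF T(1)] Delta_in_hat[OF ab(1) T(1)] Delta_in_hat[OF ab(2) T(1)] by blast+
  then show ?thesis using awblock.T_comm[OF T(1)] by blast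
qed

lemma counit_iso: "pAWstar_iso (F (Proj A)) A (counit A)"
  unfolding counit_def
proof (rule pAWstar_iso_inv[OF A Delta_hom])
  show "bij_betw (restrict (Delta A) (carrier A)) (carrier A) (carrier (F (Proj A)))"
    using Delta_bij by (simp add: bij_betw_def inj_on_restrict_eq)
  show "comm (F (Proj A)) \<subseteq> carrier (F (Proj A)) \<times> carrier (F (Proj A))"
    using is_pAWstarD(1)[OF B.is_pAWstar_F] .
qed (use Delta_reflects_comm in auto)

lemma counit_Delta: "a \<in> carrier A \<Longrightarrow> counit A (Delta A a) = a"
  using Delta_bij inv_into_f_f[of "restrict (Delta A) (carrier A)" "carrier A" a]
  by (auto simp: counit_def bij_betw_def inj_on_restrict_eq)

end

text \<open>
  A morphism is contractive on commutative AW*-algebras, so it maps a projection that witnesses a value of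
  \<open>a\<close> to one that witnesses the same value of \<open>g a\<close>.
\<close>

lemma Delta_natural:
  assumes A: "is_pAWstar A" and A': "is_pAWstar A'" and g: "g \<in> pAWstar_hom A A'" and a: "a \<in> carrier A"
  shows "F_map (Proj A) (Proj A') (Proj_map A A' g) (Delta A a) = Delta A' (g a)"
proof -
  obtain T where T: "awblock A T" "a \<in> T" using awblock_elem[OF A a] .
  obtain T' where T': "awblock A' T'" "g ` T \<subseteq> T'" using hom_in_awblock[OF A' T(1) g] .
  interpret T: pawblock A T by (rule pawblockI[OF A T(1)])
  interpret T': pawblock A' T' by (rule pawblockI[OF A' T'(1)])
  let ?G = "Proj_map A A' g"
  note G = Proj_map_hom[OF A A' g]
  have GP: "?G p = g p" "g p \<in> T'.P" if "p \<in> T.P" for p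
    using that hom_projections[OF A g] T'(2) by (auto simp: Proj_map_def)
  have sub: "?G ` T.P \<subseteq> T'.P" using GP by auto
  note pB = is_pCBool_Proj[OF A] and pB' = is_pCBool_Proj[OF A']
  note sh = hom_subalg_hom[OF pB pB' G T.P_subalg sub]
  have cm: "(x, y) \<in> comm A" if "x \<in> T" "y \<in> T" for x y using T.T_comm that by blast
  have ct: "x \<in> carrier A" if "x \<in> T" for x using T.sub that by blast
  note gh = pAWstar_homD[OF g]
  have contr: "cnorm A' (g x) \<le> cnorm A x" if "x \<in> T" for x
    by (rule star_hom_contractive[OF T.cstar_axioms T'.cstar_axioms])
      (use T'(2) gh(3,4)[OF cm] gh(5,6)[OF ct] gh(7) that in auto)
  have "T'.gelf (g a) = Func_map (Proj A') T.P T'.P ?G (T.gelf a)"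
  proof (rule extensionalityI[OF T'.gelf_ext])
    show "Func_map (Proj A') T.P T'.P ?G (T.gelf a) \<in> extensional (St (Proj A') T'.P)"
      by (simp add: Func_map_def)
    fix h assume h: "h \<in> St (Proj A') T'.P"
    define k where "k = (\<lambda>p\<in>T.P. h (?G p))"
    have k: "k \<in> St (Proj A) T.P" unfolding k_def using T.B.St_pullback[OF T.P_subalg sh h] .
    let ?z = "T.gelf a k"
    have "T'.char_at h (g a) ?z"
      unfolding T'.char_at_def
    proof (intro allI impI)
      fix e :: real assume e: "e > 0"
      obtain p where p: "p \<in> T.P" "k p" "cnorm A (pminus A a (?z \<odot>\<^bsub>A\<^esub> \<one>\<^bsub>A\<^esub>) \<otimes>\<^bsub>A\<^esub> p) < e"
        using T.char_atE[OF k T.gelf_char_at[OF k T(2)] e] .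
      note pT = T.P_in[OF p(1)]
      have m: "?z \<odot>\<^bsub>A\<^esub> \<one>\<^bsub>A\<^esub> \<in> T" "(- 1) \<odot>\<^bsub>A\<^esub> (?z \<odot>\<^bsub>A\<^esub> \<one>\<^bsub>A\<^esub>) \<in> T" "pminus A a (?z \<odot>\<^bsub>A\<^esub> \<one>\<^bsub>A\<^esub>) \<in> T"
        using T(2) by simp_all
      have "g (pminus A a (?z \<odot>\<^bsub>A\<^esub> \<one>\<^bsub>A\<^esub>)) = pminus A' (g a) (?z \<odot>\<^bsub>A'\<^esub> \<one>\<^bsub>A'\<^esub>)"
        unfolding pminus_def
        by (simp only: gh(3)[OF cm[OF T(2) m(2)]] gh(5)[OF ct[OF m(1)]] gh(5)[OF ct[OF T.one_in]] gh(7))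
      then have "g (pminus A a (?z \<odot>\<^bsub>A\<^esub> \<one>\<^bsub>A\<^esub>) \<otimes>\<^bsub>A\<^esub> p) = pminus A' (g a) (?z \<odot>\<^bsub>A'\<^esub> \<one>\<^bsub>A'\<^esub>) \<otimes>\<^bsub>A'\<^esub> g p"
        using gh(4)[OF cm[OF m(3) pT]] by simp
      then have "cnorm A' (pminus A' (g a) (?z \<odot>\<^bsub>A'\<^esub> \<one>\<^bsub>A'\<^esub>) \<otimes>\<^bsub>A'\<^esub> g p) < e"
        using contr[OF T.mult_in[OF m(3) pT]] p(3) by simp
      moreover have "h (g p)" using p GP by (simp add: k_def)
      ultimately show "\<exists>p\<in>T'.P. h p \<and> cnorm A' (pminus A' (g a) (?z \<odot>\<^bsub>A'\<^esub> \<one>\<^bsub>A'\<^esub>) \<otimes>\<^bsub>A'\<^esub> p) < e"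
        using GP(2)[OF p(1)] by blast
    qed
    then have "T'.gelf (g a) h = ?z" using T'.gelf_eqI[OF h] T'(2) T(2) by blast
    then show "T'.gelf (g a) h = Func_map (Proj A') T.P T'.P ?G (T.gelf a) h"
      using h by (simp add: Func_map_def k_def)
  qed
  then have "F_map (Proj A) (Proj A') ?G (T.delta a) = T'.delta (g a)"
    using F_map_class[OF pB pB' G T.P_subalg T'.P_subalg sub T.gelf_in[OF T(2)]]
    by (simp add: T.delta_def T'.delta_def)
  then show ?thesis using Delta_eq[OF A T] Delta_eq[OF A' T'(1), of "g a"] T'(2) T(2) by auto
qed

section \<open>The equivalence of categories\<close>

lemma pCBool_hom_ident: "is_pCBool B \<Longrightarrow> (\<lambda>x\<in>carrier B. x) \<in> pCBool_hom B B"
  unfolding pCBool_hom_def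
proof (intro CollectI conjI ballI allI impI)
  assume B: "is_pCBool B"
  fix p assume "p \<in> bcomm B"
  then show "case p of (x, y) \<Rightarrow> ((\<lambda>x\<in>carrier B. x) x, (\<lambda>x\<in>carrier B. x) y) \<in> bcomm B"
    using B by (auto simp: is_pCBool_def)
next
  assume B: "is_pCBool B"
  show "(\<lambda>x\<in>carrier B. x) (bneg B x) = bneg B ((\<lambda>x\<in>carrier B. x) x)" if "x \<in> carrier B" for x
    using B that by (auto simp: is_pCBool_def)
  show "(\<lambda>x\<in>carrier B. x) (bjoin B X) = bjoin B ((\<lambda>x\<in>carrier B. x) ` X)"
    if "X \<subseteq> carrier B" "X \<times> X \<subseteq> bcomm B" for X
  proof -
    have "bjoin B X \<in> carrier B" using B that by (simp add: is_pCBool_def)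
    moreover have "(\<lambda>x\<in>carrier B. x) ` X = X" using that(1) by (auto simp: image_iff)
    ultimately show ?thesis by simp
  qed
qed auto

lemma pCBool_hom_compose:
  assumes B: "is_pCBool B" and f: "f \<in> pCBool_hom B B'" and g: "g \<in> pCBool_hom B' B''"
  shows "compose (carrier B) g f \<in> pCBool_hom B B''"
  unfolding pCBool_hom_def
proof (intro CollectI conjI ballI allI impI)
  note f' = pCBool_homD[OF f] and g' = pCBool_homD[OF g]
  show "compose (carrier B) g f \<in> carrier B \<rightarrow>\<^sub>E carrier B''" using f' g' by (auto simp: compose_def)
  fix p assume p: "p \<in> bcomm B"
  obtain x y where xy: "p = (x, y)" by (cases p)
  have "x \<in> carrier B" "y \<in> carrier B" using B p xy by (auto simp: is_pCBool_def)
  then show "case p of (x, y) \<Rightarrow> (compose (carrier B) g f x, compose (carrier B) g f y) \<in> bcomm B''"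
    using f'(2) g'(2) p xy by (simp add: compose_def)
next
  note f' = pCBool_homD[OF f] and g' = pCBool_homD[OF g]
  show "compose (carrier B) g f (bneg B x) = bneg B'' (compose (carrier B) g f x)" if x: "x \<in> carrier B" for x
  proof -
    have "bneg B x \<in> carrier B" using B x by (simp add: is_pCBool_def)
    then show ?thesis using f'(1,3)[OF x] g'(3) x by (simp add: compose_def)
  qed
  show "compose (carrier B) g f (bjoin B X) = bjoin B'' (compose (carrier B) g f ` X)"
    if X: "X \<subseteq> carrier B" "X \<times> X \<subseteq> bcomm B" for X
  proof -
    have "bjoin B X \<in> carrier B" using B X by (simp add: is_pCBool_def)
    moreover have "f ` X \<subseteq> carrier B'" "f ` X \<times> f ` X \<subseteq> bcomm B'" using X f'(1,2) by blast+
    moreover have "compose (carrier B) g f ` X = g ` f ` X"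
      unfolding image_image by (rule image_cong) (use X in \<open>auto simp: compose_def\<close>)
    ultimately show ?thesis using f'(4)[OF X] g'(4)[of "f ` X"] by (simp add: compose_def)
  qed
qed

lemma pAWstar_closed:
  assumes A: "is_pAWstar A"
  shows "(a, b) \<in> comm A \<Longrightarrow> a \<oplus>\<^bsub>A\<^esub> b \<in> carrier A" "(a, b) \<in> comm A \<Longrightarrow> a \<otimes>\<^bsub>A\<^esub> b \<in> carrier A"
    "a \<in> carrier A \<Longrightarrow> c \<odot>\<^bsub>A\<^esub> a \<in> carrier A" "a \<in> carrier A \<Longrightarrow> invol A a \<in> carrier A"
    "X \<subseteq> projections A \<Longrightarrow> X \<times> X \<subseteq> comm A \<Longrightarrow> pjoin A X \<in> projections A"
    "(a, b) \<in> comm A \<Longrightarrow> a \<in> carrier A \<and> b \<in> carrier A"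
  using assms unfolding is_pAWstar_def is_pCstar_def by auto

lemma projections_sub: "projections A \<subseteq> carrier A"
  by (auto simp: projections_def)

lemma pAWstar_hom_ident: "is_pAWstar A \<Longrightarrow> (\<lambda>x\<in>carrier A. x) \<in> pAWstar_hom A A"
  unfolding pAWstar_hom_def
proof (intro CollectI conjI ballI allI impI)
  assume A: "is_pAWstar A"
  note cl = pAWstar_closed[OF A]
  fix p assume p: "p \<in> comm A"
  obtain x y where xy: "p = (x, y)" by (cases p)
  then show "case p of (a, b) \<Rightarrow> ((\<lambda>x\<in>carrier A. x) a, (\<lambda>x\<in>carrier A. x) b) \<in> comm A \<and>
      (\<lambda>x\<in>carrier A. x) (a \<oplus>\<^bsub>A\<^esub> b) = (\<lambda>x\<in>carrier A. x) a \<oplus>\<^bsub>A\<^esub> (\<lambda>x\<in>carrier A. x) b \<and>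
      (\<lambda>x\<in>carrier A. x) (a \<otimes>\<^bsub>A\<^esub> b) = (\<lambda>x\<in>carrier A. x) a \<otimes>\<^bsub>A\<^esub> (\<lambda>x\<in>carrier A. x) b"
    using p cl(1,2,6)[of x y] by simp
next
  assume A: "is_pAWstar A"
  note cl = pAWstar_closed[OF A]
  show "(\<lambda>x\<in>carrier A. x) (c \<odot>\<^bsub>A\<^esub> a) = c \<odot>\<^bsub>A\<^esub> (\<lambda>x\<in>carrier A. x) a" if "a \<in> carrier A" for a c
    using cl(3) that by simp
  show "(\<lambda>x\<in>carrier A. x) (invol A a) = invol A ((\<lambda>x\<in>carrier A. x) a)" if "a \<in> carrier A" for a
    using cl(4) that by simp
  show "(\<lambda>x\<in>carrier A. x) \<one>\<^bsub>A\<^esub> = \<one>\<^bsub>A\<^esub>" using is_pAWstarD(4)[OF A] by simp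
  show "(\<lambda>x\<in>carrier A. x) (pjoin A X) = pjoin A ((\<lambda>x\<in>carrier A. x) ` X)"
    if "X \<subseteq> projections A" "X \<times> X \<subseteq> comm A" for X
  proof -
    have "pjoin A X \<in> carrier A" by (rule subsetD[OF projections_sub cl(5)[OF that]])
    moreover have "(\<lambda>x\<in>carrier A. x) ` X = X" using that(1) projections_sub[of A] by (force simp: image_iff)
    ultimately show ?thesis by simp
  qed
qed auto

lemma pAWstar_hom_compose:
  assumes A: "is_pAWstar A" and f: "f \<in> pAWstar_hom A A'" and g: "g \<in> pAWstar_hom A' A''"
  shows "compose (carrier A) g f \<in> pAWstar_hom A A''"
  unfolding pAWstar_hom_def
proof (intro CollectI conjI ballI allI impI)
  note f' = pAWstar_homD[OF f] and g' = pAWstar_homD[OF g] and cl = pAWstar_closed[OF A]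
  show "compose (carrier A) g f \<in> carrier A \<rightarrow>\<^sub>E carrier A''" using f'(1) g'(1) by (auto simp: compose_def)
  fix p assume p: "p \<in> comm A"
  obtain x y where xy: "p = (x, y)" by (cases p)
  have c: "(x, y) \<in> comm A" using p xy by simp
  show "case p of (a, b) \<Rightarrow> (compose (carrier A) g f a, compose (carrier A) g f b) \<in> comm A'' \<and>
      compose (carrier A) g f (a \<oplus>\<^bsub>A\<^esub> b) = compose (carrier A) g f a \<oplus>\<^bsub>A''\<^esub> compose (carrier A) g f b \<and>
      compose (carrier A) g f (a \<otimes>\<^bsub>A\<^esub> b) = compose (carrier A) g f a \<otimes>\<^bsub>A''\<^esub> compose (carrier A) g f b"
    using cl(1,2,6)[OF c] f'(2-4)[OF c] g'(2-4)[OF f'(2)[OF c]] by (simp add: xy compose_def)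
next
  note f' = pAWstar_homD[OF f] and g' = pAWstar_homD[OF g] and cl = pAWstar_closed[OF A]
  show "compose (carrier A) g f (c \<odot>\<^bsub>A\<^esub> a) = c \<odot>\<^bsub>A''\<^esub> compose (carrier A) g f a" if a: "a \<in> carrier A" for a c
    using cl(3)[OF a] f'(1,5)[OF a] g'(5) a by (simp add: compose_def)
  show "compose (carrier A) g f (invol A a) = invol A'' (compose (carrier A) g f a)" if a: "a \<in> carrier A" for a
    using cl(4)[OF a] f'(1,6)[OF a] g'(6) a by (simp add: compose_def)
  show "compose (carrier A) g f \<one>\<^bsub>A\<^esub> = \<one>\<^bsub>A''\<^esub>" using is_pAWstarD(4)[OF A] f'(7) g'(7) by (simp add: compose_def)
  show "compose (carrier A) g f (pjoin A X) = pjoin A'' (compose (carrier A) g f ` X)"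
    if X: "X \<subseteq> projections A" "X \<times> X \<subseteq> comm A" for X
  proof -
    have Xc: "X \<subseteq> carrier A" by (rule subset_trans[OF X(1) projections_sub])
    have "pjoin A X \<in> carrier A" by (rule subsetD[OF projections_sub cl(5)[OF X]])
    moreover have "f ` X \<subseteq> projections A'" using X(1) hom_projections[OF A f] by blast
    moreover have "f ` X \<times> f ` X \<subseteq> comm A'" using X(2) f'(2) by blast
    moreover have "compose (carrier A) g f ` X = g ` f ` X"
      unfolding image_image by (rule image_cong) (use Xc in \<open>auto simp: compose_def\<close>)
    ultimately show ?thesis using f'(8)[OF X] g'(8)[of "f ` X"] by (simp add: compose_def)
  qed
qed

lemma compose_ident:
  assumes "f \<in> X \<rightarrow>\<^sub>E Y"
  shows "compose X f (\<lambda>x\<in>X. x) = f" "compose X (\<lambda>y\<in>Y. y) f = f"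
  using assms by (auto simp: compose_def fun_eq_iff PiE_def extensional_def Pi_def)

lemma category_pCBool: "is_category (pCBool_cat :: ('b pCBool, 'b \<Rightarrow> 'b) cat)"
proof -
  have ext: "f \<in> carrier X \<rightarrow>\<^sub>E carrier Y" if "f \<in> pCBool_hom X Y" for f and X Y :: "'b pCBool"
    using that by (simp add: pCBool_hom_def)
  show ?thesis
    unfolding is_category_def pCBool_cat_def cat.simps
  proof (intro conjI ballI)
    fix X Y :: "'b pCBool" and f assume "f \<in> pCBool_hom X Y"
    note f = ext[OF this]
    show "compose (carrier X) f (\<lambda>x\<in>carrier X. x) = f" "compose (carrier X) (\<lambda>x\<in>carrier Y. x) f = f"
      using compose_ident[OF f] by auto
    fix Z W :: "'b pCBool" and g h
    show "compose (carrier X) h (compose (carrier X) g f) = compose (carrier X) (compose (carrier Y) h g) f"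
      using f by (intro compose_assoc) (auto simp: PiE_iff)
  qed (use pCBool_hom_ident pCBool_hom_compose in auto)
qed

lemma category_pAWstar: "is_category (pAWstar_cat :: ('a pAWstar, 'a \<Rightarrow> 'a) cat)"
proof -
  have ext: "f \<in> carrier X \<rightarrow>\<^sub>E carrier Y" if "f \<in> pAWstar_hom X Y" for f and X Y :: "'a pAWstar"
    using that by (simp add: pAWstar_hom_def)
  show ?thesis
    unfolding is_category_def pAWstar_cat_def cat.simps
  proof (intro conjI ballI)
    fix X Y :: "'a pAWstar" and f assume "f \<in> pAWstar_hom X Y"
    note f = ext[OF this]
    show "compose (carrier X) f (\<lambda>x\<in>carrier X. x) = f" "compose (carrier X) (\<lambda>x\<in>carrier Y. x) f = f"
      using compose_ident[OF f] by auto
    fix Z W :: "'a pAWstar" and g h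
    show "compose (carrier X) h (compose (carrier X) g f) = compose (carrier X) (compose (carrier Y) h g) f"
      using f by (intro compose_assoc) (auto simp: PiE_iff)
  qed (use pAWstar_hom_ident pAWstar_hom_compose in auto)
qed

lemma functor_F: "is_functor (pCBool_cat :: ('b pCBool, 'b \<Rightarrow> 'b) cat) pAWstar_cat F F_map"
  unfolding is_functor_def pCBool_cat_def pAWstar_cat_def cat.simps
proof (intro conjI ballI)
  fix X :: "'b pCBool" assume "X \<in> {B. is_pCBool B}"
  then have X: "is_pCBool X" by simp
  show "F X \<in> {A. is_pAWstar A}" using pcbool.is_pAWstar_F[OF pcbool_of[OF X]] by simp
  show "F_map X X (\<lambda>x\<in>carrier X. x) = (\<lambda>a\<in>carrier (F X). a)"
    by (rule F_map_ident[OF X pCBool_hom_ident[OF X]])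
  fix Y :: "'b pCBool" and f assume "Y \<in> {B. is_pCBool B}" and f: "f \<in> pCBool_hom X Y"
  then have Y: "is_pCBool Y" by simp
  show "F_map X Y f \<in> pAWstar_hom (F X) (F Y)" by (rule F_map_hom[OF X Y f])
  fix Z :: "'b pCBool" and g assume "Z \<in> {B. is_pCBool B}" and g: "g \<in> pCBool_hom Y Z"
  then have Z: "is_pCBool Z" by simp
  show "F_map X Z (compose (carrier X) g f) = compose (carrier (F X)) (F_map Y Z g) (F_map X Y f)"
    by (rule F_map_comp[OF X Y Z f g pCBool_hom_compose[OF X f g]])
qed

lemma functor_Proj: "is_functor (pAWstar_cat :: ('a pAWstar, 'a \<Rightarrow> 'a) cat) pCBool_cat Proj Proj_map"
  unfolding is_functor_def pCBool_cat_def pAWstar_cat_def cat.simps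
proof (intro conjI ballI)
  fix X :: "'a pAWstar" assume "X \<in> {A. is_pAWstar A}"
  then have X: "is_pAWstar X" by simp
  show "Proj X \<in> {B. is_pCBool B}" using is_pCBool_Proj[OF X] by simp
  show "Proj_map X X (\<lambda>a\<in>carrier X. a) = (\<lambda>x\<in>carrier (Proj X). x)"
    using projections_sub[of X] by (auto simp: Proj_map_def Proj_def fun_eq_iff)
  fix Y :: "'a pAWstar" and f assume "Y \<in> {A. is_pAWstar A}" and f: "f \<in> pAWstar_hom X Y"
  then have Y: "is_pAWstar Y" by simp
  show "Proj_map X Y f \<in> pCBool_hom (Proj X) (Proj Y)" by (rule Proj_map_hom[OF X Y f])
  fix Z :: "'a pAWstar" and g assume "Z \<in> {A. is_pAWstar A}" and g: "g \<in> pAWstar_hom Y Z"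
  show "Proj_map X Z (compose (carrier X) g f)
      = compose (carrier (Proj X)) (Proj_map Y Z g) (Proj_map X Y f)"
    using projections_sub[of X] hom_projections[OF X f]
    by (auto simp: Proj_map_def Proj_def compose_def fun_eq_iff)
qed

lemma eta_natural:
  assumes B: "is_pCBool B" and B': "is_pCBool B'" and g: "g \<in> pCBool_hom B B'"
  shows "compose (carrier B) (restrict (eta B') (carrier B')) g =
    compose (carrier B) (Proj_map (F B) (F B') (F_map B B' g)) (restrict (eta B) (carrier B))"
proof
  interpret pcbool B by (rule pcbool_of[OF B])
  fix x
  show "compose (carrier B) (restrict (eta B') (carrier B')) g x =
    compose (carrier B) (Proj_map (F B) (F B') (F_map B B' g)) (restrict (eta B) (carrier B)) x"
    using F_map_eta[OF B B' g] pCBool_homD(1)[OF g] projections_F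
    by (cases "x \<in> carrier B") (auto simp: compose_def Proj_map_def)
qed

lemma counit_natural:
  assumes A: "is_pAWstar A" and A': "is_pAWstar A'" and g: "g \<in> pAWstar_hom A A'"
  shows "compose (carrier (F (Proj A))) (counit A') (F_map (Proj A) (Proj A') (Proj_map A A' g)) =
    compose (carrier (F (Proj A))) g (counit A)"
proof
  fix u
  show "compose (carrier (F (Proj A))) (counit A') (F_map (Proj A) (Proj A') (Proj_map A A' g)) u =
    compose (carrier (F (Proj A))) g (counit A) u"
  proof (cases "u \<in> carrier (F (Proj A))")
    case True
    then obtain a where a: "a \<in> carrier A" "u = Delta A a"
      using Delta_bij[OF A] by (auto simp: bij_betw_def)
    then show ?thesis
      using True Delta_natural[OF A A' g a(1)] counit_Delta[OF A a(1)]
        counit_Delta[OF A' pAWstar_homD(1)[OF g a(1)]] by (simp add: compose_def)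
  qed (simp add: compose_def)
qed

theorem theorem2p14:
  shows "is_category (pCBool_cat :: ('b pCBool, 'b \<Rightarrow> 'b) cat) \<and>
    is_category (pAWstar_cat :: ('a pAWstar, 'a \<Rightarrow> 'a) cat) \<and>
    is_functor (pCBool_cat :: ('b pCBool, 'b \<Rightarrow> 'b) cat) pAWstar_cat F F_map \<and>
    is_functor (pAWstar_cat :: ('a pAWstar, 'a \<Rightarrow> 'a) cat) pCBool_cat Proj Proj_map \<and>
    (\<exists>\<eta> :: 'b pCBool \<Rightarrow> 'b \<Rightarrow> 'b F_elem.
      (\<forall>B. is_pCBool B \<longrightarrow> pCBool_iso B (Proj (F B)) (\<eta> B)) \<and>
      (\<forall>B B' g. is_pCBool B \<and> is_pCBool B' \<and> g \<in> pCBool_hom B B' \<longrightarrow>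
         compose (carrier B) (\<eta> B') g =
         compose (carrier B) (Proj_map (F B) (F B') (F_map B B' g)) (\<eta> B))) \<and>
    (\<exists>\<epsilon> :: 'a pAWstar \<Rightarrow> 'a F_elem \<Rightarrow> 'a.
      (\<forall>A. is_pAWstar A \<longrightarrow> pAWstar_iso (F (Proj A)) A (\<epsilon> A)) \<and>
      (\<forall>A A' g. is_pAWstar A \<and> is_pAWstar A' \<and> g \<in> pAWstar_hom A A' \<longrightarrow>
         compose (carrier (F (Proj A))) (\<epsilon> A') (F_map (Proj A) (Proj A') (Proj_map A A' g)) =
         compose (carrier (F (Proj A))) g (\<epsilon> A)))"
proof (intro conjI)
  show "is_category (pCBool_cat :: ('b pCBool, 'b \<Rightarrow> 'b) cat)" by (rule category_pCBool)
  show "is_category (pAWstar_cat :: ('a pAWstar, 'a \<Rightarrow> 'a) cat)" by (rule category_pAWstar)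
  show "is_functor (pCBool_cat :: ('b pCBool, 'b \<Rightarrow> 'b) cat) pAWstar_cat F F_map" by (rule functor_F)
  show "is_functor (pAWstar_cat :: ('a pAWstar, 'a \<Rightarrow> 'a) cat) pCBool_cat Proj Proj_map"
    by (rule functor_Proj)
  show "\<exists>\<eta> :: 'b pCBool \<Rightarrow> 'b \<Rightarrow> 'b F_elem.
      (\<forall>B. is_pCBool B \<longrightarrow> pCBool_iso B (Proj (F B)) (\<eta> B)) \<and>
      (\<forall>B B' g. is_pCBool B \<and> is_pCBool B' \<and> g \<in> pCBool_hom B B' \<longrightarrow>
         compose (carrier B) (\<eta> B') g =
         compose (carrier B) (Proj_map (F B) (F B') (F_map B B' g)) (\<eta> B))"
    using pcbool.eta_iso[OF pcbool_of] eta_natural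
    by (intro exI[of _ "\<lambda>B. restrict (eta B) (carrier B)"]) blast
  show "\<exists>\<epsilon> :: 'a pAWstar \<Rightarrow> 'a F_elem \<Rightarrow> 'a.
      (\<forall>A. is_pAWstar A \<longrightarrow> pAWstar_iso (F (Proj A)) A (\<epsilon> A)) \<and>
      (\<forall>A A' g. is_pAWstar A \<and> is_pAWstar A' \<and> g \<in> pAWstar_hom A A' \<longrightarrow>
         compose (carrier (F (Proj A))) (\<epsilon> A') (F_map (Proj A) (Proj A') (Proj_map A A' g)) =
         compose (carrier (F (Proj A))) g (\<epsilon> A))"
    using counit_iso counit_natural by blast
qed

end
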